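(* In the setting of the context, let $S(t)$, $t\ge 0$, be the resolvent operators corresponding to the Volterra equation $X(t)=X_0+\int_0^t a(t-\tau)AX(\tau)\,d\tau+f(t)$. Then, for an arbitrary process $\Psi\in\mathcal N^2(0,T;L_2^0)$, the process $$W^\Psi(t):=\int_0^t S(t-\tau)\Psi(\tau)\,dW(\tau),\qquad t\in[0,T],$$ has a predictable version.
   Context: $H$ and $U$ are separable (real) Hilbert spaces and $T>0$ is fixed. $(\Omega,\mathcal F,(\mathcal F_t)_{t\ge0},P)$ is a filtered probability space whose filtration is normal ($\mathcal F_0$ contains all $P$-null sets of $\mathcal F$, and $\mathcal F_t=\bigcap_{s>t}\mathcal F_s$). $W$ is a cylindrical Wiener process with respect to $(\mathcal F_t)$ with nonnegative covariance operator $Q\in L(U)$ ($\mathrm{Tr}\,Q<\infty$ is not assumed). There is a complete orthonormal set $\{e_k\}\subset U$ of eigenvectors of $Q$ with eigenvalues $\lambda_k$, and $W(t)=\sum_k e_k\beta_k(t)$ with independent real Wiener processes $\beta_k$, $\mathbb E\beta_k^2(t)=\lambda_k t$. $U_0:=Q^{1/2}(U)$ with inner product $\langle u,v\rangle_{U_0}=\langle Q^{-1/2}u,Q^{-1/2}v\rangle_U$. $L_2^0:=L_2(U_0,H)$ is the space of Hilbert-Schmidt operators from $U_0$ to $H$ with the Hilbert-Schmidt norm. $\mathcal N^2(0,T;L_2^0)$ is the space of $L_2^0$-valued predictable processes $\Phi$ on $[0,T]$ with $\mathbb E\int_0^T|\Phi(\tau)|_{L_2^0}^2d\tau<\infty$.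 Stochastic integrals are the usual Hilbert-space stochastic integrals with respect to the cylindrical Wiener process $W$. Volterra assumptions: $A:D(A)\subset H\to H$ is a closed, densely defined unbounded linear operator; $a\in L^1_{\mathrm{loc}}(\mathbb R_+)$; and the deterministic Volterra equation $X(t)=X_0+\int_0^t a(t-\tau)AX(\tau)\,d\tau+f(t)$ is well-posed, i.e. it admits a resolvent $(S(t))_{t\ge0}$: a family of bounded linear operators on $H$ such that (1) $S$ is strongly continuous on $\mathbb R_+$ and $S(0)=I$; (2) $S(t)D(A)\subset D(A)$ and $AS(t)x=S(t)Ax$ for $x\in D(A)$, $t\ge0$; (3) $S(t)x=x+\int_0^t a(t-\tau)AS(\tau)x\,d\tau$ for all $x\in D(A)$, $t\ge0$. *)

theory Defs
  imports "HOL-Probability.Probability"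
begin

text \<open>Separable real Hilbert spaces are types of sort
  \<open>{real_inner, banach, second_countable_topology}\<close>. All time parameters are reals; only their
  restriction to nonnegative values matters.\<close>

definition nonneg_operator :: "('u::real_inner \<Rightarrow> 'u) \<Rightarrow> bool" where
  "nonneg_operator Q \<longleftrightarrow>
     bounded_linear Q \<and> (\<forall>x y. inner (Q x) y = inner x (Q y)) \<and> (\<forall>x. 0 \<le> inner (Q x) x)"

definition operator_sqrt :: "('u::real_inner \<Rightarrow> 'u) \<Rightarrow> 'u \<Rightarrow> 'u" where
  "operator_sqrt Q = (THE R. nonneg_operator R \<and> R \<circ> R = Q)"

text \<open>\<open>Q\<close> may have a kernel, so \<open>Q\<^sup>-\<^sup>1\<^sup>/\<^sup>2\<close> is the pseudo-inverse of \<open>Q\<^sup>1\<^sup>/\<^sup>2\<close>: it picks the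
  preimage that is orthogonal to the kernel (equivalently, the one of minimal norm).\<close>

definition pseudo_inverse :: "('u::real_inner \<Rightarrow> 'u) \<Rightarrow> 'u \<Rightarrow> 'u" where
  "pseudo_inverse R u = (THE x. R x = u \<and> (\<forall>z. R z = 0 \<longrightarrow> inner x z = 0))"

definition U0 :: "('u::real_inner \<Rightarrow> 'u) \<Rightarrow> 'u set" where
  "U0 Q = range (operator_sqrt Q)"

definition inner_U0 :: "('u::real_inner \<Rightarrow> 'u) \<Rightarrow> 'u \<Rightarrow> 'u \<Rightarrow> real" where
  "inner_U0 Q u v =
     inner (pseudo_inverse (operator_sqrt Q) u) (pseudo_inverse (operator_sqrt Q) v)"

definition norm_U0 :: "('u::real_inner \<Rightarrow> 'u) \<Rightarrow> 'u \<Rightarrow> real" where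
  "norm_U0 Q u = sqrt (inner_U0 Q u u)"

definition orthonormal_basis_U0 :: "('u::real_inner \<Rightarrow> 'u) \<Rightarrow> 'u set \<Rightarrow> bool" where
  "orthonormal_basis_U0 Q B \<longleftrightarrow>
     B \<subseteq> U0 Q \<and>
     (\<forall>b\<in>B. \<forall>c\<in>B. inner_U0 Q b c = (if b = c then 1 else 0)) \<and>
     (\<forall>v\<in>U0 Q. (\<forall>b\<in>B. inner_U0 Q v b = 0) \<longrightarrow> v = 0)"

definition linear_on_set :: "'a::real_vector set \<Rightarrow> ('a \<Rightarrow> 'b::real_vector) \<Rightarrow> bool" where
  "linear_on_set V f \<longleftrightarrow>
     (\<forall>x\<in>V. \<forall>y\<in>V. f (x + y) = f x + f y) \<and> (\<forall>c. \<forall>x\<in>V. f (c *\<^sub>R x) = c *\<^sub>R f x)"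

text \<open>An operator on \<open>U\<^sub>0\<close> is a function on the whole type that vanishes off \<open>U\<^sub>0\<close>;
  this makes its representation unique. Boundedness is a separate requirement: a linear map that is
  square-summable along one orthonormal basis need not be bounded.\<close>

definition L20 :: "('u::real_inner \<Rightarrow> 'u) \<Rightarrow> ('u \<Rightarrow> 'h::real_normed_vector) set" where
  "L20 Q = {\<Phi>. linear_on_set (U0 Q) \<Phi> \<and>
                (\<forall>u. u \<notin> U0 Q \<longrightarrow> \<Phi> u = 0) \<and>
                (\<exists>C. \<forall>u\<in>U0 Q. norm (\<Phi> u) \<le> C * norm_U0 Q u) \<and>
                (\<forall>B. orthonormal_basis_U0 Q B \<longrightarrow> (\<lambda>b. (norm (\<Phi> b))\<^sup>2) summable_on B)}"

text \<open>The sum below does not depend on the chosen basis.\<close>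

definition L20_norm :: "('u::real_inner \<Rightarrow> 'u) \<Rightarrow> ('u \<Rightarrow> 'h::real_normed_vector) \<Rightarrow> real" where
  "L20_norm Q \<Phi> = sqrt (\<Sum>\<^sub>\<infinity>b\<in>(SOME B. orthonormal_basis_U0 Q B). (norm (\<Phi> b))\<^sup>2)"

definition L20_dist ::
    "('u::real_inner \<Rightarrow> 'u) \<Rightarrow> ('u \<Rightarrow> 'h::real_normed_vector) \<Rightarrow> ('u \<Rightarrow> 'h) \<Rightarrow> real" where
  "L20_dist Q \<Phi> \<Theta> = L20_norm Q (\<lambda>u. \<Phi> u - \<Theta> u)"

definition L20_borel ::
    "('u::real_inner \<Rightarrow> 'u) \<Rightarrow> ('u \<Rightarrow> 'h::real_normed_vector) measure" where
  "L20_borel Q = sigma (L20 Q) {G. openin (Metric_space.mtopology (L20 Q) (L20_dist Q)) G}"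

definition normal_filtration :: "'w measure \<Rightarrow> (real \<Rightarrow> 'w measure) \<Rightarrow> bool" where
  "normal_filtration M F \<longleftrightarrow>
     (\<forall>t\<ge>0. subalgebra M (F t)) \<and>
     (\<forall>s t. 0 \<le> s \<and> s \<le> t \<longrightarrow> sets (F s) \<subseteq> sets (F t)) \<and>
     null_sets M \<subseteq> sets (F 0) \<and>
     (\<forall>t\<ge>0. sets (F t) = (\<Inter>s\<in>{t<..}. sets (F s)))"

definition predictable_algebra ::
    "'w measure \<Rightarrow> (real \<Rightarrow> 'w measure) \<Rightarrow> real \<Rightarrow> (real \<times> 'w) measure" where
  "predictable_algebra M F T = sigma ({0..T} \<times> space M)
     ({{s<..t} \<times> A | s t A. 0 \<le> s \<and> s < t \<and> t \<le> T \<and> A \<in> sets (F s)} \<union>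
      {{0} \<times> A | A. A \<in> sets (F 0)})"

definition predictable_process ::
    "'w measure \<Rightarrow> (real \<Rightarrow> 'w measure) \<Rightarrow> real \<Rightarrow> 'b measure \<Rightarrow> (real \<Rightarrow> 'w \<Rightarrow> 'b) \<Rightarrow> bool" where
  "predictable_process M F T N X \<longleftrightarrow> (\<lambda>(t, \<omega>). X t \<omega>) \<in> predictable_algebra M F T \<rightarrow>\<^sub>M N"

definition N2_norm_sq :: "'w measure \<Rightarrow> ('u::real_inner \<Rightarrow> 'u) \<Rightarrow> real \<Rightarrow>
    (real \<Rightarrow> 'w \<Rightarrow> 'u \<Rightarrow> 'h::real_normed_vector) \<Rightarrow> ennreal" where
  "N2_norm_sq M Q T \<Phi> =
     (\<integral>\<^sup>+\<omega>. (\<integral>\<^sup>+\<tau>\<in>{0..T}. ennreal ((L20_norm Q (\<Phi> \<tau> \<omega>))\<^sup>2) \<partial>lborel) \<partial>M)"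

definition N2 :: "'w measure \<Rightarrow> (real \<Rightarrow> 'w measure) \<Rightarrow> ('u::real_inner \<Rightarrow> 'u) \<Rightarrow> real \<Rightarrow>
    (real \<Rightarrow> 'w \<Rightarrow> 'u \<Rightarrow> 'h::real_normed_vector) set" where
  "N2 M F Q T = {\<Phi>. predictable_process M F T (L20_borel Q) \<Phi> \<and> N2_norm_sq M Q T \<Phi> < \<infinity>}"

definition centered_gaussian :: "real \<Rightarrow> real measure" where
  "centered_gaussian v =
     (if v = 0 then return borel 0 else density lborel (normal_density 0 (sqrt v)))"

definition real_wiener_process :: "'w measure \<Rightarrow> real \<Rightarrow> (real \<Rightarrow> 'w \<Rightarrow> real) \<Rightarrow> bool" where
  "real_wiener_process M v B \<longleftrightarrow>
     (\<forall>t\<ge>0. B t \<in> borel_measurable M) \<and>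
     (AE \<omega> in M. B 0 \<omega> = 0) \<and>
     (AE \<omega> in M. continuous_on {0..} (\<lambda>t. B t \<omega>)) \<and>
     (\<forall>s t. 0 \<le> s \<and> s < t \<longrightarrow>
        distr M borel (\<lambda>\<omega>. B t \<omega> - B s \<omega>) = centered_gaussian (v * (t - s))) \<and>
     (\<forall>(r::nat \<Rightarrow> real) n. 0 \<le> r 0 \<and> (\<forall>i<n. r i < r (Suc i)) \<longrightarrow>
        prob_space.indep_vars M (\<lambda>_. borel) (\<lambda>i \<omega>. B (r (Suc i)) \<omega> - B (r i) \<omega>) {..<n})"

text \<open>Without a trace condition on \<open>Q\<close> the series \<open>W(t) = (\<Sum>k. \<beta>\<^sub>k(t) e\<^sub>k)\<close> does not converge
  in \<open>U\<close>, so \<open>W\<close> is represented by the basis \<open>e\<close> and the coordinate processes \<open>\<beta>\<close>. The index set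
  \<open>K\<close> is a set of naturals so that finite-dimensional \<open>U\<close> is covered. The last two conjuncts
  say that \<open>W\<close> is a Wiener process relative to \<open>F\<close>: it is adapted, and the increment
  \<open>W(t) - W(s)\<close>, that is, the whole family of coordinate increments, is independent of \<open>F s\<close>.\<close>

definition cylindrical_wiener_process ::
    "'w measure \<Rightarrow> (real \<Rightarrow> 'w measure) \<Rightarrow> ('u::{real_inner,banach,second_countable_topology} \<Rightarrow> 'u) \<Rightarrow>
     nat set \<Rightarrow> (nat \<Rightarrow> 'u) \<Rightarrow> (nat \<Rightarrow> real) \<Rightarrow> (nat \<Rightarrow> real \<Rightarrow> 'w \<Rightarrow> real) \<Rightarrow> bool" where
  "cylindrical_wiener_process M F Q K e lam \<beta> \<longleftrightarrow>
     nonneg_operator Q \<and>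
     (\<forall>j\<in>K. \<forall>k\<in>K. inner (e j) (e k) = (if j = k then 1 else 0)) \<and>
     closure (span (e ` K)) = UNIV \<and>
     (\<forall>k\<in>K. Q (e k) = lam k *\<^sub>R e k) \<and>
     (\<forall>k\<in>K. real_wiener_process M (lam k) (\<beta> k)) \<and>
     prob_space.indep_vars M (\<lambda>_. PiM {0..} (\<lambda>_. borel)) (\<lambda>k \<omega>. \<lambda>t\<in>{0..}. \<beta> k t \<omega>) K \<and>
     (\<forall>k\<in>K. \<forall>t\<ge>0. \<beta> k t \<in> borel_measurable (F t)) \<and>
     (\<forall>s t. 0 \<le> s \<and> s < t \<longrightarrow>
        prob_space.indep_set M (sets (F s))
          (sets (vimage_algebra (space M) (\<lambda>\<omega>. \<lambda>k\<in>K. \<beta> k t \<omega> - \<beta> k s \<omega>) (PiM K (\<lambda>_. borel)))))"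

definition L2_limit :: "'w measure \<Rightarrow> (nat \<Rightarrow> 'w \<Rightarrow> 'h) \<Rightarrow>
    ('w \<Rightarrow> 'h::{real_normed_vector,second_countable_topology}) \<Rightarrow> bool" where
  "L2_limit M X Y \<longleftrightarrow>
     Y \<in> borel_measurable M \<and> (\<integral>\<^sup>+\<omega>. ennreal ((norm (Y \<omega>))\<^sup>2) \<partial>M) < \<infinity> \<and>
     (\<lambda>n. \<integral>\<^sup>+\<omega>. ennreal ((norm (X n \<omega> - Y \<omega>))\<^sup>2) \<partial>M) \<longlonglongrightarrow> 0"

text \<open>Data of an elementary process on \<open>[0,t]\<close>: a partition \<open>0 = r 0 < \<dots> < r N = t\<close> and
  finitely valued, \<open>F (r m)\<close>-measurable, \<open>L20\<close>-valued random variables \<open>\<xi> m\<close>, the value of the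
  process on \<open>(r m, r (m+1)]\<close>.\<close>

definition elementary_data :: "'w measure \<Rightarrow> (real \<Rightarrow> 'w measure) \<Rightarrow> ('u::real_inner \<Rightarrow> 'u) \<Rightarrow> real \<Rightarrow>
    nat \<Rightarrow> (nat \<Rightarrow> real) \<Rightarrow> (nat \<Rightarrow> 'w \<Rightarrow> 'u \<Rightarrow> 'h::real_normed_vector) \<Rightarrow> bool" where
  "elementary_data M F Q t N r \<xi> \<longleftrightarrow>
     r 0 = 0 \<and> r N = t \<and> (\<forall>m<N. r m < r (Suc m)) \<and>
     (\<forall>m<N. simple_function (F (r m)) (\<xi> m) \<and> \<xi> m ` space M \<subseteq> L20 Q)"

definition elementary_process ::
    "nat \<Rightarrow> (nat \<Rightarrow> real) \<Rightarrow> (nat \<Rightarrow> 'w \<Rightarrow> 'u \<Rightarrow> 'h::real_normed_vector) \<Rightarrow> real \<Rightarrow> 'w \<Rightarrow> 'u \<Rightarrow> 'h" where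
  "elementary_process N r \<xi> \<tau> \<omega> u =
     (\<Sum>m<N. indicat_real {r m<..r (Suc m)} \<tau> *\<^sub>R \<xi> m \<omega> u)"

text \<open>The integral of an elementary process is \<open>\<Sum>m<N. \<xi> m (W(r (m+1)) - W(r m))\<close>, where
  an operator \<open>\<xi>\<close> in \<open>L20\<close> acts on the formal series of an increment term by term; the resulting
  series over \<open>k\<close> converges in mean square. Coordinates with eigenvalue \<open>0\<close>, for which \<open>e k\<close> is not
  in \<open>U\<^sub>0\<close>, contribute nothing.\<close>

definition has_elementary_integral ::
    "'w measure \<Rightarrow> nat set \<Rightarrow> (nat \<Rightarrow> 'u) \<Rightarrow> (nat \<Rightarrow> real \<Rightarrow> 'w \<Rightarrow> real) \<Rightarrow>
     nat \<Rightarrow> (nat \<Rightarrow> real) \<Rightarrow> (nat \<Rightarrow> 'w \<Rightarrow> 'u \<Rightarrow> 'h::{real_inner,banach,second_countable_topology}) \<Rightarrow>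
     ('w \<Rightarrow> 'h) \<Rightarrow> bool" where
  "has_elementary_integral M K e \<beta> N r \<xi> Z \<longleftrightarrow>
     L2_limit M
       (\<lambda>n \<omega>. \<Sum>m<N. \<Sum>k\<in>K \<inter> {..<n}. (\<beta> k (r (Suc m)) \<omega> - \<beta> k (r m) \<omega>) *\<^sub>R \<xi> m \<omega> (e k)) Z"

text \<open>\<open>has_stochastic_integral M F Q K e \<beta> \<Phi> t Y\<close>: the random variable \<open>Y\<close> is (a version of)
  the integral of \<open>\<Phi>\<close> over \<open>[0,t]\<close> with respect to \<open>W\<close>, obtained by extending
  the isometry from elementary processes to \<open>N2\<close>. It determines \<open>Y\<close> up to almost sure equality.\<close>

definition has_stochastic_integral ::
    "'w measure \<Rightarrow> (real \<Rightarrow> 'w measure) \<Rightarrow> ('u::{real_inner,banach,second_countable_topology} \<Rightarrow> 'u) \<Rightarrow>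
     nat set \<Rightarrow> (nat \<Rightarrow> 'u) \<Rightarrow> (nat \<Rightarrow> real \<Rightarrow> 'w \<Rightarrow> real) \<Rightarrow>
     (real \<Rightarrow> 'w \<Rightarrow> 'u \<Rightarrow> 'h::{real_inner,banach,second_countable_topology}) \<Rightarrow> real \<Rightarrow>
     ('w \<Rightarrow> 'h) \<Rightarrow> bool" where
  "has_stochastic_integral M F Q K e \<beta> \<Phi> t Y \<longleftrightarrow>
     \<Phi> \<in> N2 M F Q t \<and>
     (\<exists>N r \<xi> Z.
        (\<forall>n. elementary_data M F Q t (N n) (r n) (\<xi> n) \<and>
             has_elementary_integral M K e \<beta> (N n) (r n) (\<xi> n) (Z n)) \<and>
        (\<lambda>n. N2_norm_sq M Q t
               (\<lambda>\<tau> \<omega> u. elementary_process (N n) (r n) (\<xi> n) \<tau> \<omega> u - \<Phi> \<tau> \<omega> u)) \<longlonglongrightarrow> 0 \<and>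
        L2_limit M Z Y)"

definition stochastic_integral ::
    "'w measure \<Rightarrow> (real \<Rightarrow> 'w measure) \<Rightarrow> ('u::{real_inner,banach,second_countable_topology} \<Rightarrow> 'u) \<Rightarrow>
     nat set \<Rightarrow> (nat \<Rightarrow> 'u) \<Rightarrow> (nat \<Rightarrow> real \<Rightarrow> 'w \<Rightarrow> real) \<Rightarrow>
     (real \<Rightarrow> 'w \<Rightarrow> 'u \<Rightarrow> 'h::{real_inner,banach,second_countable_topology}) \<Rightarrow> real \<Rightarrow> 'w \<Rightarrow> 'h" where
  "stochastic_integral M F Q K e \<beta> \<Phi> t = (SOME Y. has_stochastic_integral M F Q K e \<beta> \<Phi> t Y)"

text \<open>As usual, ``unbounded operator'' means an operator that need not be bounded.\<close>

definition closed_densely_defined :: "'h::real_normed_vector set \<Rightarrow> ('h \<Rightarrow> 'h) \<Rightarrow> bool" where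
  "closed_densely_defined D A \<longleftrightarrow>
     subspace D \<and> linear_on_set D A \<and> closure D = UNIV \<and> closed ((\<lambda>x. (x, A x)) ` D)"

definition locally_integrable :: "(real \<Rightarrow> real) \<Rightarrow> bool" where
  "locally_integrable a \<longleftrightarrow> (\<forall>b\<ge>0. set_integrable lborel {0..b} a)"

definition volterra_resolvent :: "(real \<Rightarrow> real) \<Rightarrow> 'h::{banach,second_countable_topology} set \<Rightarrow>
    ('h \<Rightarrow> 'h) \<Rightarrow> (real \<Rightarrow> 'h \<Rightarrow> 'h) \<Rightarrow> bool" where
  "volterra_resolvent a D A S \<longleftrightarrow>
     (\<forall>t\<ge>0. bounded_linear (S t)) \<and>
     (\<forall>x. continuous_on {0..} (\<lambda>t. S t x)) \<and> S 0 = id \<and>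
     (\<forall>t\<ge>0. \<forall>x\<in>D. S t x \<in> D \<and> A (S t x) = S t (A x)) \<and>
     (\<forall>t\<ge>0. \<forall>x\<in>D. S t x = x + (LINT \<tau>:{0..t}|lborel. a (t - \<tau>) *\<^sub>R A (S \<tau> x)))"

definition convolution_integrand ::
    "(real \<Rightarrow> 'h \<Rightarrow> 'h) \<Rightarrow> (real \<Rightarrow> 'w \<Rightarrow> 'u \<Rightarrow> 'h) \<Rightarrow> real \<Rightarrow> real \<Rightarrow> 'w \<Rightarrow> 'u \<Rightarrow> 'h" where
  "convolution_integrand S \<Psi> t \<tau> \<omega> = S (t - \<tau>) \<circ> \<Psi> \<tau> \<omega>"

definition stochastic_convolution ::
    "'w measure \<Rightarrow> (real \<Rightarrow> 'w measure) \<Rightarrow> ('u::{real_inner,banach,second_countable_topology} \<Rightarrow> 'u) \<Rightarrow>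
     nat set \<Rightarrow> (nat \<Rightarrow> 'u) \<Rightarrow> (nat \<Rightarrow> real \<Rightarrow> 'w \<Rightarrow> real) \<Rightarrow>
     (real \<Rightarrow> 'h::{real_inner,banach,second_countable_topology} \<Rightarrow> 'h) \<Rightarrow>
     (real \<Rightarrow> 'w \<Rightarrow> 'u \<Rightarrow> 'h) \<Rightarrow> real \<Rightarrow> 'w \<Rightarrow> 'h" where
  "stochastic_convolution M F Q K e \<beta> S \<Psi> t =
     stochastic_integral M F Q K e \<beta> (convolution_integrand S \<Psi> t) t"

definition has_predictable_version ::
    "'w measure \<Rightarrow> (real \<Rightarrow> 'w measure) \<Rightarrow> real \<Rightarrow> (real \<Rightarrow> 'w \<Rightarrow> 'h::topological_space) \<Rightarrow> bool" where
  "has_predictable_version M F T X \<longleftrightarrow>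
     (\<exists>V. predictable_process M F T borel V \<and> (\<forall>t\<in>{0..T}. AE \<omega> in M. V t \<omega> = X t \<omega>))"

end

theory Submission
  imports Defs
begin

text \<open>The resolvent is uniformly bounded on \<open>[0,T]\<close> by the uniform boundedness principle, so
  \<open>\<tau> \<mapsto> 1\<^bsub>[0,t]\<^esub>(\<tau>) S(t-\<tau>) \<Psi>(\<tau>)\<close> lies in \<open>N2\<close>; by strong continuity and dominated convergence it
  depends continuously on \<open>t\<close> in mean square. The isometry of the stochastic integral transfers this
  to the (adapted) convolution, uniformly on the compact interval \<open>[0,T]\<close>. Step
  processes that freeze it at the left endpoints of finer and finer partitions are predictable
  and, with mesh chosen so that the squared errors are summable, converge almost surely at
  every time; their pointwise limit is the predictable version.\<close>

section \<open>Orthonormal families and Hilbert-Schmidt sums\<close>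

text \<open>A resolvent obeys no semigroup law in general, so \<open>S (t - \<tau>)\<close> cannot
  be factored through an intermediate time, and the integrals at different \<open>t\<close> cannot
  be deduced from each other. Each is built separately, and two of them are compared through their
  integrands: cut off at its own horizon and read in the coordinates \<open>f k\<close>, every
  integrand is an element of one L2 space over counting measure times time times probability
  (\<open>coords\<close>, \<open>pm\<close>).

  Comparing integrals with different horizons means subtracting elementary processes on unrelated
  partitions. The isometry is therefore proved for finite families of possibly overlapping intervals
  (\<open>atoms\<close>), where a difference is a disjoint union with a sign.

  Since \<open>stochastic_integral\<close> is a choice, existence is part of the work. Mean squares
  satisfy the triangle inequality up to a factor 2; repeated use of it produces constants such as
  16.\<close>

definition orthonormal_family :: "'i set \<Rightarrow> ('i \<Rightarrow> 'a::real_inner) \<Rightarrow> bool" where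
  "orthonormal_family I e \<longleftrightarrow> (\<forall>j\<in>I. \<forall>k\<in>I. inner (e j) (e k) = (if j = k then 1 else 0))"

lemma orthonormal_family_subset: "orthonormal_family I e \<Longrightarrow> J \<subseteq> I \<Longrightarrow> orthonormal_family J e"
  unfolding orthonormal_family_def by blast

lemma norm_sum_orthogonal_sq:
  fixes x :: "'i \<Rightarrow> 'a::real_inner"
  assumes "finite F" "\<And>i j. i \<in> F \<Longrightarrow> j \<in> F \<Longrightarrow> i \<noteq> j \<Longrightarrow> inner (x i) (x j) = 0"
  shows "(norm (\<Sum>i\<in>F. x i))\<^sup>2 = (\<Sum>i\<in>F. (norm (x i))\<^sup>2)"
proof -
  have "(norm (\<Sum>i\<in>F. x i))\<^sup>2 = (\<Sum>i\<in>F. \<Sum>j\<in>F. inner (x i) (x j))"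
    by (simp add: power2_norm_eq_inner inner_sum_left inner_sum_right) (rule sum.swap)
  also have "\<dots> = (\<Sum>i\<in>F. inner (x i) (x i))"
  proof (rule sum.cong[OF refl])
    fix i assume "i \<in> F"
    have "(\<Sum>j\<in>F. inner (x i) (x j)) = (\<Sum>j\<in>F. if j = i then inner (x i) (x i) else 0)"
      using assms(2) \<open>i \<in> F\<close> by (intro sum.cong) auto
    thus "(\<Sum>j\<in>F. inner (x i) (x j)) = inner (x i) (x i)" using assms(1) \<open>i \<in> F\<close> by simp
  qed
  finally show ?thesis by (simp add: power2_norm_eq_inner)
qed

text \<open>By Pythagoras the squared distance between nested partial sums is a partial sum of the
  squared norms, so the net of finite sums is Cauchy as soon as the squared norms are summable;
  completeness then gives a limit.\<close>

lemma summable_on_orthogonal: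
  fixes x :: "'i \<Rightarrow> 'a::{real_inner,banach}"
  assumes orth: "\<And>i j. i \<in> I \<Longrightarrow> j \<in> I \<Longrightarrow> i \<noteq> j \<Longrightarrow> inner (x i) (x j) = 0"
    and sm: "(\<lambda>i. (norm (x i))\<^sup>2) summable_on I"
  shows "x summable_on I"
proof -
  obtain s where s: "((\<lambda>i. (norm (x i))\<^sup>2) has_sum s) I" using sm by (auto simp: summable_on_def)
  have "\<exists>P. eventually P (finite_subsets_at_top I) \<and>
        (\<forall>F F'. P F \<and> P F' \<longrightarrow> dist (sum x F) (sum x F') < d)" if "d > 0" for d
  proof -
    \<comment> \<open>Two partial sums of squares, each within d^2/16 of \<open>s\<close>, differ by
      less than d^2/8, which is below (d/2)^2.\<close>
    have "eventually (\<lambda>F. dist (\<Sum>i\<in>F. (norm (x i))\<^sup>2) s < d\<^sup>2/16) (finite_subsets_at_top I)"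
      using s that unfolding has_sum_def by (intro tendstoD) auto
    then obtain F0 where F0: "finite F0" "F0 \<subseteq> I"
      "\<And>F. F0 \<subseteq> F \<Longrightarrow> finite F \<Longrightarrow> F \<subseteq> I \<Longrightarrow> dist (\<Sum>i\<in>F. (norm (x i))\<^sup>2) s < d\<^sup>2/16"
      by (auto simp: eventually_finite_subsets_at_top)
    define P where "P F \<longleftrightarrow> F0 \<subseteq> F \<and> finite F \<and> F \<subseteq> I" for F
    have close: "dist (sum x F) (sum x F0) < d/2" if "P F" for F
    proof -
      have F: "F0 \<subseteq> F" "finite F" "F \<subseteq> I" using that by (auto simp: P_def)
      have "(dist (sum x F) (sum x F0))\<^sup>2 = (norm (sum x (F - F0)))\<^sup>2"
        using F by (simp add: dist_norm sum_diff)
      also have "\<dots> = (\<Sum>i\<in>F-F0. (norm (x i))\<^sup>2)"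
        using F by (intro norm_sum_orthogonal_sq orth) auto
      also have "\<dots> = (\<Sum>i\<in>F. (norm (x i))\<^sup>2) - (\<Sum>i\<in>F0. (norm (x i))\<^sup>2)"
        using F by (simp add: sum_diff)
      also have "\<dots> < d\<^sup>2/16 + d\<^sup>2/16"
      proof -
        have "\<bar>(\<Sum>i\<in>F. (norm (x i))\<^sup>2) - s\<bar> < d\<^sup>2/16" "\<bar>(\<Sum>i\<in>F0. (norm (x i))\<^sup>2) - s\<bar> < d\<^sup>2/16"
          using F0(3)[of F] F0(3)[of F0] F F0(1,2) by (auto simp: dist_real_def)
        thus ?thesis by linarith
      qed
      also have "\<dots> \<le> (d/2)\<^sup>2" by (simp add: power2_eq_square)
      finally show ?thesis using \<open>d > 0\<close> by (meson half_gt_zero less_imp_le power2_less_imp_less)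
    qed
    have "eventually P (finite_subsets_at_top I)"
      unfolding eventually_finite_subsets_at_top P_def using F0 by blast
    moreover have "dist (sum x F) (sum x F') < d" if "P F" "P F'" for F F'
      using close[OF that(1)] close[OF that(2)] dist_triangle2[of "sum x F" "sum x F'" "sum x F0"] by simp
    ultimately show ?thesis by blast
  qed
  then have "cauchy_filter (filtermap (sum x) (finite_subsets_at_top I))"
    by (simp add: cauchy_filter_metric_filtermap)
  moreover have "uniform_space_class.complete (UNIV::'a set)"
    by (meson Cauchy_convergent UNIV_I complete_def convergent_def)
  ultimately obtain L' where \<open>(sum x \<longlongrightarrow> L') (finite_subsets_at_top I)\<close>
    using complete_uniform[where S=UNIV] by (force simp add: filterlim_def)
  then show ?thesis
    using summable_on_def has_sum_def by blast
qed

text \<open>Expands the squared distance from \<open>y\<close> to its projection \<open>?p\<close>;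
  the inner product of \<open>y\<close> with \<open>?p\<close> and the squared norm of
  \<open>?p\<close> are both the sum of squared coefficients.\<close>

lemma bessel_finite:
  assumes "orthonormal_family I e" "finite I"
  shows "(\<Sum>k\<in>I. (inner y (e k))\<^sup>2) \<le> (norm y)\<^sup>2"
proof -
  let ?p = "\<Sum>k\<in>I. inner y (e k) *\<^sub>R e k"
  have n: "(norm ?p)\<^sup>2 = (\<Sum>k\<in>I. (inner y (e k))\<^sup>2)"
    using assms by (subst norm_sum_orthogonal_sq)
      (auto simp: orthonormal_family_def power_mult_distrib power2_norm_eq_inner intro!: sum.cong)
  have i: "inner y ?p = (\<Sum>k\<in>I. (inner y (e k))\<^sup>2)"
    by (simp add: inner_sum_right power2_eq_square)
  have "0 \<le> (norm (y - ?p))\<^sup>2" by simp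
  also have "\<dots> = (norm y)\<^sup>2 - 2 * inner y ?p + (norm ?p)\<^sup>2"
    by (simp add: power2_norm_eq_inner inner_diff inner_commute)
  finally show ?thesis using n i by simp
qed

lemma bessel:
  assumes "orthonormal_family I e"
  shows "(\<lambda>k. (inner y (e k))\<^sup>2) summable_on I" "(\<Sum>\<^sub>\<infinity>k\<in>I. (inner y (e k))\<^sup>2) \<le> (norm y)\<^sup>2"
proof -
  show *: "(\<lambda>k. (inner y (e k))\<^sup>2) summable_on I"
    by (rule nonneg_bounded_partial_sums_imp_summable_on[where C="(norm y)\<^sup>2"])
      (auto intro!: eventually_finite_subsets_at_top_weakI bessel_finite
         intro: orthonormal_family_subset[OF assms])
  show "(\<Sum>\<^sub>\<infinity>k\<in>I. (inner y (e k))\<^sup>2) \<le> (norm y)\<^sup>2"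
    by (rule infsum_le_finite_sums[OF *])
      (auto intro!: bessel_finite intro: orthonormal_family_subset[OF assms])
qed

text \<open>Riesz-Fischer. The Fourier expansion and all operators diagonal in a basis are obtained
  from it.\<close>

lemma orthonormal_series:
  fixes e :: "'i \<Rightarrow> 'a::{real_inner,banach}"
  assumes on: "orthonormal_family I e" and sm: "(\<lambda>k. (c k)\<^sup>2) summable_on I"
  obtains z where "((\<lambda>k. c k *\<^sub>R e k) has_sum z) I" "\<And>k. k \<in> I \<Longrightarrow> inner z (e k) = c k"
proof -
  have "(\<lambda>k. c k *\<^sub>R e k) summable_on I"
  proof (rule summable_on_orthogonal)
    show "(\<lambda>i. (norm (c i *\<^sub>R e i))\<^sup>2) summable_on I"
      using sm by (rule summable_on_cong[THEN iffD1, rotated])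
        (use on in \<open>auto simp: orthonormal_family_def power_mult_distrib power2_norm_eq_inner\<close>)
  qed (use on in \<open>auto simp: orthonormal_family_def\<close>)
  then obtain z where z: "((\<lambda>k. c k *\<^sub>R e k) has_sum z) I" by (auto simp: summable_on_def)
  have "inner z (e k) = c k" if "k \<in> I" for k
  proof -
    have "((\<lambda>j. inner (c j *\<^sub>R e j) (e k)) has_sum inner z (e k)) I"
      using has_sum_bounded_linear[OF bounded_linear_inner_left z] by (simp add: o_def)
    moreover have "((\<lambda>j. inner (c j *\<^sub>R e j) (e k)) has_sum c k) I"
      by (rule has_sum_cong_neutral[THEN iffD1, OF _ _ _ has_sum_finite[of "{k}" "\<lambda>_. c k", simplified]])
        (use on that in \<open>auto simp: orthonormal_family_def\<close>)
    ultimately show ?thesis by (rule has_sum_unique)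
  qed
  with z that show thesis by blast
qed

text \<open>Gram-Schmidt. Finitely many values of an operator can thus be measured by finitely many
  scalar coordinates, which stands in for a basis of the whole target space.\<close>

lemma finite_orthonormal_hull:
  fixes V :: "'a::real_inner set"
  assumes "finite V"
  obtains C where "finite C" "orthonormal_family C (\<lambda>c. c)"
    "\<And>v. v \<in> V \<Longrightarrow> (norm v)\<^sup>2 = (\<Sum>c\<in>C. (inner v c)\<^sup>2)"
proof -
  obtain B where B: "finite B" "span B = span V" "pairwise orthogonal B"
    using basis_orthogonal[OF assms] by blast
  \<comment> \<open>An orthogonal spanning set may contain 0, which cannot be normalised.\<close>
  define C where "C = (\<lambda>c. c /\<^sub>R norm c) ` (B - {0})"
  have fin: "finite C" using B by (simp add: C_def)
  have on: "orthonormal_family C (\<lambda>c. c)"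
    unfolding orthonormal_family_def
  proof (intro ballI)
    fix c d assume "c \<in> C" "d \<in> C"
    then obtain a b where ab: "a \<in> B" "a \<noteq> 0" "c = a /\<^sub>R norm a" "b \<in> B" "b \<noteq> 0" "d = b /\<^sub>R norm b"
      by (auto simp: C_def)
    show "inner c d = (if c = d then 1 else 0)"
    proof (cases "a = b")
      case True
      thus ?thesis using ab by (simp add: power2_norm_eq_inner[symmetric] power2_eq_square)
    next
      case False
      hence 0: "inner c d = 0" using B(3) ab by (auto simp: pairwise_def orthogonal_def)
      have "inner c c \<noteq> 0" using ab by simp
      with 0 show ?thesis by auto
    qed
  qed
  have "b \<in> span C" if "b \<in> B" for b
  proof (cases "b = 0")
    case False
    have "norm b *\<^sub>R (b /\<^sub>R norm b) \<in> span C"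
      by (intro span_scale span_base) (use that False in \<open>auto simp: C_def\<close>)
    thus ?thesis using False by simp
  qed (simp add: span_zero)
  hence "span V \<subseteq> span C" using B(2) by (metis span_minimal subspace_span subsetI)
  hence sp: "v \<in> span C" if "v \<in> V" for v using that span_base by blast
  have "(norm v)\<^sup>2 = (\<Sum>c\<in>C. (inner v c)\<^sup>2)" if "v \<in> V" for v
  proof -
    have "v \<in> span C" using sp that by blast
    then obtain u where u: "v = (\<Sum>c\<in>C. u c *\<^sub>R c)"
      by (auto simp: span_finite[OF fin])
    have "inner v c = u c" if "c \<in> C" for c
    proof -
      have "inner v c = (\<Sum>d\<in>C. if d = c then u c else 0)"
        unfolding u inner_sum_left using on that
        by (intro sum.cong) (auto simp: orthonormal_family_def)
      thus ?thesis using fin that by simp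
    qed
    moreover have "(norm v)\<^sup>2 = (\<Sum>c\<in>C. (u c)\<^sup>2)"
      unfolding u using on fin
      by (subst norm_sum_orthogonal_sq)
        (auto simp: orthonormal_family_def power_mult_distrib power2_norm_eq_inner intro!: sum.cong)
    ultimately show ?thesis by simp
  qed
  with fin on that show thesis by blast
qed

lemma has_sum_finite_sum:
  fixes f :: "'c \<Rightarrow> 'i \<Rightarrow> 'a::topological_comm_monoid_add"
  assumes "finite C" "\<And>c. c \<in> C \<Longrightarrow> (f c has_sum s c) I"
  shows "((\<lambda>k. \<Sum>c\<in>C. f c k) has_sum (\<Sum>c\<in>C. s c)) I"
  using assms by (induction C rule: finite_induct) (auto intro!: has_sum_add)

text \<open>Duality, one target direction \<open>c\<close> at a time. The sum of squares on the left
  is the squared norm of a vector \<open>v\<close> with \<open>inner (G v) c\<close> equal to it;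
  expanding \<open>v\<close> along \<open>e\<close> and using the arithmetic-geometric inequality
  bounds this by half of itself plus half of the right side. The condition \<open>ker\<close>
  replaces completeness of \<open>e\<close>: whatever \<open>e\<close> misses, \<open>G\<close>
  kills.\<close>

lemma hilbert_schmidt_finite_le:
  fixes G :: "'a::{real_inner,banach} \<Rightarrow> 'b::real_inner"
  assumes G: "bounded_linear G" and on: "orthonormal_family I e" and J: "orthonormal_family J g" "finite J"
    and ker: "\<And>x. \<forall>k\<in>I. inner x (e k) = 0 \<Longrightarrow> G x = 0"
    and sm: "(\<lambda>k. (norm (G (e k)))\<^sup>2) summable_on I"
  shows "(\<Sum>j\<in>J. (norm (G (g j)))\<^sup>2) \<le> (\<Sum>\<^sub>\<infinity>k\<in>I. (norm (G (e k)))\<^sup>2)"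
proof -
  interpret G: bounded_linear G by fact
  obtain C where C: "finite C" "orthonormal_family C (\<lambda>c. c)"
    "\<And>v. v \<in> (G \<circ> g) ` J \<Longrightarrow> (norm v)\<^sup>2 = (\<Sum>c\<in>C. (inner v c)\<^sup>2)"
    using finite_orthonormal_hull[of "(G \<circ> g) ` J"] J(2) by auto
  have smc: "(\<lambda>k. (inner (G (e k)) c)\<^sup>2) summable_on I" if "c \<in> C" for c
  proof (rule summable_on_comparison_test[OF sm])
    fix k
    have "(inner (G (e k)) c)\<^sup>2 \<le> (norm (G (e k)))\<^sup>2 * (norm c)\<^sup>2"
      using Cauchy_Schwarz_ineq[of "G (e k)" c] by (simp add: power2_norm_eq_inner)
    thus "(inner (G (e k)) c)\<^sup>2 \<le> (norm (G (e k)))\<^sup>2"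
      using C(2) that by (auto simp: orthonormal_family_def power2_norm_eq_inner)
  qed simp
  have c: "(\<Sum>j\<in>J. (inner (G (g j)) c)\<^sup>2) \<le> (\<Sum>\<^sub>\<infinity>k\<in>I. (inner (G (e k)) c)\<^sup>2)" if "c \<in> C" for c
  proof -
    \<comment> \<open>\<open>v\<close> is the adjoint of \<open>G\<close> applied to
      \<open>c\<close>, projected onto the span of \<open>g\<close>.\<close>
    define v where "v = (\<Sum>j\<in>J. inner (G (g j)) c *\<^sub>R g j)"
    have nv: "(norm v)\<^sup>2 = (\<Sum>j\<in>J. (inner (G (g j)) c)\<^sup>2)"
      unfolding v_def using J by (subst norm_sum_orthogonal_sq)
        (auto simp: orthonormal_family_def power_mult_distrib power2_norm_eq_inner intro!: sum.cong)
    have pv: "inner (G v) c = (\<Sum>j\<in>J. (inner (G (g j)) c)\<^sup>2)"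
      by (simp add: v_def G.sum G.scale inner_sum_left power2_eq_square)
    obtain z where z: "((\<lambda>k. inner v (e k) *\<^sub>R e k) has_sum z) I"
      "\<And>k. k \<in> I \<Longrightarrow> inner z (e k) = inner v (e k)"
      using orthonormal_series[OF on bessel(1)[OF on]] by blast
    \<comment> \<open>\<open>z\<close> is the part of \<open>v\<close> seen by \<open>e\<close>; the
      remainder is orthogonal to all \<open>e k\<close>.\<close>
    have "G (v - z) = 0" by (rule ker) (simp add: z inner_diff_left)
    hence Gz: "G z = G v" by (simp add: G.diff)
    have "((\<lambda>k. inner (G (inner v (e k) *\<^sub>R e k)) c) has_sum inner (G z) c) I"
      using has_sum_bounded_linear[OF bounded_linear_compose[OF bounded_linear_inner_left G] z(1)]
      by (simp add: o_def)
    hence hs: "((\<lambda>k. inner v (e k) * inner (G (e k)) c) has_sum inner (G v) c) I"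
      by (simp add: G.scale Gz)
    have hs2: "((\<lambda>k. (inner v (e k))\<^sup>2 / 2 + (inner (G (e k)) c)\<^sup>2 / 2) has_sum
        ((\<Sum>\<^sub>\<infinity>k\<in>I. (inner v (e k))\<^sup>2) / 2 + (\<Sum>\<^sub>\<infinity>k\<in>I. (inner (G (e k)) c)\<^sup>2) / 2)) I"
      unfolding divide_inverse
      by (intro has_sum_add has_sum_cmult_left has_sum_infsum bessel(1)[OF on] smc that)
    have "inner (G v) c \<le> ((\<Sum>\<^sub>\<infinity>k\<in>I. (inner v (e k))\<^sup>2) / 2 + (\<Sum>\<^sub>\<infinity>k\<in>I. (inner (G (e k)) c)\<^sup>2) / 2)"
    proof (rule has_sum_mono[OF hs hs2])
      fix k
      have "0 \<le> (inner v (e k) - inner (G (e k)) c)\<^sup>2" by simp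
      thus "inner v (e k) * inner (G (e k)) c \<le> (inner v (e k))\<^sup>2 / 2 + (inner (G (e k)) c)\<^sup>2 / 2"
        by (simp add: power2_diff)
    qed
    \<comment> \<open>Bessel bounds the first half by \<open>(norm v)\<^sup>2 / 2\<close>, which is
      absorbed on the left.\<close>
    thus ?thesis using bessel(2)[OF on, of v] nv pv by simp
  qed
  have "(\<Sum>j\<in>J. (norm (G (g j)))\<^sup>2) = (\<Sum>c\<in>C. \<Sum>j\<in>J. (inner (G (g j)) c)\<^sup>2)"
    using C(3) by (subst sum.swap) (auto intro!: sum.cong)
  also have "\<dots> \<le> (\<Sum>c\<in>C. \<Sum>\<^sub>\<infinity>k\<in>I. (inner (G (e k)) c)\<^sup>2)" by (intro sum_mono c)
  also have "\<dots> \<le> (\<Sum>\<^sub>\<infinity>k\<in>I. (norm (G (e k)))\<^sup>2)"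
  proof (rule has_sum_mono)
    show "((\<lambda>k. \<Sum>c\<in>C. (inner (G (e k)) c)\<^sup>2) has_sum (\<Sum>c\<in>C. \<Sum>\<^sub>\<infinity>k\<in>I. (inner (G (e k)) c)\<^sup>2)) I"
      using smc by (intro has_sum_finite_sum C(1)) auto
    show "((\<lambda>k. (norm (G (e k)))\<^sup>2) has_sum (\<Sum>\<^sub>\<infinity>k\<in>I. (norm (G (e k)))\<^sup>2)) I"
      using sm by simp
  qed (use C bessel_finite in blast)
  finally show ?thesis .
qed

text \<open>The finite bound is uniform, so the full sum over \<open>J\<close> exists. Used in both
  directions between two families, this makes Hilbert-Schmidt sums independent of the
  family.\<close>

lemma hilbert_schmidt_le:
  fixes G :: "'a::{real_inner,banach} \<Rightarrow> 'b::real_inner"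
  assumes G: "bounded_linear G" and on: "orthonormal_family I e" and J: "orthonormal_family J g"
    and ker: "\<And>x. \<forall>k\<in>I. inner x (e k) = 0 \<Longrightarrow> G x = 0"
    and sm: "(\<lambda>k. (norm (G (e k)))\<^sup>2) summable_on I"
  shows "(\<lambda>k. (norm (G (g k)))\<^sup>2) summable_on J"
    and "(\<Sum>\<^sub>\<infinity>j\<in>J. (norm (G (g j)))\<^sup>2) \<le> (\<Sum>\<^sub>\<infinity>k\<in>I. (norm (G (e k)))\<^sup>2)"
proof -
  have le: "(\<Sum>j\<in>F. (norm (G (g j)))\<^sup>2) \<le> (\<Sum>\<^sub>\<infinity>k\<in>I. (norm (G (e k)))\<^sup>2)" if "F \<subseteq> J" "finite F" for F
    by (rule hilbert_schmidt_finite_le[OF G on orthonormal_family_subset[OF J that(1)] that(2) ker sm])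
  show *: "(\<lambda>k. (norm (G (g k)))\<^sup>2) summable_on J"
    by (rule nonneg_bounded_partial_sums_imp_summable_on)
      (auto intro!: eventually_finite_subsets_at_top_weakI le)
  show "(\<Sum>\<^sub>\<infinity>j\<in>J. (norm (G (g j)))\<^sup>2) \<le> (\<Sum>\<^sub>\<infinity>k\<in>I. (norm (G (e k)))\<^sup>2)"
    by (rule infsum_le_finite_sums[OF *]) (use le in auto)
qed

section \<open>The space of Hilbert-Schmidt operators on the reproducing space\<close>

lemma norm_add_sq_le: "(norm (x + y))\<^sup>2 \<le> 2 * (norm x)\<^sup>2 + 2 * (norm y)\<^sup>2"
proof -
  have "(norm (x + y))\<^sup>2 \<le> (norm x + norm y)\<^sup>2" by (intro power_mono norm_triangle_ineq) auto
  also have "\<dots> \<le> 2 * (norm x)\<^sup>2 + 2 * (norm y)\<^sup>2"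
    using sum_squares_bound[of "norm x" "norm y"] by (simp add: power2_sum)
  finally show ?thesis .
qed

text \<open>Minkowski's inequality as a limit of its finite form
  \<open>L2_set_triangle_ineq\<close>; it becomes the triangle inequality of
  \<open>L20_dist\<close>.\<close>

lemma sums_norm_triangle:
  fixes a b :: "nat \<Rightarrow> 'a::real_normed_vector"
  assumes "summable (\<lambda>k. (norm (a k))\<^sup>2)" "summable (\<lambda>k. (norm (b k))\<^sup>2)"
  shows "summable (\<lambda>k. (norm (a k + b k))\<^sup>2)"
    "sqrt (\<Sum>k. (norm (a k + b k))\<^sup>2) \<le> sqrt (\<Sum>k. (norm (a k))\<^sup>2) + sqrt (\<Sum>k. (norm (b k))\<^sup>2)"
proof -
  have sm: "summable (\<lambda>k. 2 * (norm (a k))\<^sup>2 + 2 * (norm (b k))\<^sup>2)"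
    using assms by (intro summable_add summable_mult)
  show s: "summable (\<lambda>k. (norm (a k + b k))\<^sup>2)"
    by (rule summable_comparison_test'[OF sm, of 0]) (simp add: norm_add_sq_le)
  have l: "(\<lambda>n. L2_set (\<lambda>k. norm (c k)) {..<n}) \<longlonglongrightarrow> sqrt (\<Sum>k. (norm (c k))\<^sup>2)"
    if "summable (\<lambda>k. (norm (c k))\<^sup>2)" for c :: "nat \<Rightarrow> 'a"
    unfolding L2_set_def using that by (intro tendsto_real_sqrt summable_LIMSEQ)
  show "sqrt (\<Sum>k. (norm (a k + b k))\<^sup>2) \<le> sqrt (\<Sum>k. (norm (a k))\<^sup>2) + sqrt (\<Sum>k. (norm (b k))\<^sup>2)"
  proof (rule LIMSEQ_le[OF l[OF s] tendsto_add[OF l[OF assms(1)] l[OF assms(2)]]], intro exI allI impI)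
    fix n :: nat
    have "L2_set (\<lambda>k. norm (a k + b k)) {..<n} \<le> L2_set (\<lambda>k. norm (a k) + norm (b k)) {..<n}"
      by (intro L2_set_mono) (auto intro: norm_triangle_ineq)
    also have "\<dots> \<le> L2_set (\<lambda>k. norm (a k)) {..<n} + L2_set (\<lambda>k. norm (b k)) {..<n}"
      by (rule L2_set_triangle_ineq)
    finally show "L2_set (\<lambda>k. norm (a k + b k)) {..<n} \<le> \<dots>" .
  qed
qed

section \<open>Diagonal operators, the square root of \<open>Q\<close> and its
  pseudo-inverse\<close>

locale diagonal_operator =
  fixes Q :: "'u::{real_inner,banach,second_countable_topology} \<Rightarrow> 'u"
    and K :: "nat set" and e :: "nat \<Rightarrow> 'u" and lam :: "nat \<Rightarrow> real"
  assumes nonneg: "nonneg_operator Q"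
    and on: "orthonormal_family K e"
    and total: "closure (span (e ` K)) = UNIV"
    and eigen: "k \<in> K \<Longrightarrow> Q (e k) = lam k *\<^sub>R e k"
begin

lemma inner_e: "j \<in> K \<Longrightarrow> k \<in> K \<Longrightarrow> inner (e j) (e k) = (if j = k then 1 else 0)"
  using on by (auto simp: orthonormal_family_def)

text \<open>The kernel of \<open>G\<close> is a closed subspace containing the dense span of
  \<open>e\<close>; identities between bounded operators may thus be checked on the basis.\<close>

lemma bounded_linear_eq_0:
  fixes G :: "'u \<Rightarrow> 'b::real_normed_vector"
  assumes "bounded_linear G" "\<And>k. k \<in> K \<Longrightarrow> G (e k) = 0"
  shows "G x = 0"
proof -
  interpret bounded_linear G by fact
  have "span (e ` K) \<subseteq> {x. G x = 0}"
    using assms(2) by (intro span_minimal) (auto simp: subspace_def add scaleR zero)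
  moreover have "closed {x. G x = 0}"
    by (intro closed_Collect_eq linear_continuous_on assms continuous_intros)
  ultimately have "closure (span (e ` K)) \<subseteq> {x. G x = 0}" by (rule closure_minimal)
  thus ?thesis using total by blast
qed

lemma coord_eqI:
  assumes "\<And>k. k \<in> K \<Longrightarrow> inner x (e k) = inner y (e k)"
  shows "x = y"
proof -
  have "inner (x - y) (x - y) = 0"
    by (rule bounded_linear_eq_0[of "inner (x - y)"])
      (auto simp: bounded_linear_inner_right inner_diff_left assms)
  thus ?thesis by simp
qed

lemma fourier: "((\<lambda>k. inner x (e k) *\<^sub>R e k) has_sum x) K"
proof -
  obtain z where "((\<lambda>k. inner x (e k) *\<^sub>R e k) has_sum z) K" "\<And>k. k \<in> K \<Longrightarrow> inner z (e k) = inner x (e k)"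
    using orthonormal_series[OF on bessel(1)[OF on]] by blast
  moreover from this(2) have "z = x" by (rule coord_eqI)
  ultimately show ?thesis by simp
qed

lemma parseval: "((\<lambda>k. inner x (e k) * inner y (e k)) has_sum inner x y) K"
  using has_sum_bounded_linear[OF bounded_linear_inner_left fourier, of y x]
  by (simp add: o_def inner_commute mult.commute)

text \<open>Both the square root of \<open>Q\<close> (\<open>m k = sqrt (lam k)\<close>) and the
  projection onto the closure of its range (\<open>m\<close> an indicator) are instances. For
  \<open>m\<close> unbounded on \<open>K\<close> the series can diverge, and the infinite sum is
  then 0 by convention; the lemmas below therefore carry a bound \<open>C\<close>.\<close>

definition multiplier :: "(nat \<Rightarrow> real) \<Rightarrow> 'u \<Rightarrow> 'u" where
  "multiplier m x = (\<Sum>\<^sub>\<infinity>k\<in>K. (m k * inner x (e k)) *\<^sub>R e k)"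

lemma multiplier_coord:
  assumes "\<And>k. k \<in> K \<Longrightarrow> \<bar>m k\<bar> \<le> C" "k \<in> K"
  shows "inner (multiplier m x) (e k) = m k * inner x (e k)"
proof -
  have sm: "(\<lambda>k. (m k * inner x (e k))\<^sup>2) summable_on K"
  proof (rule summable_on_comparison_test)
    show "(\<lambda>k. C\<^sup>2 * (inner x (e k))\<^sup>2) summable_on K"
      by (intro summable_on_cmult_right bessel(1)[OF on])
    fix k assume "k \<in> K"
    hence "(m k)\<^sup>2 \<le> C\<^sup>2" using assms(1)[of k] abs_ge_zero[of "m k"]
      by (metis abs_le_square_iff abs_of_nonneg order_trans)
    thus "(m k * inner x (e k))\<^sup>2 \<le> C\<^sup>2 * (inner x (e k))\<^sup>2"
      by (simp add: power_mult_distrib mult_right_mono)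
  qed simp
  obtain z where "((\<lambda>k. (m k * inner x (e k)) *\<^sub>R e k) has_sum z) K"
    "\<And>k. k \<in> K \<Longrightarrow> inner z (e k) = m k * inner x (e k)"
    by (rule orthonormal_series[OF on sm]) blast
  thus ?thesis using assms(2) by (simp add: multiplier_def infsumI)
qed

lemma multiplier_inner:
  assumes "\<And>k. k \<in> K \<Longrightarrow> \<bar>m k\<bar> \<le> C"
  shows "((\<lambda>k. m k * inner x (e k) * inner y (e k)) has_sum inner (multiplier m x) y) K"
  using parseval[of "multiplier m x" y] multiplier_coord[OF assms] by (simp cong: has_sum_cong)

lemma multiplier_symmetric:
  assumes "\<And>k. k \<in> K \<Longrightarrow> \<bar>m k\<bar> \<le> C"
  shows "inner (multiplier m x) y = inner x (multiplier m y)"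
proof -
  have "((\<lambda>k. m k * inner x (e k) * inner y (e k)) has_sum inner (multiplier m y) x) K"
    using multiplier_inner[where m=m and x=y and y=x, OF assms] by (simp add: mult_ac)
  with multiplier_inner[OF assms] have "inner (multiplier m x) y = inner (multiplier m y) x"
    by (rule has_sum_unique)
  thus ?thesis by (simp add: inner_commute)
qed

lemma multiplier_bounded_linear:
  assumes "\<And>k. k \<in> K \<Longrightarrow> \<bar>m k\<bar> \<le> C"
  shows "bounded_linear (multiplier m)"
proof (rule bounded_linear_intro)
  note c = multiplier_coord[OF assms]
  show "multiplier m (x + y) = multiplier m x + multiplier m y" for x y
    by (rule coord_eqI) (simp add: c inner_add_left distrib_left)
  show "multiplier m (r *\<^sub>R x) = r *\<^sub>R multiplier m x" for r x
    by (rule coord_eqI) (simp add: c)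
  \<comment> \<open>\<open>\<bar>C\<bar>\<close> rather than \<open>C\<close>: for empty
    \<open>K\<close> the assumption does not force \<open>C\<close> to be nonnegative.\<close>
  show "norm (multiplier m x) \<le> norm x * \<bar>C\<bar>" for x
  proof -
    have "(norm (multiplier m x))\<^sup>2 \<le> C\<^sup>2 * (norm x)\<^sup>2"
      unfolding power2_norm_eq_inner
    proof (rule has_sum_mono)
      show "((\<lambda>k. m k * inner x (e k) * inner (multiplier m x) (e k)) has_sum
          inner (multiplier m x) (multiplier m x)) K" by (rule multiplier_inner[OF assms])
      show "((\<lambda>k. C\<^sup>2 * (inner x (e k) * inner x (e k))) has_sum C\<^sup>2 * inner x x) K"
        by (intro has_sum_cmult_right parseval)
      fix k assume k: "k \<in> K"
      hence "(m k)\<^sup>2 \<le> C\<^sup>2" using assms[of k] abs_ge_zero[of "m k"]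
        by (metis abs_le_square_iff abs_of_nonneg order_trans)
      hence "(m k)\<^sup>2 * (inner x (e k))\<^sup>2 \<le> C\<^sup>2 * (inner x (e k))\<^sup>2" by (rule mult_right_mono) simp
      thus "m k * inner x (e k) * inner (multiplier m x) (e k) \<le> C\<^sup>2 * (inner x (e k) * inner x (e k))"
        using k by (simp add: c power2_eq_square mult_ac)
    qed
    also have "\<dots> = (norm x * \<bar>C\<bar>)\<^sup>2" by (simp add: power_mult_distrib)
    finally show ?thesis by (rule power2_le_imp_le) simp
  qed
qed

lemma lam_nonneg: "k \<in> K \<Longrightarrow> 0 \<le> lam k"
  using nonneg eigen[of k] inner_e[of k k] unfolding nonneg_operator_def
  by (metis inner_scaleR_left mult.right_neutral)

lemma Q_coord: "k \<in> K \<Longrightarrow> inner (Q x) (e k) = lam k * inner x (e k)"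
  using nonneg eigen[of k] unfolding nonneg_operator_def by (metis inner_scaleR_right)

text \<open>An eigenvalue is at most the operator norm. This is the bound \<open>C\<close> for the
  multiplier that will be the square root.\<close>

lemma sqrt_lam_le: "k \<in> K \<Longrightarrow> \<bar>sqrt (lam k)\<bar> \<le> sqrt (onorm Q)"
proof -
  assume k: "k \<in> K"
  have bl: "bounded_linear Q" using nonneg by (simp add: nonneg_operator_def)
  have "norm (e k) = 1" using inner_e[OF k k] by (simp add: norm_eq_sqrt_inner)
  hence "lam k \<le> onorm Q" using onorm[OF bl, of "e k"] eigen[OF k] lam_nonneg[OF k] by simp
  thus ?thesis using lam_nonneg[OF k] by simp
qed

text \<open>Uniqueness of the nonnegative square root, tested on one eigenvector: \<open>?y\<close>
  is annihilated by \<open>R + ?s\<close>, and pairing with \<open>?y\<close> gives two nonnegative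
  terms with sum 0.\<close>

lemma square_root_coord:
  assumes R: "nonneg_operator R" "R \<circ> R = Q" and k: "k \<in> K"
  shows "R (e k) = sqrt (lam k) *\<^sub>R e k"
proof -
  interpret bounded_linear R using R by (simp add: nonneg_operator_def)
  have RR: "R (R x) = Q x" for x using R(2) by (metis comp_apply)
  have sym: "inner (R x) y = inner x (R y)" and pos: "0 \<le> inner (R x) x" for x y
    using R(1) by (auto simp: nonneg_operator_def)
  let ?s = "sqrt (lam k)" let ?y = "R (e k) - ?s *\<^sub>R e k"
  have s2: "?s * ?s = lam k" using lam_nonneg[OF k] by simp
  have "R ?y + ?s *\<^sub>R ?y = 0"
    by (simp add: diff scale RR eigen[OF k] scaleR_right_diff_distrib lam_nonneg[OF k])
  hence "inner (R ?y) ?y + ?s * inner ?y ?y = 0"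
    by (metis inner_add_left inner_scaleR_left inner_zero_left)
  moreover have "0 \<le> ?s * inner ?y ?y" using lam_nonneg[OF k] by simp
  ultimately have "?s * inner ?y ?y = 0" using pos[of ?y] by linarith
  hence "?s = 0 \<or> ?y = 0" by (auto simp: inner_eq_zero_iff)
  \<comment> \<open>For \<open>?s = 0\<close> the pairing says nothing about \<open>?y\<close>; here
    the squared norm of \<open>R (e k)\<close> is \<open>inner (e k) (Q (e k))\<close>, which is
    0.\<close>
  moreover have "R (e k) = 0" if "?s = 0"
  proof -
    have "inner (R (e k)) (R (e k)) = inner (e k) (Q (e k))" by (simp add: sym RR)
    also have "\<dots> = (?s * ?s) * inner (e k) (e k)" by (simp only: eigen[OF k] s2 inner_scaleR_right)
    finally show ?thesis using that by simp
  qed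
  ultimately show ?thesis by auto
qed

abbreviation R where "R \<equiv> operator_sqrt Q"
abbreviation P where "P \<equiv> pseudo_inverse R"

text \<open>The \<open>THE\<close> in \<open>operator_sqrt\<close> needs existence and uniqueness:
  the multiplier is a nonnegative square root, and every other one agrees with it on each
  \<open>e k\<close> by \<open>square_root_coord\<close>.\<close>

lemma operator_sqrt_eq: "R = multiplier (\<lambda>k. sqrt (lam k))" (is "_ = ?m")
  unfolding operator_sqrt_def
proof (rule the_equality)
  note b = sqrt_lam_le
  show m: "nonneg_operator ?m \<and> ?m \<circ> ?m = Q"
  proof
    have "0 \<le> inner (?m x) x" for x
      by (rule has_sum_nonneg[OF multiplier_inner[OF b]]) (auto simp: lam_nonneg mult.assoc)
    thus "nonneg_operator ?m"
      using multiplier_bounded_linear[OF b] multiplier_symmetric[OF b] by (auto simp: nonneg_operator_def)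
    show "?m \<circ> ?m = Q"
      by (rule ext, rule coord_eqI) (simp add: multiplier_coord[OF b] Q_coord lam_nonneg flip: mult.assoc)
  qed
  fix R' assume R': "nonneg_operator R' \<and> R' \<circ> R' = Q"
  show "R' = ?m"
  proof
    fix x
    have "bounded_linear (\<lambda>x. R' x - ?m x)"
      using R' m by (intro bounded_linear_sub) (auto simp: nonneg_operator_def)
    moreover have "R' (e k) - ?m (e k) = 0" if "k \<in> K" for k
      using square_root_coord[of R' k] square_root_coord[of ?m k] R' m that by simp
    ultimately have "R' x - ?m x = 0" by (rule bounded_linear_eq_0)
    thus "R' x = ?m x" by simp
  qed
qed

lemma R_coord: "k \<in> K \<Longrightarrow> inner (R x) (e k) = sqrt (lam k) * inner x (e k)"
  unfolding operator_sqrt_eq by (rule multiplier_coord[OF sqrt_lam_le])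

lemma bounded_linear_R: "bounded_linear R"
  unfolding operator_sqrt_eq by (rule multiplier_bounded_linear[OF sqrt_lam_le])

lemma subspace_U0: "subspace (U0 Q)"
  unfolding U0_def using bounded_linear_R
  by (intro linear_subspace_image subspace_UNIV bounded_linear.linear)

text \<open>The kernel of \<open>R\<close> is the orthogonal complement of these \<open>e k\<close>,
  so this set indexes an orthonormal basis of \<open>U0 Q\<close>.\<close>

definition Kp :: "nat set" where "Kp = {k \<in> K. 0 < lam k}"

lemma Kp_K: "k \<in> Kp \<Longrightarrow> k \<in> K" by (simp add: Kp_def)

lemma R_eq_0_iff: "R x = 0 \<longleftrightarrow> (\<forall>k\<in>Kp. inner x (e k) = 0)"
proof
  assume "R x = 0"
  thus "\<forall>k\<in>Kp. inner x (e k) = 0" using R_coord[of _ x] by (force simp: Kp_def)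
next
  assume *: "\<forall>k\<in>Kp. inner x (e k) = 0"
  have "inner (R x) (e k) = 0" if "k \<in> K" for k
    using * that lam_nonneg[OF that] by (auto simp: R_coord Kp_def less_le)
  thus "R x = 0" using coord_eqI[of "R x" 0] by simp
qed

text \<open>The orthogonal projection onto the closure of the range of \<open>R\<close>.\<close>

definition proj :: "'u \<Rightarrow> 'u" where "proj = multiplier (indicat_real Kp)"

lemma indicator_Kp_le: "k \<in> K \<Longrightarrow> \<bar>indicat_real Kp k\<bar> \<le> 1" by (simp add: indicator_def)

lemma proj_coord: "k \<in> K \<Longrightarrow> inner (proj x) (e k) = indicat_real Kp k * inner x (e k)"
  unfolding proj_def by (rule multiplier_coord[OF indicator_Kp_le])

lemma bounded_linear_proj: "bounded_linear proj"
  unfolding proj_def by (rule multiplier_bounded_linear[OF indicator_Kp_le])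

lemma proj_symmetric: "inner (proj x) y = inner x (proj y)"
  unfolding proj_def by (rule multiplier_symmetric[OF indicator_Kp_le])

lemma proj_idem: "proj (proj x) = proj x"
  by (rule coord_eqI) (auto simp: proj_coord indicator_def)

lemma R_proj: "R (proj x) = R x"
  by (rule coord_eqI) (use lam_nonneg in \<open>auto simp: R_coord proj_coord indicator_def Kp_def less_le\<close>)

lemma norm_proj_le: "norm (proj x) \<le> norm x"
proof -
  have "(norm (proj x))\<^sup>2 = inner (proj x) x"
    by (metis power2_norm_eq_inner proj_symmetric proj_idem inner_commute)
  also have "\<dots> \<le> norm (proj x) * norm x" by (rule norm_cauchy_schwarz)
  finally show ?thesis
    by (cases "proj x = 0") (simp_all add: power2_eq_square)
qed

text \<open>Preimages of \<open>R x\<close> differ by kernel vectors, and \<open>proj x\<close> is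
  the one orthogonal to the kernel. The difference of two such preimages lies in the kernel and is
  orthogonal to it, hence to itself.\<close>

lemma pseudo_inverse_R: "P (R x) = proj x"
  unfolding pseudo_inverse_def
proof (rule the_equality)
  have "inner (proj x) z = 0" if "R z = 0" for z
  proof -
    have "proj z = 0"
      by (rule coord_eqI) (use that R_eq_0_iff in \<open>auto simp: proj_coord indicator_def\<close>)
    thus ?thesis by (simp add: proj_symmetric)
  qed
  thus p: "R (proj x) = R x \<and> (\<forall>z. R z = 0 \<longrightarrow> inner (proj x) z = 0)" by (simp add: R_proj)
  fix y assume y: "R y = R x \<and> (\<forall>z. R z = 0 \<longrightarrow> inner y z = 0)"
  have "R (y - proj x) = 0"
    using y by (simp add: R_proj linear_diff[OF bounded_linear.linear[OF bounded_linear_R]])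
  hence "inner y (y - proj x) = 0" "inner (proj x) (y - proj x) = 0" using p y by blast+
  hence "inner (y - proj x) (y - proj x) = 0" by (simp add: inner_diff_left)
  thus "y = proj x" by simp
qed

lemma R_pseudo_inverse: "u \<in> U0 Q \<Longrightarrow> R (P u) = u"
  by (auto simp: U0_def pseudo_inverse_R R_proj)

text \<open>\<open>P u\<close> lies in the range of \<open>proj\<close>, so the symmetric projection
  contributed by \<open>P (R x)\<close> is absorbed.\<close>

lemma inner_pseudo_inverse: "u \<in> U0 Q \<Longrightarrow> inner (P (R x)) (P u) = inner x (P u)"
  by (auto simp: U0_def pseudo_inverse_R proj_symmetric proj_idem)

lemma norm_U0_eq: "norm_U0 Q u = norm (P u)"
  by (simp add: norm_U0_def inner_U0_def norm_eq_sqrt_inner)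

lemma linear_on_P: "linear_on_set (U0 Q) P"
proof -
  interpret R: bounded_linear R by (rule bounded_linear_R)
  interpret p: bounded_linear proj by (rule bounded_linear_proj)
  show ?thesis
    by (auto simp: linear_on_set_def U0_def pseudo_inverse_R p.add p.scaleR
      simp flip: R.add R.scaleR)
qed

text \<open>An orthonormal basis of \<open>U\<^sub>0\<close>, padded with zeros so that it is indexed by all naturals.\<close>

definition f :: "nat \<Rightarrow> 'u" where "f k = (if k \<in> K then sqrt (lam k) *\<^sub>R e k else 0)"

lemma R_e: "k \<in> K \<Longrightarrow> R (e k) = f k"
  by (rule coord_eqI) (auto simp: R_coord f_def inner_e)

lemma f_U0: "f k \<in> U0 Q"
proof (cases "k \<in> K")
  case True thus ?thesis by (auto simp: U0_def R_e[symmetric])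
next
  case False thus ?thesis using subspace_0[OF subspace_U0] by (simp add: f_def)
qed

lemma f_eq_0: "k \<notin> Kp \<Longrightarrow> f k = 0"
  using lam_nonneg[of k] by (auto simp: f_def Kp_def)

lemma P_f: "k \<in> Kp \<Longrightarrow> P (f k) = e k"
  using Kp_K[of k] by (auto simp: R_e[symmetric] pseudo_inverse_R intro!: coord_eqI simp: proj_coord inner_e)

text \<open>\<open>P\<close> maps \<open>f k\<close> to \<open>e k\<close>, which carries over
  orthonormality. A vector orthogonal to all \<open>f k\<close> has its pseudo-inverse in the kernel
  of \<open>R\<close>, while \<open>R\<close> maps that pseudo-inverse back to the vector.\<close>

lemma orthonormal_basis_f: "orthonormal_basis_U0 Q (f ` Kp)"
  unfolding orthonormal_basis_U0_def
proof (intro conjI ballI impI)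
  show "f ` Kp \<subseteq> U0 Q" using f_U0 by auto
  fix b c assume "b \<in> f ` Kp" "c \<in> f ` Kp"
  then obtain j k where jk: "j \<in> Kp" "k \<in> Kp" "b = f j" "c = f k" by auto
  have "f j = f k \<Longrightarrow> j = k" using jk P_f inner_e[of j k] Kp_K
    by (metis inner_e zero_neq_one)
  thus "inner_U0 Q b c = (if b = c then 1 else 0)"
    using jk Kp_K by (auto simp: inner_U0_def P_f inner_e)
next
  fix v assume v: "v \<in> U0 Q" "\<forall>b\<in>f ` Kp. inner_U0 Q v b = 0"
  hence "\<forall>k\<in>Kp. inner (P v) (e k) = 0" by (auto simp: inner_U0_def P_f)
  hence "R (P v) = 0" by (simp add: R_eq_0_iff)
  thus "v = 0" using v R_pseudo_inverse by simp
qed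

text \<open>A bounded operator \<open>\<Phi>\<close> on \<open>U\<^sub>0\<close> corresponds to \<open>\<Phi> \<circ> R\<close> on all of \<open>U\<close>, and an orthonormal
  basis of \<open>U\<^sub>0\<close> to an orthonormal family in \<open>U\<close>.\<close>

definition bounded_U0 :: "('u \<Rightarrow> 'b::real_normed_vector) \<Rightarrow> bool" where
  "bounded_U0 \<Phi> \<longleftrightarrow> linear_on_set (U0 Q) \<Phi> \<and> (\<forall>u. u \<notin> U0 Q \<longrightarrow> \<Phi> u = 0) \<and>
     (\<exists>C. \<forall>u\<in>U0 Q. norm (\<Phi> u) \<le> C * norm_U0 Q u)"

lemma bounded_U0_zero: "bounded_U0 \<Phi> \<Longrightarrow> \<Phi> 0 = 0"
  unfolding bounded_U0_def linear_on_set_def using subspace_0[OF subspace_U0] by (metis scaleR_zero_left)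

text \<open>The bound survives because the \<open>U0\<close> norm of \<open>R x\<close> is the norm
  of \<open>proj x\<close>.\<close>

lemma bounded_linear_comp_R:
  assumes "bounded_U0 \<Phi>"
  shows "bounded_linear (\<lambda>x. \<Phi> (R x))"
proof -
  interpret R: bounded_linear R by (rule bounded_linear_R)
  obtain C where C: "\<forall>u\<in>U0 Q. norm (\<Phi> u) \<le> C * norm_U0 Q u" using assms by (auto simp: bounded_U0_def)
  have lin: "linear_on_set (U0 Q) \<Phi>" using assms by (auto simp: bounded_U0_def)
  show ?thesis
  proof (rule bounded_linear_intro[where K="\<bar>C\<bar>"])
    show "\<Phi> (R (x + y)) = \<Phi> (R x) + \<Phi> (R y)" for x y
      using lin by (auto simp: linear_on_set_def R.add U0_def)
    show "\<Phi> (R (r *\<^sub>R x)) = r *\<^sub>R \<Phi> (R x)" for r x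
      using lin by (auto simp: linear_on_set_def R.scaleR U0_def)
    fix x
    have "norm (\<Phi> (R x)) \<le> C * norm_U0 Q (R x)" using C by (auto simp: U0_def)
    also have "\<dots> = C * norm (proj x)" by (simp add: norm_U0_eq pseudo_inverse_R)
    also have "\<dots> \<le> \<bar>C\<bar> * norm x" by (intro mult_mono norm_proj_le) auto
    finally show "norm (\<Phi> (R x)) \<le> norm x * \<bar>C\<bar>" by (simp add: mult.commute)
  qed
qed

lemma bounded_U0_eqI:
  assumes "bounded_U0 \<Phi>" "bounded_U0 \<Theta>" "\<And>k. \<Phi> (f k) = \<Theta> (f k)"
  shows "\<Phi> = \<Theta>"
proof
  fix u
  show "\<Phi> u = \<Theta> u"
  proof (cases "u \<in> U0 Q")
    case True
    then obtain x where x: "u = R x" by (auto simp: U0_def)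
    have "\<Phi> (R x) - \<Theta> (R x) = 0"
      by (rule bounded_linear_eq_0[OF bounded_linear_sub[OF bounded_linear_comp_R bounded_linear_comp_R]])
        (use assms in \<open>auto simp: R_e\<close>)
    thus ?thesis by (simp add: x)
  next
    case False thus ?thesis using assms by (simp add: bounded_U0_def)
  qed
qed

text \<open>\<open>hilbert_schmidt_le\<close> is applied to \<open>\<Phi> \<circ> R\<close> in both
  directions, between \<open>P b\<close> for \<open>b\<close> in \<open>B\<close> and
  \<open>e k\<close> for \<open>k\<close> in \<open>Kp\<close>. Its vanishing condition holds
  because a vector orthogonal to either family is in the kernel of \<open>R\<close>. Basis-dependent
  definitions thereby become one series over the naturals.\<close>

lemma hilbert_schmidt_basis:
  fixes \<Phi> :: "'u \<Rightarrow> 'b::real_inner"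
  assumes \<Phi>: "bounded_U0 \<Phi>" and B: "orthonormal_basis_U0 Q B"
  shows "(\<lambda>b. (norm (\<Phi> b))\<^sup>2) summable_on B \<longleftrightarrow> summable (\<lambda>k. (norm (\<Phi> (f k)))\<^sup>2)"
    and "summable (\<lambda>k. (norm (\<Phi> (f k)))\<^sup>2) \<Longrightarrow>
      (\<Sum>\<^sub>\<infinity>b\<in>B. (norm (\<Phi> b))\<^sup>2) = (\<Sum>k. (norm (\<Phi> (f k)))\<^sup>2)"
proof -
  let ?G = "\<lambda>x. \<Phi> (R x)"
  note G = bounded_linear_comp_R[OF \<Phi>]
  have BU: "B \<subseteq> U0 Q" using B by (simp add: orthonormal_basis_U0_def)
  have onB: "orthonormal_family B P"
    using B by (simp add: orthonormal_basis_U0_def orthonormal_family_def inner_U0_def)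
  have onK: "orthonormal_family Kp e" by (rule orthonormal_family_subset[OF on]) (auto simp: Kp_def)
  have kerB: "?G x = 0" if "\<forall>b\<in>B. inner x (P b) = 0" for x
  proof -
    have "\<forall>b\<in>B. inner_U0 Q (R x) b = 0"
      using that BU by (auto simp: inner_U0_def inner_pseudo_inverse subset_iff)
    hence "R x = 0" using B by (auto simp: orthonormal_basis_U0_def U0_def)
    thus ?thesis by (simp add: bounded_U0_zero[OF \<Phi>])
  qed
  have kerK: "?G x = 0" if "\<forall>k\<in>Kp. inner x (e k) = 0" for x
    using that R_eq_0_iff[of x] by (simp add: bounded_U0_zero[OF \<Phi>])
  have GB: "b \<in> B \<Longrightarrow> ?G (P b) = \<Phi> b" for b using BU R_pseudo_inverse by auto
  have GK: "k \<in> Kp \<Longrightarrow> ?G (e k) = \<Phi> (f k)" for k using Kp_K R_e by auto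
  have cB: "(\<lambda>b. (norm (?G (P b)))\<^sup>2) summable_on B \<longleftrightarrow> (\<lambda>b. (norm (\<Phi> b))\<^sup>2) summable_on B"
    "(\<Sum>\<^sub>\<infinity>b\<in>B. (norm (?G (P b)))\<^sup>2) = (\<Sum>\<^sub>\<infinity>b\<in>B. (norm (\<Phi> b))\<^sup>2)"
    using GB by (auto intro!: summable_on_cong infsum_cong)
  \<comment> \<open>Outside \<open>Kp\<close> the vector \<open>f k\<close> is 0, so passing to all
    naturals changes no sum.\<close>
  have cK: "(\<lambda>k. (norm (?G (e k)))\<^sup>2) summable_on Kp \<longleftrightarrow> (\<lambda>k. (norm (\<Phi> (f k)))\<^sup>2) summable_on UNIV"
    "(\<Sum>\<^sub>\<infinity>k\<in>Kp. (norm (?G (e k)))\<^sup>2) = (\<Sum>\<^sub>\<infinity>k. (norm (\<Phi> (f k)))\<^sup>2)"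
    by (rule summable_on_cong_neutral infsum_cong_neutral;
      simp add: GK f_eq_0 bounded_U0_zero[OF \<Phi>])+
  have nat: "(\<lambda>k. (norm (\<Phi> (f k)))\<^sup>2) summable_on UNIV \<longleftrightarrow> summable (\<lambda>k. (norm (\<Phi> (f k)))\<^sup>2)"
    by (rule summable_on_UNIV_nonneg_real_iff) simp
  have BK: "(\<lambda>k. (norm (\<Phi> (f k)))\<^sup>2) summable_on UNIV"
      "(\<Sum>\<^sub>\<infinity>k. (norm (\<Phi> (f k)))\<^sup>2) \<le> (\<Sum>\<^sub>\<infinity>b\<in>B. (norm (\<Phi> b))\<^sup>2)"
    if "(\<lambda>b. (norm (\<Phi> b))\<^sup>2) summable_on B"
    using hilbert_schmidt_le[OF G onB onK kerB that[folded cB(1)]] unfolding cB cK by blast+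
  have KB: "(\<lambda>b. (norm (\<Phi> b))\<^sup>2) summable_on B"
      "(\<Sum>\<^sub>\<infinity>b\<in>B. (norm (\<Phi> b))\<^sup>2) \<le> (\<Sum>\<^sub>\<infinity>k. (norm (\<Phi> (f k)))\<^sup>2)"
    if "(\<lambda>k. (norm (\<Phi> (f k)))\<^sup>2) summable_on UNIV"
    using hilbert_schmidt_le[OF G onK onB kerK that[folded cK(1)]] unfolding cB cK by blast+
  show iff: "(\<lambda>b. (norm (\<Phi> b))\<^sup>2) summable_on B \<longleftrightarrow> summable (\<lambda>k. (norm (\<Phi> (f k)))\<^sup>2)"
    using BK(1) KB(1) nat by blast
  assume s: "summable (\<lambda>k. (norm (\<Phi> (f k)))\<^sup>2)"
  hence sU: "(\<lambda>k. (norm (\<Phi> (f k)))\<^sup>2) summable_on UNIV" using nat by blast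
  hence "(\<Sum>\<^sub>\<infinity>k. (norm (\<Phi> (f k)))\<^sup>2) = (\<Sum>k. (norm (\<Phi> (f k)))\<^sup>2)"
    using has_sum_imp_sums[OF has_sum_infsum[OF sU]] sums_unique by blast
  thus "(\<Sum>\<^sub>\<infinity>b\<in>B. (norm (\<Phi> b))\<^sup>2) = (\<Sum>k. (norm (\<Phi> (f k)))\<^sup>2)"
    using BK(2) KB(2) s iff nat by fastforce
qed

text \<open>The quantifier over all bases in \<open>L20\<close> collapses to the series along
  \<open>f\<close>; it is not vacuous because \<open>orthonormal_basis_f\<close> exhibits a
  basis.\<close>

lemma L20_iff:
  fixes \<Phi> :: "'u \<Rightarrow> 'b::real_inner"
  shows "\<Phi> \<in> L20 Q \<longleftrightarrow> bounded_U0 \<Phi> \<and> summable (\<lambda>k. (norm (\<Phi> (f k)))\<^sup>2)"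
  unfolding L20_def using hilbert_schmidt_basis(1) orthonormal_basis_f by (auto simp: bounded_U0_def)

lemma L20_norm_sq:
  fixes \<Phi> :: "'u \<Rightarrow> 'b::real_inner"
  assumes "\<Phi> \<in> L20 Q"
  shows "(L20_norm Q \<Phi>)\<^sup>2 = (\<Sum>k. (norm (\<Phi> (f k)))\<^sup>2)"
proof -
  have "orthonormal_basis_U0 Q (SOME B. orthonormal_basis_U0 Q B)"
    using orthonormal_basis_f by (rule someI)
  thus ?thesis
    using assms hilbert_schmidt_basis(2)[of \<Phi> "SOME B. orthonormal_basis_U0 Q B"]
    by (simp add: L20_norm_def L20_iff suminf_nonneg)
qed

lemma L20_norm_eq:
  fixes \<Phi> :: "'u \<Rightarrow> 'b::real_inner"
  assumes "\<Phi> \<in> L20 Q"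
  shows "L20_norm Q \<Phi> = sqrt (\<Sum>k. (norm (\<Phi> (f k)))\<^sup>2)"
proof -
  have "0 \<le> L20_norm Q \<Phi>" by (simp add: L20_norm_def infsum_nonneg)
  thus ?thesis by (simp add: L20_norm_sq[OF assms, symmetric])
qed

section \<open>Vector space operations and rank-one operators in \<open>L20\<close>\<close>

lemma L20_add:
  fixes \<Phi> \<Theta> :: "'u \<Rightarrow> 'b::real_inner"
  assumes "\<Phi> \<in> L20 Q" "\<Theta> \<in> L20 Q"
  shows "(\<lambda>u. \<Phi> u + \<Theta> u) \<in> L20 Q"
proof -
  obtain C1 C2 where "\<forall>u\<in>U0 Q. norm (\<Phi> u) \<le> C1 * norm_U0 Q u" "\<forall>u\<in>U0 Q. norm (\<Theta> u) \<le> C2 * norm_U0 Q u"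
    using assms by (auto simp: L20_def)
  hence "\<forall>u\<in>U0 Q. norm (\<Phi> u + \<Theta> u) \<le> (C1 + C2) * norm_U0 Q u"
    by (auto simp: distrib_right intro!: norm_triangle_mono)
  moreover have "linear_on_set (U0 Q) (\<lambda>u. \<Phi> u + \<Theta> u)"
    using assms by (auto simp: L20_def linear_on_set_def scaleR_right_distrib)
  ultimately have "bounded_U0 (\<lambda>u. \<Phi> u + \<Theta> u)"
    using assms by (auto simp: bounded_U0_def L20_def)
  thus ?thesis using assms sums_norm_triangle(1) by (auto simp: L20_iff)
qed

lemma L20_bounded_linear:
  fixes \<Phi> :: "'u \<Rightarrow> 'b::real_inner" and G :: "'b \<Rightarrow> 'c::real_inner"
  assumes "\<Phi> \<in> L20 Q" and G: "bounded_linear G"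
  shows "(\<lambda>u. G (\<Phi> u)) \<in> L20 Q"
proof -
  interpret G: bounded_linear G by fact
  obtain C where C: "\<forall>u\<in>U0 Q. norm (\<Phi> u) \<le> C * norm_U0 Q u" using assms by (auto simp: L20_def)
  have le: "norm (G x) \<le> onorm G * norm x" for x by (rule onorm[OF G])
  have "\<forall>u\<in>U0 Q. norm (G (\<Phi> u)) \<le> (onorm G * C) * norm_U0 Q u"
  proof
    fix u assume "u \<in> U0 Q"
    with C have "onorm G * norm (\<Phi> u) \<le> onorm G * (C * norm_U0 Q u)"
      by (intro mult_left_mono onorm_pos_le G) auto
    with le[of "\<Phi> u"] show "norm (G (\<Phi> u)) \<le> (onorm G * C) * norm_U0 Q u" by (simp add: mult.assoc)
  qed
  moreover have "linear_on_set (U0 Q) (\<lambda>u. G (\<Phi> u))"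
    using assms by (auto simp: L20_def linear_on_set_def G.add G.scaleR)
  ultimately have "bounded_U0 (\<lambda>u. G (\<Phi> u))"
    using assms by (auto simp: bounded_U0_def L20_def G.zero)
  moreover have "summable (\<lambda>k. (norm (G (\<Phi> (f k))))\<^sup>2)"
  proof (rule summable_comparison_test'[where N=0])
    show "summable (\<lambda>k. (onorm G)\<^sup>2 * (norm (\<Phi> (f k)))\<^sup>2)"
      using assms(1) by (intro summable_mult) (simp add: L20_iff)
    show "norm ((norm (G (\<Phi> (f k))))\<^sup>2) \<le> (onorm G)\<^sup>2 * (norm (\<Phi> (f k)))\<^sup>2" for k
      using power_mono[OF le, of "\<Phi> (f k)" 2] by (simp add: power_mult_distrib)
  qed
  ultimately show ?thesis by (simp add: L20_iff)
qed

lemma L20_scaleR: "\<Phi> \<in> L20 Q \<Longrightarrow> (\<lambda>u. c *\<^sub>R \<Phi> u :: 'b::real_inner) \<in> L20 Q"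
  using L20_bounded_linear[OF _ bounded_linear_scaleR_right] by blast

lemma L20_diff:
  "\<Phi> \<in> L20 Q \<Longrightarrow> \<Theta> \<in> L20 Q \<Longrightarrow> (\<lambda>u. \<Phi> u - \<Theta> u :: 'b::real_inner) \<in> L20 Q"
  using L20_add[of \<Phi> "\<lambda>u. - \<Theta> u"] L20_bounded_linear[of \<Theta> uminus] by (simp add: bounded_linear_minus bounded_linear_ident)

lemma L20_zero: "(\<lambda>u. 0 :: 'b::real_inner) \<in> L20 Q"
  by (simp add: L20_def linear_on_set_def exI[of _ 0])

lemma L20_sum:
  "(\<And>i. i \<in> I \<Longrightarrow> \<Phi> i \<in> L20 Q) \<Longrightarrow> (\<lambda>u. \<Sum>i\<in>I. \<Phi> i u :: 'b::real_inner) \<in> L20 Q"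
  by (induction I rule: infinite_finite_induct) (auto simp: L20_zero L20_add)

text \<open>\<open>inner (P u) (e k)\<close> is the coordinate of \<open>u\<close> along
  \<open>f k\<close> in \<open>U0 Q\<close>, so for \<open>k\<close> in \<open>Kp\<close> this
  operator sends \<open>f k\<close> to \<open>h\<close> and every other \<open>f j\<close> to
  0.\<close>

definition rank_one :: "nat \<Rightarrow> 'b \<Rightarrow> 'u \<Rightarrow> 'b::real_inner" where
  "rank_one k h u = (if u \<in> U0 Q then inner (P u) (e k) *\<^sub>R h else 0)"

lemma rank_one_f: "k \<in> Kp \<Longrightarrow> rank_one k h (f j) = (if j = k then h else 0)"
proof (cases "j \<in> Kp")
  case False
  moreover assume "k \<in> Kp"
  moreover have "P 0 = 0" using pseudo_inverse_R[of 0] bounded_linear_R bounded_linear_proj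
    by (simp add: linear_0 bounded_linear.linear)
  ultimately show ?thesis by (auto simp: rank_one_def f_eq_0)
qed (use Kp_K in \<open>auto simp: rank_one_def f_U0 P_f inner_e\<close>)

lemma rank_one_L20:
  assumes "k \<in> Kp"
  shows "rank_one k h \<in> L20 Q"
proof -
  have "norm (rank_one k h u) \<le> norm h * norm_U0 Q u" if "u \<in> U0 Q" for u
  proof -
    have "\<bar>inner (P u) (e k)\<bar> \<le> norm (P u) * norm (e k)" by (rule Cauchy_Schwarz_ineq2)
    also have "norm (e k) = 1" using inner_e[of k k] assms Kp_K by (simp add: norm_eq_sqrt_inner)
    finally have "\<bar>inner (P u) (e k)\<bar> * norm h \<le> norm (P u) * norm h" by (intro mult_right_mono) auto
    thus ?thesis using that by (simp add: rank_one_def norm_U0_eq mult.commute)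
  qed
  moreover have "linear_on_set (U0 Q) (rank_one k h)"
    using linear_on_P subspace_U0
    by (auto simp: linear_on_set_def rank_one_def inner_add_left scaleR_left_distrib subspace_add subspace_scale)
  ultimately have "bounded_U0 (rank_one k h)"
    by (auto simp: bounded_U0_def rank_one_def)
  moreover have "summable (\<lambda>j. (norm (rank_one k h (f j)))\<^sup>2)"
    by (rule summable_finite[of "{k}"]) (auto simp: rank_one_f[OF assms])
  ultimately show ?thesis by (simp add: L20_iff)
qed

section \<open>Metric, separability and Borel sets of \<open>L20\<close>\<close>

lemma L20_dist_eq:
  fixes \<Phi> \<Theta> :: "'u \<Rightarrow> 'b::real_inner"
  assumes "\<Phi> \<in> L20 Q" "\<Theta> \<in> L20 Q"
  shows "L20_dist Q \<Phi> \<Theta> = sqrt (\<Sum>k. (norm (\<Phi> (f k) - \<Theta> (f k)))\<^sup>2)"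
  unfolding L20_dist_def using L20_norm_eq[OF L20_diff[OF assms]] .

lemma L20_summable_diff:
  fixes \<Phi> \<Theta> :: "'u \<Rightarrow> 'b::real_inner"
  assumes "\<Phi> \<in> L20 Q" "\<Theta> \<in> L20 Q"
  shows "summable (\<lambda>k. (norm (\<Phi> (f k) - \<Theta> (f k)))\<^sup>2)"
  using L20_diff[OF assms] by (simp add: L20_iff)

lemma norm_coord_le_dist:
  fixes \<Phi> \<Theta> :: "'u \<Rightarrow> 'b::real_inner"
  assumes "\<Phi> \<in> L20 Q" "\<Theta> \<in> L20 Q"
  shows "norm (\<Phi> (f k) - \<Theta> (f k)) \<le> L20_dist Q \<Phi> \<Theta>"
proof -
  have "(norm (\<Phi> (f k) - \<Theta> (f k)))\<^sup>2 \<le> (\<Sum>k. (norm (\<Phi> (f k) - \<Theta> (f k)))\<^sup>2)"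
    using sum_le_suminf[OF L20_summable_diff[OF assms], of "{k}"] by simp
  thus ?thesis unfolding L20_dist_eq[OF assms] by (rule real_le_rsqrt)
qed

lemma Metric_space_L20:
  "Metric_space (L20 Q :: ('u \<Rightarrow> 'b::real_inner) set) (L20_dist Q)"
proof
  fix \<Phi> \<Theta> :: "'u \<Rightarrow> 'b"
  show "0 \<le> L20_dist Q \<Phi> \<Theta>" by (simp add: L20_dist_def L20_norm_def infsum_nonneg)
  show "L20_dist Q \<Phi> \<Theta> = L20_dist Q \<Theta> \<Phi>"
    by (simp add: L20_dist_def L20_norm_def norm_minus_commute)
  assume \<Phi>: "\<Phi> \<in> L20 Q" and \<Theta>: "\<Theta> \<in> L20 Q"
  show "L20_dist Q \<Phi> \<Theta> = 0 \<longleftrightarrow> \<Phi> = \<Theta>"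
  proof
    assume "L20_dist Q \<Phi> \<Theta> = 0"
    hence "\<Phi> (f k) = \<Theta> (f k)" for k using norm_coord_le_dist[OF \<Phi> \<Theta>, of k] by simp
    thus "\<Phi> = \<Theta>" using \<Phi> \<Theta> by (intro bounded_U0_eqI) (auto simp: L20_iff)
  qed (use L20_dist_eq[OF \<Phi> \<Phi>] in simp)
  fix \<Xi> :: "'u \<Rightarrow> 'b" assume \<Xi>: "\<Xi> \<in> L20 Q"
  show "L20_dist Q \<Phi> \<Xi> \<le> L20_dist Q \<Phi> \<Theta> + L20_dist Q \<Theta> \<Xi>"
    using sums_norm_triangle(2)[OF L20_summable_diff[OF \<Phi> \<Theta>] L20_summable_diff[OF \<Theta> \<Xi>]]
    by (simp add: L20_dist_eq \<Phi> \<Theta> \<Xi>)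
qed

text \<open>Finite sums of \<open>rank_one\<close> operators with values in a countable dense set
  \<open>D\<close>; coding the values as lists makes countability immediate. The squared error
  splits into a tail and finitely many coordinate errors, each part below
  \<open>r\<^sup>2 / 2\<close>.\<close>

lemma L20_countable_dense:
  obtains E :: "('u \<Rightarrow> 'b::{real_inner,second_countable_topology}) set" where
    "countable E" "E \<subseteq> L20 Q" "\<And>\<Phi> r. \<Phi> \<in> L20 Q \<Longrightarrow> 0 < r \<Longrightarrow> \<exists>d\<in>E. L20_dist Q \<Phi> d < r"
proof -
  obtain D :: "'b set" where D: "countable D" "\<And>X. open X \<Longrightarrow> X \<noteq> {} \<Longrightarrow> \<exists>d\<in>D. d \<in> X"
    by (erule countable_dense_setE)
  define op where "op n l = (\<lambda>u. \<Sum>k\<in>Kp \<inter> {..<n}. rank_one k (l ! k :: 'b) u)" for n l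
  have op_L20: "op n l \<in> L20 Q" for n l
    unfolding op_def by (intro L20_sum rank_one_L20) auto
  have op_f: "op n l (f k) = (if k \<in> Kp \<and> k < n then l ! k else 0)" for n l k
  proof -
    have "op n l (f k) = (\<Sum>j\<in>Kp \<inter> {..<n}. if j = k then l ! k else 0)"
      unfolding op_def by (intro sum.cong) (auto simp: rank_one_f)
    thus ?thesis by simp
  qed
  show thesis
  proof
    show "countable ((\<lambda>(n, l). op n l) ` (UNIV \<times> lists D))"
      using D(1) by (intro countable_image countable_SIGMA) auto
    show "(\<lambda>(n, l). op n l) ` (UNIV \<times> lists D) \<subseteq> L20 Q" using op_L20 by auto
    fix \<Phi> :: "'u \<Rightarrow> 'b" and r :: real assume \<Phi>: "\<Phi> \<in> L20 Q" and r: "0 < r"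
    have sm: "summable (\<lambda>k. (norm (\<Phi> (f k)))\<^sup>2)" using \<Phi> by (simp add: L20_iff)
    obtain n where "\<forall>n'\<ge>n. norm (\<Sum>k. (norm (\<Phi> (f (k + n'))))\<^sup>2) < r\<^sup>2 / 2"
      using suminf_exist_split[OF _ sm, of "r\<^sup>2/2"] r by auto
    hence n: "(\<Sum>k. (norm (\<Phi> (f (k + n))))\<^sup>2) < r\<^sup>2 / 2" by fastforce
    \<comment> \<open>\<open>n + 1\<close> instead of \<open>n\<close> makes the inequality for
      \<open>n\<close> errors strict and admits \<open>n = 0\<close>.\<close>
    define \<delta> where "\<delta> = r / sqrt (2 * (real n + 1))"
    have \<delta>: "0 < \<delta>" "real n * \<delta>\<^sup>2 < r\<^sup>2 / 2" using r
      by (auto simp: \<delta>_def power_divide field_simps)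
    have "\<forall>k. \<exists>d\<in>D. d \<in> ball (\<Phi> (f k)) \<delta>" using D(2)[of "ball _ \<delta>"] \<delta>(1) by simp
    then obtain d where d: "\<And>k. d k \<in> D" "\<And>k. norm (\<Phi> (f k) - d k) < \<delta>"
      by (auto simp: dist_norm choice_iff Bex_def)
    let ?o = "op n (map d [0..<n])"
    have o: "?o (f k) = (if k \<in> Kp \<and> k < n then d k else 0)" for k by (auto simp: op_f)
    have "(\<Sum>k. (norm (\<Phi> (f k) - ?o (f k)))\<^sup>2) =
        (\<Sum>k. (norm (\<Phi> (f (k + n)) - ?o (f (k + n))))\<^sup>2) + (\<Sum>k<n. (norm (\<Phi> (f k) - ?o (f k)))\<^sup>2)"
      by (rule suminf_split_initial_segment[OF L20_summable_diff[OF \<Phi> op_L20]])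
    also have "(\<Sum>k. (norm (\<Phi> (f (k + n)) - ?o (f (k + n))))\<^sup>2) < r\<^sup>2 / 2" using n by (simp add: o)
    also have "(\<Sum>k<n. (norm (\<Phi> (f k) - ?o (f k)))\<^sup>2) \<le> (\<Sum>k<n. \<delta>\<^sup>2)"
    proof (rule sum_mono)
      fix k assume k: "k \<in> {..<n}"
      have "norm (\<Phi> (f k) - ?o (f k)) \<le> \<delta>"
      proof (cases "k \<in> Kp")
        case True thus ?thesis using d(2)[of k] k by (simp add: o)
      next
        case False
        have "?o (f k) = 0" by (subst o) (simp add: False)
        moreover have "\<Phi> (f k) = 0"
          using False \<Phi> bounded_U0_zero[of \<Phi>] by (simp add: f_eq_0 L20_iff)
        ultimately show ?thesis using \<delta> by simp
      qed
      thus "(norm (\<Phi> (f k) - ?o (f k)))\<^sup>2 \<le> \<delta>\<^sup>2" by (rule power_mono) simp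
    qed
    also have "(\<Sum>k<n. \<delta>\<^sup>2) < r\<^sup>2 / 2" using \<delta> by simp
    finally have "(\<Sum>k. (norm (\<Phi> (f k) - ?o (f k)))\<^sup>2) < r\<^sup>2" by simp
    hence "L20_dist Q \<Phi> ?o < r"
      using r by (simp add: L20_dist_eq[OF \<Phi> op_L20] real_less_lsqrt suminf_nonneg L20_summable_diff[OF \<Phi> op_L20])
    moreover have "?o \<in> (\<lambda>(n, l). op n l) ` (UNIV \<times> lists D)"
      using d(1) by (intro image_eqI[of _ _ "(n, map d [0..<n])"]) auto
    ultimately show "\<exists>d\<in>(\<lambda>(n, l). op n l) ` (UNIV \<times> lists D). L20_dist Q \<Phi> d < r" by blast
  qed
qed

lemma space_L20_borel: "space (L20_borel Q :: ('u \<Rightarrow> 'b::real_inner) measure) = L20 Q"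
  by (simp add: L20_borel_def space_measure_of_conv)

text \<open>Evaluations at \<open>f k\<close> are 1-Lipschitz for \<open>L20_dist\<close>, hence
  Borel. Conversely, separability writes an open set as a countable union of balls, and the distance
  to a centre is a measurable function of the coordinates. Predictability of operator-valued
  processes is thereby reduced to that of their coordinates.\<close>

lemma measurable_L20_iff:
  fixes X :: "'x \<Rightarrow> 'u \<Rightarrow> 'b::{real_inner,second_countable_topology}"
  shows "X \<in> N \<rightarrow>\<^sub>M L20_borel Q \<longleftrightarrow>
    X \<in> space N \<rightarrow> L20 Q \<and> (\<forall>k. (\<lambda>x. X x (f k)) \<in> borel_measurable N)"
proof -
  interpret Metric_space "L20 Q :: ('u \<Rightarrow> 'b) set" "L20_dist Q" by (rule Metric_space_L20)
  let ?\<G> = "{G. openin mtopology (G :: ('u \<Rightarrow> 'b) set)}"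
  have sub: "?\<G> \<subseteq> Pow (L20 Q)" using openin_subset[of mtopology] by auto
  have "(\<lambda>\<Phi>. \<Phi> (f k)) \<in> borel_measurable (L20_borel Q :: ('u \<Rightarrow> 'b) measure)" for k
  proof (rule borel_measurableI)
    fix S :: "'b set" assume S: "open S"
    let ?G = "(\<lambda>\<Phi>. \<Phi> (f k)) -` S \<inter> L20 Q"
    have "openin mtopology ?G"
      unfolding openin_mtopology
    proof (intro conjI allI impI)
      fix \<Phi> assume \<Phi>: "\<Phi> \<in> ?G"
      then obtain r where r: "0 < r" "ball (\<Phi> (f k)) r \<subseteq> S" using S open_contains_ball by blast
      have "mball \<Phi> r \<subseteq> ?G"
      proof
        fix \<Theta> assume \<Theta>: "\<Theta> \<in> mball \<Phi> r"
        hence "norm (\<Phi> (f k) - \<Theta> (f k)) < r"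
          using norm_coord_le_dist[of \<Phi> \<Theta> k] by (auto simp: mball_def)
        thus "\<Theta> \<in> ?G" using r \<Theta> by (auto simp: mball_def dist_norm)
      qed
      with r show "\<exists>r>0. mball \<Phi> r \<subseteq> ?G" by blast
    qed auto
    thus "(\<lambda>\<Phi>. \<Phi> (f k)) -` S \<inter> space (L20_borel Q) \<in> sets (L20_borel Q)"
      using sub by (auto simp: L20_borel_def)
  qed
  note coord = measurable_compose[OF _ this]
  moreover have "X \<in> N \<rightarrow>\<^sub>M L20_borel Q"
    if X: "X \<in> space N \<rightarrow> L20 Q" and [measurable]: "\<And>k. (\<lambda>x. X x (f k)) \<in> borel_measurable N"
    unfolding L20_borel_def
  proof (rule measurable_measure_of[OF sub X])
    fix G :: "('u \<Rightarrow> 'b) set" assume "G \<in> ?\<G>"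
    hence G: "G \<subseteq> L20 Q" "\<And>\<Phi>. \<Phi> \<in> G \<Longrightarrow> \<exists>r>0. mball \<Phi> r \<subseteq> G" by (auto simp: openin_mtopology)
    obtain E :: "('u \<Rightarrow> 'b) set" where E: "countable E" "E \<subseteq> L20 Q"
      "\<And>\<Phi> r. \<Phi> \<in> L20 Q \<Longrightarrow> 0 < r \<Longrightarrow> \<exists>d\<in>E. L20_dist Q \<Phi> d < r" using L20_countable_dense by metis
    let ?I = "{(d, q). d \<in> E \<and> q \<in> \<rat> \<and> mball d q \<subseteq> G}"
    have cI: "countable ?I" using E(1) countable_rat
      by (rule countable_subset[rotated, OF countable_SIGMA]) auto
    have "G = (\<Union>(d, q)\<in>?I. mball d q)"
    proof
      show "G \<subseteq> (\<Union>(d, q)\<in>?I. mball d q)"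
      proof
        fix \<Phi> assume \<Phi>: "\<Phi> \<in> G"
        then obtain r where r: "0 < r" "mball \<Phi> r \<subseteq> G" using G by blast
        obtain d where d: "d \<in> E" "L20_dist Q \<Phi> d < r / 2" using E(3)[of \<Phi> "r/2"] r \<Phi> G by auto
        \<comment> \<open>A radius above the distance keeps \<open>\<Phi>\<close> in the ball around
          \<open>d\<close>; a radius below \<open>r / 2\<close> keeps that ball inside the one of
          radius \<open>r\<close> around \<open>\<Phi>\<close>.\<close>
        obtain q where q: "q \<in> \<rat>" "L20_dist Q \<Phi> d < q" "q < r / 2" using Rats_dense_in_real[OF d(2)] by auto
        have dL: "d \<in> L20 Q" "\<Phi> \<in> L20 Q" using E d G \<Phi> by auto
        have "mball d q \<subseteq> mball \<Phi> r"
        proof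
          fix \<Theta> assume "\<Theta> \<in> mball d q"
          thus "\<Theta> \<in> mball \<Phi> r" using triangle[of \<Phi> d \<Theta>] dL d q by (auto simp: mball_def)
        qed
        hence "(d, q) \<in> ?I" using d q r by auto
        moreover have "\<Phi> \<in> mball d q" using dL q commute by (auto simp: mball_def)
        ultimately show "\<Phi> \<in> (\<Union>(d, q)\<in>?I. mball d q)" by blast
      qed
    qed auto
    hence "X -` G \<inter> space N = X -` (\<Union>(d, q)\<in>?I. mball d q) \<inter> space N" by (rule arg_cong)
    also have "\<dots> = (\<Union>p\<in>?I. {x\<in>space N. X x \<in> (case p of (d, q) \<Rightarrow> mball d q)})" by blast
    also have "\<dots> \<in> sets N"
    proof (rule sets.countable_UN''[OF cI])
      fix p assume "p \<in> ?I"
      then obtain d q where p: "p = (d, q)" "d \<in> E" by auto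
      hence dL: "d \<in> L20 Q" using E by auto
      have "{x\<in>space N. X x \<in> mball d q} = {x\<in>space N. sqrt (\<Sum>k. (norm (d (f k) - X x (f k)))\<^sup>2) < q}"
      proof (rule Collect_cong, rule conj_cong[OF refl])
        fix x assume "x \<in> space N"
        hence "X x \<in> L20 Q" using X by blast
        thus "X x \<in> mball d q \<longleftrightarrow> sqrt (\<Sum>k. (norm (d (f k) - X x (f k)))\<^sup>2) < q"
          using dL by (simp add: L20_dist_eq)
      qed
      also have "\<dots> \<in> sets N" by measurable
      finally show "{x\<in>space N. X x \<in> (case p of (d, q) \<Rightarrow> mball d q)} \<in> sets N" by (simp add: p)
    qed
    finally show "X -` G \<inter> space N \<in> sets N" .
  qed
  moreover have "X \<in> space N \<rightarrow> L20 Q" if "X \<in> N \<rightarrow>\<^sub>M L20_borel Q"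
    using measurable_space[OF that] by (simp add: space_L20_borel)
  ultimately show ?thesis by blast
qed

end

section \<open>Mean square convergence\<close>

text \<open>With values in \<open>ennreal\<close> no integrability conditions arise; the triangle
  inequality takes the squared form with factor 2 (\<open>L2sq_add\<close>).\<close>

definition L2sq :: "'x measure \<Rightarrow> ('x \<Rightarrow> 'b::real_normed_vector) \<Rightarrow> ennreal" where
  "L2sq M X = (\<integral>\<^sup>+x. ennreal ((norm (X x))\<^sup>2) \<partial>M)"

lemma L2sq_mono:
  "(\<And>x. x \<in> space M \<Longrightarrow> norm (X x) \<le> norm (Y x)) \<Longrightarrow> L2sq M X \<le> L2sq M Y"
  unfolding L2sq_def by (intro nn_integral_mono ennreal_leI power_mono) auto

lemma L2sq_cong:
  "(\<And>x. x \<in> space M \<Longrightarrow> norm (X x) = norm (Y x)) \<Longrightarrow> L2sq M X = L2sq M Y"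
  by (intro antisym L2sq_mono) auto

lemma L2sq_add:
  fixes X Y :: "'x \<Rightarrow> 'b::{real_normed_vector,second_countable_topology}"
  assumes [measurable]: "X \<in> borel_measurable M" "Y \<in> borel_measurable M"
  shows "L2sq M (\<lambda>x. X x + Y x) \<le> 2 * L2sq M X + 2 * L2sq M Y"
proof -
  have "L2sq M (\<lambda>x. X x + Y x) \<le>
      (\<integral>\<^sup>+x. 2 * ennreal ((norm (X x))\<^sup>2) + 2 * ennreal ((norm (Y x))\<^sup>2) \<partial>M)"
    unfolding L2sq_def
    by (intro nn_integral_mono) (simp add: ennreal_mult'[symmetric] norm_add_sq_le
      flip: ennreal_plus ennreal_numeral)
  also have "\<dots> = 2 * L2sq M X + 2 * L2sq M Y"
    unfolding L2sq_def by (simp add: nn_integral_add nn_integral_cmult)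
  finally show ?thesis .
qed

lemma L2sq_uminus: "L2sq M (\<lambda>x. - X x) = L2sq M X"
  by (simp add: L2sq_def)

lemma L2sq_minus_commute: "L2sq M (\<lambda>x. X x - Y x) = L2sq M (\<lambda>x. Y x - X x)"
  by (simp add: L2sq_def norm_minus_commute)

lemma L2sq_triangle:
  fixes X Y Z :: "'x \<Rightarrow> 'b::{real_normed_vector,second_countable_topology}"
  assumes [measurable]: "X \<in> borel_measurable M" "Y \<in> borel_measurable M" "Z \<in> borel_measurable M"
  shows "L2sq M (\<lambda>x. X x - Z x) \<le> 2 * L2sq M (\<lambda>x. X x - Y x) + 2 * L2sq M (\<lambda>x. Y x - Z x)"
  using L2sq_add[of "\<lambda>x. X x - Y x" M "\<lambda>x. Y x - Z x"] by simp

lemma L2_limit_def':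
  "L2_limit M X Y \<longleftrightarrow> Y \<in> borel_measurable M \<and> L2sq M Y < \<infinity> \<and> (\<lambda>n. L2sq M (\<lambda>x. X n x - Y x)) \<longlonglongrightarrow> 0"
  unfolding L2_limit_def L2sq_def ..

lemma L2_limit_bound:
  assumes Y: "L2_limit M X Y" and [measurable]: "\<And>n. X n \<in> borel_measurable M"
    and B: "\<And>n. L2sq M (X n) \<le> B"
  shows "L2sq M Y \<le> 2 * B"
proof (rule LIMSEQ_le_const)
  have [measurable]: "Y \<in> borel_measurable M" using Y by (simp add: L2_limit_def')
  show "(\<lambda>n. 2 * B + 2 * L2sq M (\<lambda>x. X n x - Y x)) \<longlonglongrightarrow> 2 * B"
    using tendsto_add[OF tendsto_const ennreal_tendsto_cmult[of 2]] Y
    by (force simp: L2_limit_def')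
  have "L2sq M Y \<le> 2 * B + 2 * L2sq M (\<lambda>x. X n x - Y x)" for n
  proof -
    have "L2sq M (\<lambda>x. X n x + (Y x - X n x)) \<le> 2 * L2sq M (X n) + 2 * L2sq M (\<lambda>x. Y x - X n x)"
      by (rule L2sq_add) measurable
    also have "\<dots> \<le> 2 * B + 2 * L2sq M (\<lambda>x. X n x - Y x)"
      unfolding L2sq_minus_commute[of M Y] by (intro add_mono mult_left_mono B) auto
    finally show ?thesis by simp
  qed
  thus "\<exists>N. \<forall>n\<ge>N. L2sq M Y \<le> 2 * B + 2 * L2sq M (\<lambda>x. X n x - Y x)" by blast
qed

lemma L2_limit_diff:
  assumes X: "L2_limit M X Y" and X': "L2_limit M X' Y'"
    and m[measurable]: "\<And>n. X n \<in> borel_measurable M" "\<And>n. X' n \<in> borel_measurable M"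
  shows "L2_limit M (\<lambda>n x. X n x - X' n x) (\<lambda>x. Y x - Y' x)"
proof -
  have [measurable]: "Y \<in> borel_measurable M" "Y' \<in> borel_measurable M"
    using X X' by (auto simp: L2_limit_def')
  have "L2sq M (\<lambda>x. Y x - Y' x) \<le> 2 * L2sq M Y + 2 * L2sq M (\<lambda>x. - Y' x)"
    using L2sq_add[of Y M "\<lambda>x. - Y' x"] by simp
  also have "\<dots> < \<infinity>" using X X' by (simp add: L2_limit_def' L2sq_uminus ennreal_mult_less_top)
  finally have fin: "L2sq M (\<lambda>x. Y x - Y' x) < \<infinity>" .
  have "(\<lambda>n. L2sq M (\<lambda>x. (X n x - X' n x) - (Y x - Y' x))) \<longlonglongrightarrow> 0"
  proof (rule tendsto_sandwich[OF _ _ tendsto_const])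
    show "\<forall>\<^sub>F n in sequentially. L2sq M (\<lambda>x. (X n x - X' n x) - (Y x - Y' x)) \<le>
        2 * L2sq M (\<lambda>x. X n x - Y x) + 2 * L2sq M (\<lambda>x. X' n x - Y' x)"
    proof (intro always_eventually allI)
      fix n
      have "L2sq M (\<lambda>x. (X n x - Y x) + (- (X' n x - Y' x))) \<le>
        2 * L2sq M (\<lambda>x. X n x - Y x) + 2 * L2sq M (\<lambda>x. - (X' n x - Y' x))"
        by (rule L2sq_add) measurable
      thus "L2sq M (\<lambda>x. (X n x - X' n x) - (Y x - Y' x)) \<le>
        2 * L2sq M (\<lambda>x. X n x - Y x) + 2 * L2sq M (\<lambda>x. X' n x - Y' x)"
        unfolding L2sq_uminus by (simp add: algebra_simps)
    qed
    have "(\<lambda>n. 2 * L2sq M (\<lambda>x. X n x - Y x) + 2 * L2sq M (\<lambda>x. X' n x - Y' x)) \<longlonglongrightarrow> 2 * 0 + 2 * 0"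
      using X X' by (intro tendsto_add ennreal_tendsto_cmult) (auto simp: L2_limit_def')
    thus "(\<lambda>n. 2 * L2sq M (\<lambda>x. X n x - Y x) + 2 * L2sq M (\<lambda>x. X' n x - Y' x)) \<longlonglongrightarrow> 0" by simp
  qed simp
  with fin show ?thesis by (simp add: L2_limit_def')
qed

text \<open>The sum of the squared errors has a finite integral, so it is finite almost everywhere
  and its terms tend to 0.\<close>

lemma AE_LIMSEQ_of_summable_L2sq:
  fixes X :: "nat \<Rightarrow> 'x \<Rightarrow> 'b::{real_normed_vector,second_countable_topology}"
  assumes [measurable]: "\<And>n. X n \<in> borel_measurable M" "Y \<in> borel_measurable M"
    and fin: "(\<Sum>n. L2sq M (\<lambda>x. X n x - Y x)) < \<infinity>"
  shows "AE x in M. (\<lambda>n. X n x) \<longlonglongrightarrow> Y x"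
proof -
  have "(\<integral>\<^sup>+x. (\<Sum>n. ennreal ((norm (X n x - Y x))\<^sup>2)) \<partial>M) = (\<Sum>n. L2sq M (\<lambda>x. X n x - Y x))"
    unfolding L2sq_def by (rule nn_integral_suminf) measurable
  hence "AE x in M. (\<Sum>n. ennreal ((norm (X n x - Y x))\<^sup>2)) \<noteq> \<infinity>"
    using fin by (intro nn_integral_noteq_infinite) auto
  thus ?thesis
  proof eventually_elim
    fix x assume "(\<Sum>n. ennreal ((norm (X n x - Y x))\<^sup>2)) \<noteq> \<infinity>"
    hence "summable (\<lambda>n. (norm (X n x - Y x))\<^sup>2)" by (intro summable_suminf_not_top) auto
    hence "(\<lambda>n. (norm (X n x - Y x))\<^sup>2) \<longlonglongrightarrow> 0" by (rule summable_LIMSEQ_zero)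
    hence "(\<lambda>n. sqrt ((norm (X n x - Y x))\<^sup>2)) \<longlonglongrightarrow> sqrt 0" by (rule tendsto_real_sqrt)
    thus "(\<lambda>n. X n x) \<longlonglongrightarrow> Y x" by (simp add: LIM_zero_iff tendsto_norm_zero_iff)
  qed
qed

text \<open>Completeness of L2 with control of measurability: the limit is measurable for the
  subalgebra \<open>G\<close> itself, not merely almost everywhere equal to such a function.
  Adaptedness of the stochastic integral comes from here.\<close>

lemma L2_complete:
  fixes X :: "nat \<Rightarrow> 'x \<Rightarrow> 'b::{banach,second_countable_topology}"
  assumes G: "subalgebra M G" and XG[measurable]: "\<And>n. X n \<in> borel_measurable G"
    and fin: "\<And>n. L2sq M (X n) < \<infinity>"
    and cauchy: "\<And>\<epsilon>::real. 0 < \<epsilon> \<Longrightarrow> \<exists>N. \<forall>m\<ge>N. \<forall>n\<ge>N. L2sq M (\<lambda>x. X m x - X n x) \<le> ennreal \<epsilon>"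
  obtains Y where "Y \<in> borel_measurable G" "L2_limit M X Y"
proof -
  have mG: "g \<in> borel_measurable G \<Longrightarrow> g \<in> borel_measurable M" for g :: "'x \<Rightarrow> 'b"
    using measurable_from_subalg[OF G] .
  have [measurable]: "X n \<in> borel_measurable M" for n by (rule mG[OF XG])
  \<comment> \<open>The rate \<open>(1/16)^k\<close> leaves room for the weight \<open>4^k\<close>
    below: the weighted sum still converges, and weighted terms below 1 mean
    \<open>norm (D k x) \<le> (1/2)^k\<close>.\<close>
  have "\<forall>k. \<exists>N. \<forall>m\<ge>N. \<forall>n\<ge>N. L2sq M (\<lambda>x. X m x - X n x) \<le> ennreal ((1/16)^k)"
    by (intro allI cauchy) simp
  then obtain N where "\<forall>k. \<forall>m\<ge>N k. \<forall>n\<ge>N k. L2sq M (\<lambda>x. X m x - X n x) \<le> ennreal ((1/16)^k)"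
    unfolding choice_iff by blast
  hence N: "m \<ge> N k \<Longrightarrow> n \<ge> N k \<Longrightarrow> L2sq M (\<lambda>x. X m x - X n x) \<le> ennreal ((1/16)^k)" for k m n
    by blast
  \<comment> \<open>Partial sums of \<open>N\<close> are nondecreasing and dominate
    \<open>N\<close>, so the Cauchy bounds hold along the whole subsequence.\<close>
  define r where "r k = (\<Sum>i\<le>k. N i)" for k
  have r: "r k \<ge> N k" "r (Suc k) \<ge> N k" "r k \<le> r (Suc k)" for k
    using member_le_sum[of k "{..k}" N] by (auto simp: r_def)
  define D where "D k x = X (r (Suc k)) x - X (r k) x" for k x
  have [measurable]: "D k \<in> borel_measurable M" for k unfolding D_def by measurable
  have D: "L2sq M (D k) \<le> ennreal ((1/16)^k)" for k
    unfolding D_def by (rule N) (use r in auto)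
  have "(\<integral>\<^sup>+x. (\<Sum>k. ennreal (4^k * (norm (D k x))\<^sup>2)) \<partial>M) = (\<Sum>k. \<integral>\<^sup>+x. ennreal (4^k * (norm (D k x))\<^sup>2) \<partial>M)"
    by (rule nn_integral_suminf) measurable
  also have "\<dots> = (\<Sum>k. ennreal (4^k) * L2sq M (D k))"
  proof (rule arg_cong[where f=suminf], rule ext)
    fix k
    have "(\<integral>\<^sup>+x. ennreal (4^k * (norm (D k x))\<^sup>2) \<partial>M) = (\<integral>\<^sup>+x. ennreal (4^k) * ennreal ((norm (D k x))\<^sup>2) \<partial>M)"
      by (rule nn_integral_cong, rule ennreal_mult) simp_all
    also have "\<dots> = ennreal (4^k) * L2sq M (D k)"
      unfolding L2sq_def by (rule nn_integral_cmult) measurable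
    finally show "(\<integral>\<^sup>+x. ennreal (4^k * (norm (D k x))\<^sup>2) \<partial>M) = \<dots>" .
  qed
  also have "\<dots> \<le> (\<Sum>k. ennreal (4^k) * ennreal ((1/16)^k))"
    by (intro suminf_le mult_left_mono D zero_le summableI)
  also have "\<dots> = (\<Sum>k. ennreal ((1/4)^k))"
  proof (rule arg_cong[where f=suminf], rule ext)
    fix k
    have "(4::real)^k * (1/16)^k = (4 * (1/16))^k" by (rule power_mult_distrib[symmetric])
    thus "ennreal (4^k) * ennreal ((1/16)^k) = ennreal ((1/4)^k)"
      by (subst ennreal_mult[symmetric]) simp_all
  qed
  also have "\<dots> < \<infinity>"
    unfolding infinity_ennreal_def less_top[symmetric]
    by (rule ennreal_suminf_neq_top) (simp_all add: summable_geometric)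
  finally have "AE x in M. (\<Sum>k. ennreal (4^k * (norm (D k x))\<^sup>2)) \<noteq> \<infinity>"
    by (intro nn_integral_noteq_infinite) auto
  hence conv: "AE x in M. convergent (\<lambda>k. X (r k) x)"
  proof eventually_elim
    fix x assume "(\<Sum>k. ennreal (4^k * (norm (D k x))\<^sup>2)) \<noteq> \<infinity>"
    hence "summable (\<lambda>k. 4^k * (norm (D k x))\<^sup>2)" by (intro summable_suminf_not_top) auto
    hence "(\<lambda>k. 4^k * (norm (D k x))\<^sup>2) \<longlonglongrightarrow> 0" by (rule summable_LIMSEQ_zero)
    hence "eventually (\<lambda>k. 4^k * (norm (D k x))\<^sup>2 < 1) sequentially" by (rule order_tendstoD) simp
    hence ev: "eventually (\<lambda>k. norm (D k x) \<le> (1/2)^k) sequentially"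
    proof eventually_elim
      case (elim k)
      have "(4::real)^k = (2^k)\<^sup>2" by (simp add: power2_eq_square flip: power_mult_distrib)
      with elim have "(2^k * norm (D k x))\<^sup>2 \<le> 1\<^sup>2" unfolding power_mult_distrib by simp
      hence "2^k * norm (D k x) \<le> 1" by (rule power2_le_imp_le) simp
      thus ?case by (simp add: field_simps)
    qed
    have "summable (\<lambda>k. D k x)"
      by (rule summable_comparison_test_ev[OF ev]) (simp add: summable_geometric)
    hence "convergent (\<lambda>n. X (r 0) x + (\<Sum>k<n. D k x))"
      by (intro convergent_add convergent_const) (simp add: summable_iff_convergent)
    moreover have "X (r 0) x + (\<Sum>k<n. D k x) = X (r n) x" for n
      using sum_lessThan_telescope[of "\<lambda>k. X (r k) x" n] by (simp add: D_def)
    ultimately show "convergent (\<lambda>k. X (r k) x)" by simp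
  qed
  \<comment> \<open>\<open>lim\<close> takes one fixed unspecified value wherever the sequence
    diverges; this keeps \<open>Y\<close> measurable for \<open>G\<close>.\<close>
  define Y where "Y x = lim (\<lambda>k. X (r k) x)" for x
  have YG: "Y \<in> borel_measurable G" unfolding Y_def by measurable
  have [measurable]: "Y \<in> borel_measurable M" by (rule mG[OF YG])
  have lim: "AE x in M. (\<lambda>k. X (r k) x) \<longlonglongrightarrow> Y x"
    using conv by eventually_elim (simp add: Y_def convergent_LIMSEQ_iff)
  have r_mono: "k \<le> l \<Longrightarrow> r k \<le> r l" for k l by (auto simp: r_def intro!: sum_mono2)
  have le: "L2sq M (\<lambda>x. X m x - Y x) \<le> ennreal ((1/16)^k)" if m: "m \<ge> N k" for k m
  proof -
    \<comment> \<open>Fatou along the subsequence turns the Cauchy bound into a bound on the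
      distance to the limit.\<close>
    have "L2sq M (\<lambda>x. X m x - Y x) \<le> (\<integral>\<^sup>+x. liminf (\<lambda>l. ennreal ((norm (X m x - X (r l) x))\<^sup>2)) \<partial>M)"
      unfolding L2sq_def
    proof (intro nn_integral_mono_AE)
      show "AE x in M. ennreal ((norm (X m x - Y x))\<^sup>2) \<le> liminf (\<lambda>l. ennreal ((norm (X m x - X (r l) x))\<^sup>2))"
        using lim
      proof eventually_elim
        case (elim x)
        hence "(\<lambda>l. ennreal ((norm (X m x - X (r l) x))\<^sup>2)) \<longlonglongrightarrow> ennreal ((norm (X m x - Y x))\<^sup>2)"
          by (intro tendsto_ennrealI tendsto_intros)
        from lim_imp_Liminf[OF _ this] show ?case by simp
      qed
    qed
    also have "\<dots> \<le> liminf (\<lambda>l. L2sq M (\<lambda>x. X m x - X (r l) x))"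
      unfolding L2sq_def by (rule nn_integral_liminf) measurable
    also have "\<dots> \<le> ennreal ((1/16)^k)"
    proof (rule Liminf_le)
      show "\<forall>\<^sub>F l in sequentially. L2sq M (\<lambda>x. X m x - X (r l) x) \<le> ennreal ((1/16)^k)"
        using eventually_ge_at_top[of k]
      proof eventually_elim
        case (elim l)
        show ?case by (rule N[OF m]) (use r(1)[of k] r_mono[OF elim] in simp)
      qed
    qed simp
    finally show ?thesis .
  qed
  have "L2sq M (\<lambda>x. X (N 0) x - Y x) \<le> ennreal 1" using le[of 0 "N 0"] by simp
  also have "\<dots> < \<infinity>" by simp
  finally have fin0: "L2sq M (\<lambda>x. X (N 0) x - Y x) < \<infinity>" .
  have "L2sq M (\<lambda>x. X (N 0) x + (Y x - X (N 0) x)) \<le> 2 * L2sq M (X (N 0)) + 2 * L2sq M (\<lambda>x. Y x - X (N 0) x)"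
    by (rule L2sq_add) measurable
  also have "\<dots> < \<infinity>" using fin[of "N 0"] fin0 unfolding L2sq_minus_commute[of M Y]
    by (simp add: ennreal_mult_less_top)
  finally have finY: "L2sq M Y < \<infinity>" by simp
  have "(\<lambda>n. L2sq M (\<lambda>x. X n x - Y x)) \<longlonglongrightarrow> 0"
  proof (rule order_tendstoI)
    fix a :: ennreal assume a: "0 < a"
    have "(\<lambda>k. ennreal ((1/16)^k)) \<longlonglongrightarrow> ennreal 0"
      by (intro tendsto_ennrealI LIMSEQ_power_zero) simp
    hence "eventually (\<lambda>k. ennreal ((1/16)^k) < a) sequentially" using a by (intro order_tendstoD) auto
    then obtain k where k: "ennreal ((1/16)^k) < a" by (auto simp: eventually_sequentially)
    show "\<forall>\<^sub>F n in sequentially. L2sq M (\<lambda>x. X n x - Y x) < a"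
      using eventually_ge_at_top[of "N k"] by eventually_elim (use le[of k] k in \<open>blast intro: le_less_trans\<close>)
  qed simp
  with finY YG show thesis by (intro that[of Y]) (simp_all add: L2_limit_def')
qed

text \<open>Banach-Steinhaus by Baire: the closed sets \<open>E n\<close> cover the complete space,
  so one of them contains a ball, on which all operators are bounded at once.\<close>

lemma uniform_boundedness:
  fixes S :: "'i \<Rightarrow> 'a::banach \<Rightarrow> 'b::real_normed_vector"
  assumes bl: "\<And>i. i \<in> I \<Longrightarrow> bounded_linear (S i)"
    and bd: "\<And>x. \<exists>B. \<forall>i\<in>I. norm (S i x) \<le> B"
  obtains C where "0 \<le> C" "\<And>i x. i \<in> I \<Longrightarrow> norm (S i x) \<le> C * norm x"
proof -
  define E where "E n = {x. \<forall>i\<in>I. norm (S i x) \<le> real n}" for n :: nat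
  have cl: "closed (E n)" for n
  proof -
    have "E n = (\<Inter>i\<in>I. {x. norm (S i x) \<le> real n})" by (auto simp: E_def)
    also have "closed \<dots>"
      by (intro closed_INT ballI closed_Collect_le continuous_intros linear_continuous_on bl)
    finally show ?thesis .
  qed
  have "\<exists>n. interior (E n) \<noteq> {}"
  proof (rule ccontr)
    assume "\<nexists>n. interior (E n) \<noteq> {}"
    hence "euclidean interior_of \<Union>(range E) = {}"
      using cl by (intro Baire_category_alt disjI1 completely_metrizable_space_euclidean)
        (auto simp: closed_closedin[symmetric])
    moreover have "\<Union>(range E) = UNIV"
    proof -
      have "x \<in> \<Union>(range E)" for x
      proof -
        obtain B where "\<forall>i\<in>I. norm (S i x) \<le> B" using bd by blast
        moreover obtain n where "B \<le> real n" using real_arch_simple by blast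
        ultimately have "x \<in> E n" by (force simp: E_def)
        thus ?thesis by blast
      qed
      thus ?thesis by blast
    qed
    ultimately show False by simp
  qed
  then obtain n x0 where "x0 \<in> interior (E n)" by blast
  then obtain r where r: "0 < r" "cball x0 r \<subseteq> E n"
    by (meson interior_subset mem_interior_cball order_trans)
  have "norm (S i x) \<le> (2 * real n / r) * norm x" if i: "i \<in> I" for i x
  proof (cases "x = 0")
    case True
    thus ?thesis using bounded_linear.linear[OF bl[OF i]] by (simp add: linear_0)
  next
    case False
    interpret bounded_linear "S i" by (rule bl[OF i])
    \<comment> \<open>\<open>x\<close> rescaled to length \<open>r\<close>: the difference of two
      points of the ball, which explains the factor 2 in the bound.\<close>
    let ?y = "(r / norm x) *\<^sub>R x"
    have "x0 \<in> cball x0 r" "x0 + ?y \<in> cball x0 r" using r False by (auto simp: dist_norm)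
    hence "x0 \<in> E n" "x0 + ?y \<in> E n" using r(2) by blast+
    hence "norm (S i (x0 + ?y)) \<le> real n" "norm (S i x0) \<le> real n" using i by (auto simp: E_def)
    hence "norm (S i (x0 + ?y) - S i x0) \<le> 2 * real n"
      using norm_triangle_ineq4[of "S i (x0 + ?y)" "S i x0"] by linarith
    hence "(r / norm x) * norm (S i x) \<le> 2 * real n" using r by (simp add: add scaleR)
    thus ?thesis using r False by (simp add: field_simps)
  qed
  with r show thesis by (intro that[of "2 * real n / r"]) auto
qed

section \<open>Increments of the Wiener process\<close>

text \<open>Variance 0 is the point mass at 0 and occurs for vanishing eigenvalues; it is treated
  apart from the normal density.\<close>

lemma centered_gaussian_moments:
  assumes "0 \<le> v"
  shows "integrable (centered_gaussian v) (\<lambda>x. x)" (is ?i1)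
    and "integrable (centered_gaussian v) (\<lambda>x. x\<^sup>2)" (is ?i2)
    and "(\<integral>x. x \<partial>centered_gaussian v) = 0" (is ?e1)
    and "(\<integral>x. x\<^sup>2 \<partial>centered_gaussian v) = v" (is ?e2)
proof -
  have m: "(\<lambda>x::real. x) \<in> borel_measurable borel" "(\<lambda>x::real. x\<^sup>2) \<in> borel_measurable borel"
    by measurable
  have "?i1 \<and> ?i2 \<and> ?e1 \<and> ?e2"
  proof (cases "v = 0")
    case True
    have i: "integrable (return borel 0) g" if [measurable]: "g \<in> borel_measurable borel" for g :: "real \<Rightarrow> real"
      by (rule integrableI_bounded) (auto simp: nn_integral_return)
    have e: "(\<integral>x. g x \<partial>return borel 0) = g 0" if "g \<in> borel_measurable borel" for g :: "real \<Rightarrow> real"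
      using that by (intro integral_return) simp_all
    have "centered_gaussian v = return borel 0" using True by (simp add: centered_gaussian_def)
    thus ?thesis using True i[OF m(1)] i[OF m(2)] e[OF m(1)] e[OF m(2)] by simp
  next
    case False
    hence v: "0 < v" using assms by simp
    let ?d = "normal_density 0 (sqrt v)"
    have 1: "has_bochner_integral lborel (\<lambda>x. ?d x * x) 0"
      using normal_moment_odd[where \<mu>=0 and \<sigma>="sqrt v" and k=0] v by simp
    \<comment> \<open>The general formula for the moment of order \<open>2 * k\<close>, evaluated at
      \<open>k = 1\<close>.\<close>
    have "fact (2 * 1) / ((2 / (sqrt v)\<^sup>2)^1 * fact 1) = v"
      using v by (simp add: fact_2)
    hence 2: "has_bochner_integral lborel (\<lambda>x. ?d x * x\<^sup>2) v"
      using normal_moment_even[where \<mu>=0 and \<sigma>="sqrt v" and k=1] v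
      by (simp only: mult_1_right diff_0_right real_sqrt_gt_0_iff)
    have eq: "centered_gaussian v = density lborel ?d" using False by (simp add: centered_gaussian_def)
    have i: "integrable (density lborel ?d) g \<longleftrightarrow> integrable lborel (\<lambda>x. ?d x * g x)"
        "(\<integral>x. g x \<partial>density lborel ?d) = (\<integral>x. ?d x * g x \<partial>lborel)"
      if "g \<in> borel_measurable borel" for g :: "real \<Rightarrow> real"
      using that by (simp_all add: integrable_density[where 'b=real] integral_density[where 'b=real])
    show ?thesis
      unfolding eq i[OF m(1)] i[OF m(2)] using 1 2 by (auto simp: has_bochner_integral_iff)
  qed
  thus ?i1 ?i2 ?e1 ?e2 by auto
qed

text \<open>The sigma-algebras generated by \<open>X\<close> and \<open>Y\<close> are contained in
  \<open>G\<close> and \<open>H\<close>, so independence passes to the variables and expectations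
  multiply.\<close>

lemma (in prob_space) indep_set_lebesgue_integral:
  fixes X Y :: "'a \<Rightarrow> real"
  assumes ind: "indep_set (sets G) (sets H)" and sp: "space G = space M" "space H = space M"
    and X: "X \<in> borel_measurable G" "integrable M X" and Y: "Y \<in> borel_measurable H" "integrable M Y"
  shows "integrable M (\<lambda>\<omega>. X \<omega> * Y \<omega>)" (is ?i)
    and "expectation (\<lambda>\<omega>. X \<omega> * Y \<omega>) = expectation X * expectation Y" (is ?e)
proof -
  have *: "sigma_sets (space M) {Z -` A \<inter> space M |A. A \<in> sets borel} \<subseteq> sets N"
    if "Z \<in> borel_measurable N" "space N = space M" for Z :: "'a \<Rightarrow> real" and N
    using that(2) measurable_sets[OF that(1)] by (intro sets.sigma_sets_subset') (auto simp flip: that(2))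
  have "indep_var borel X borel Y"
    unfolding indep_var_eq
  proof
    show "random_variable borel X \<and> random_variable borel Y" using X Y by auto
    show "indep_set (sigma_sets (space M) {X -` A \<inter> space M |A. A \<in> sets borel})
        (sigma_sets (space M) {Y -` A \<inter> space M |A. A \<in> sets borel})"
      using ind *[OF X(1) sp(1)] *[OF Y(1) sp(2)] unfolding indep_sets2_eq by (meson subset_eq)
  qed
  thus ?i ?e
    using indep_var_integrable indep_var_lebesgue_integral X Y by auto
qed

locale wiener_setting = prob_space M + diagonal_operator Q K e lam
  for M :: "'w measure" and Q :: "'u::{real_inner,banach,second_countable_topology} \<Rightarrow> 'u"
    and K e lam +
  fixes F :: "real \<Rightarrow> 'w measure" and \<beta> :: "nat \<Rightarrow> real \<Rightarrow> 'w \<Rightarrow> real"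
  assumes filtration: "normal_filtration M F"
    and wiener: "cylindrical_wiener_process M F Q K e lam \<beta>"
begin

lemma subalg: "0 \<le> t \<Longrightarrow> subalgebra M (F t)"
  using filtration by (simp add: normal_filtration_def)

lemma space_F: "0 \<le> t \<Longrightarrow> space (F t) = space M"
  using subalg by (simp add: subalgebra_def)

lemma sets_F_M: "0 \<le> t \<Longrightarrow> sets (F t) \<subseteq> sets M"
  using subalg by (simp add: subalgebra_def)

lemma sets_F_mono: "0 \<le> s \<Longrightarrow> s \<le> t \<Longrightarrow> sets (F s) \<subseteq> sets (F t)"
  using filtration unfolding normal_filtration_def by blast

lemma measurable_F_mono: "0 \<le> s \<Longrightarrow> s \<le> t \<Longrightarrow> X \<in> F s \<rightarrow>\<^sub>M N \<Longrightarrow> X \<in> F t \<rightarrow>\<^sub>M N"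
  by (rule measurable_from_subalg[of "F t" "F s"]) (auto simp: subalgebra_def space_F sets_F_mono)

lemma measurable_F_M: "0 \<le> t \<Longrightarrow> X \<in> F t \<rightarrow>\<^sub>M N \<Longrightarrow> X \<in> M \<rightarrow>\<^sub>M N"
  using measurable_from_subalg[OF subalg] .

section \<open>Moments and covariances of the coordinate increments\<close>

definition incr :: "nat \<Rightarrow> real \<Rightarrow> real \<Rightarrow> 'w \<Rightarrow> real" where
  "incr k s u \<omega> = \<beta> k u \<omega> - \<beta> k s \<omega>"

lemma incr_measurable_F:
  assumes "k \<in> K" "0 \<le> s" "s \<le> u"
  shows "incr k s u \<in> borel_measurable (F u)"
proof -
  have "\<beta> k u \<in> borel_measurable (F u)" "\<beta> k s \<in> borel_measurable (F s)"
    using wiener assms by (auto simp: cylindrical_wiener_process_def)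
  hence [measurable]: "\<beta> k u \<in> borel_measurable (F u)" "\<beta> k s \<in> borel_measurable (F u)"
    using measurable_F_mono assms by auto
  show ?thesis unfolding incr_def[abs_def] by measurable
qed

lemma incr_measurable:
  assumes "k \<in> K" "0 \<le> s" "s \<le> u"
  shows "incr k s u \<in> borel_measurable M"
  using measurable_F_M[OF _ incr_measurable_F] assms by auto

lemma incr_moments:
  assumes k: "k \<in> K" and su: "0 \<le> s" "s \<le> u"
  shows "integrable M (incr k s u)" (is ?i1)
    and "integrable M (\<lambda>\<omega>. (incr k s u \<omega>)\<^sup>2)" (is ?i2)
    and "expectation (incr k s u) = 0" (is ?e1)
    and "expectation (\<lambda>\<omega>. (incr k s u \<omega>)\<^sup>2) = lam k * (u - s)" (is ?e2)
proof -
  note m[measurable] = incr_measurable[OF k su]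
  have "?i1 \<and> ?i2 \<and> ?e1 \<and> ?e2"
  proof (cases "s = u")
    case True
    thus ?thesis by (simp add: incr_def[abs_def])
  next
    case False
    hence d: "distr M borel (incr k s u) = centered_gaussian (lam k * (u - s))"
      using wiener k su unfolding incr_def[abs_def]
      by (auto simp: cylindrical_wiener_process_def real_wiener_process_def)
    have v: "0 \<le> lam k * (u - s)" using lam_nonneg[OF k] su by simp
    have i: "integrable (centered_gaussian (lam k * (u - s))) g \<longleftrightarrow> integrable M (\<lambda>\<omega>. g (incr k s u \<omega>))"
      "(\<integral>x. g x \<partial>centered_gaussian (lam k * (u - s))) = expectation (\<lambda>\<omega>. g (incr k s u \<omega>))"
      if "g \<in> borel_measurable borel" for g :: "real \<Rightarrow> real"
      unfolding d[symmetric] by (rule integrable_distr_eq[OF m that], rule integral_distr[OF m that])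
    have b: "(\<lambda>x::real. x) \<in> borel_measurable borel" "(\<lambda>x::real. x\<^sup>2) \<in> borel_measurable borel"
      by measurable
    note c = centered_gaussian_moments[OF v]
    show ?thesis
      by (intro conjI c(1)[unfolded i(1)[OF b(1)]] c(2)[unfolded i(1)[OF b(2)]]
        c(3)[unfolded i(2)[OF b(1)]] c(4)[unfolded i(2)[OF b(2)]])
  qed
  thus ?i1 ?i2 ?e1 ?e2 by auto
qed

lemma incr_prod_integrable:
  assumes "k \<in> K" "l \<in> K" "0 \<le> s" "s \<le> u" "0 \<le> s'" "s' \<le> u'"
  shows "integrable M (\<lambda>\<omega>. incr k s u \<omega> * incr l s' u' \<omega>)"
proof (rule Bochner_Integration.integrable_bound)
  have [measurable]: "incr k s u \<in> borel_measurable M" "incr l s' u' \<in> borel_measurable M"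
    using assms by (auto intro: incr_measurable)
  show "integrable M (\<lambda>\<omega>. (incr k s u \<omega>)\<^sup>2 + (incr l s' u' \<omega>)\<^sup>2)"
    using assms by (intro Bochner_Integration.integrable_add incr_moments)
  show "(\<lambda>\<omega>. incr k s u \<omega> * incr l s' u' \<omega>) \<in> borel_measurable M" by measurable
  have "\<bar>x * y\<bar> \<le> \<bar>x\<^sup>2 + y\<^sup>2\<bar>" for x y :: real
  proof -
    have "0 \<le> \<bar>x\<bar> * \<bar>y\<bar>" by simp
    moreover have "2 * (\<bar>x\<bar> * \<bar>y\<bar>) \<le> x\<^sup>2 + y\<^sup>2"
      using sum_squares_bound[of "\<bar>x\<bar>" "\<bar>y\<bar>"] by (simp add: mult.assoc)
    ultimately have "\<bar>x\<bar> * \<bar>y\<bar> \<le> x\<^sup>2 + y\<^sup>2" by linarith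
    thus ?thesis by (simp add: abs_mult)
  qed
  thus "AE \<omega> in M. norm (incr k s u \<omega> * incr l s' u' \<omega>) \<le> norm ((incr k s u \<omega>)\<^sup>2 + (incr l s' u' \<omega>)\<^sup>2)"
    by simp
qed

text \<open>Each increment is a function of a whole coordinate path, and the paths for different
  indices are independent; the expectation factors into two zero means.\<close>

lemma incr_orthogonal:
  assumes kl: "k \<in> K" "l \<in> K" "k \<noteq> l" and su: "0 \<le> s" "s \<le> u"
  shows "expectation (\<lambda>\<omega>. incr k s u \<omega> * incr l s u \<omega>) = 0"
proof -
  have "indep_vars (\<lambda>_. PiM {0..} (\<lambda>_. borel)) (\<lambda>k \<omega>. \<lambda>t\<in>{0..}. \<beta> k t \<omega>) K"
    using wiener by (simp add: cylindrical_wiener_process_def)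
  hence "indep_vars (\<lambda>_. borel) (\<lambda>k \<omega>. (\<lambda>p. p u - p s) (\<lambda>t\<in>{0..}. \<beta> k t \<omega>)) K"
    by (rule indep_vars_compose2)
      (use su in \<open>auto intro!: borel_measurable_diff measurable_component_singleton\<close>)
  hence "indep_vars (\<lambda>_. borel) (\<lambda>k. incr k s u) K"
    using su by (simp add: incr_def[abs_def])
  hence "indep_vars (\<lambda>_. borel) (\<lambda>k. incr k s u) {k, l}"
    by (rule indep_vars_subset) (use kl in auto)
  hence "expectation (\<lambda>\<omega>. \<Prod>i\<in>{k, l}. incr i s u \<omega>) = (\<Prod>i\<in>{k, l}. expectation (incr i s u))"
    by (rule indep_vars_lebesgue_integral[rotated]) (use kl su in \<open>auto intro: incr_moments\<close>)
  thus ?thesis using kl su by (simp add: incr_moments(3))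
qed

text \<open>The whole family of increments is independent of \<open>F s\<close>, so \<open>h\<close>
  may involve several coordinates at once: a single one gives the martingale property, a product of
  two gives the bracket.\<close>

lemma incr_independent:
  assumes su: "0 \<le> s" "s < u" and X: "X \<in> borel_measurable (F s)" "integrable M X"
    and h: "h \<in> borel_measurable (PiM K (\<lambda>_. borel))"
    and Y: "integrable M (\<lambda>\<omega>. h (\<lambda>k\<in>K. incr k s u \<omega>) :: real)"
  shows "integrable M (\<lambda>\<omega>. X \<omega> * h (\<lambda>k\<in>K. incr k s u \<omega>))" (is ?i)
    and "expectation (\<lambda>\<omega>. X \<omega> * h (\<lambda>k\<in>K. incr k s u \<omega>)) = expectation X * expectation (\<lambda>\<omega>. h (\<lambda>k\<in>K. incr k s u \<omega>))" (is ?e)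
proof -
  let ?V = "vimage_algebra (space M) (\<lambda>\<omega>. \<lambda>k\<in>K. incr k s u \<omega>) (PiM K (\<lambda>_. borel))"
  have ind: "indep_set (sets (F s)) (sets ?V)"
    using wiener su unfolding cylindrical_wiener_process_def incr_def by blast
  have "(\<lambda>\<omega>. \<lambda>k\<in>K. incr k s u \<omega>) \<in> ?V \<rightarrow>\<^sub>M PiM K (\<lambda>_. borel)"
    by (rule measurable_vimage_algebra1) (auto simp: space_PiM)
  hence "(\<lambda>\<omega>. h (\<lambda>k\<in>K. incr k s u \<omega>)) \<in> borel_measurable ?V"
    using h by (rule measurable_compose)
  from indep_set_lebesgue_integral[OF ind _ _ X this Y] space_F[OF su(1)]
  show ?i ?e
    by simp_all
qed

lemma incr_martingale:
  assumes k: "k \<in> K" and su: "0 \<le> s" "s \<le> u" and X: "X \<in> borel_measurable (F s)" "integrable M X"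
  shows "integrable M (\<lambda>\<omega>. X \<omega> * incr k s u \<omega>)" (is ?i)
    and "expectation (\<lambda>\<omega>. X \<omega> * incr k s u \<omega>) = 0" (is ?e)
proof -
  have "?i \<and> ?e"
  proof (cases "s = u")
    case True thus ?thesis by (simp add: incr_def)
  next
    case False
    hence "s < u" using su by simp
    from incr_independent[OF su(1) this X, of "\<lambda>p. p k"] k su incr_moments[OF k su]
    show ?thesis by (simp add: measurable_component_singleton)
  qed
  thus ?i ?e by auto
qed

lemma incr_bracket:
  assumes kl: "k \<in> K" "l \<in> K" and su: "0 \<le> s" "s \<le> u" and X: "X \<in> borel_measurable (F s)" "integrable M X"
  shows "integrable M (\<lambda>\<omega>. X \<omega> * (incr k s u \<omega> * incr l s u \<omega>))" (is ?i)
    and "expectation (\<lambda>\<omega>. X \<omega> * (incr k s u \<omega> * incr l s u \<omega>)) =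
      (if k = l then lam k * (u - s) * expectation X else 0)" (is ?e)
proof -
  have "?i \<and> ?e"
  proof (cases "s = u")
    case True thus ?thesis by (simp add: incr_def)
  next
    case False
    hence su': "s < u" using su by simp
    have h: "(\<lambda>p. p k * p l) \<in> borel_measurable (PiM K (\<lambda>_. borel :: real measure))"
      using kl by (intro borel_measurable_times measurable_component_singleton)
    have "expectation (\<lambda>\<omega>. incr k s u \<omega> * incr l s u \<omega>) = (if k = l then lam k * (u - s) else 0)"
      using incr_orthogonal[OF kl _ su] incr_moments(4)[OF kl(1) su] by (auto simp: power2_eq_square)
    with incr_independent[OF su(1) su' X h] kl su incr_prod_integrable[of k l s u s u]
    show ?thesis by (simp add: mult.commute)
  qed
  thus ?i ?e by auto
qed

text \<open>The length of the intersection of \<open>{s<..u}\<close> and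
  \<open>{s'<..u'}\<close>.\<close>

definition overlap :: "real \<Rightarrow> real \<Rightarrow> real \<Rightarrow> real \<Rightarrow> real" where
  "overlap s u s' u' = max 0 (min u u' - max s s')"

lemma overlap_commute: "overlap s u s' u' = overlap s' u' s u"
  by (simp add: overlap_def max.commute min.commute)

lemma overlap_integral:
  assumes "s \<le> u" "s' \<le> u'"
  shows "has_bochner_integral lborel (\<lambda>\<tau>. indicat_real {s<..u} \<tau> * indicat_real {s'<..u'} \<tau>) (overlap s u s' u')"
proof -
  have "(\<lambda>\<tau>. indicat_real {s<..u} \<tau> * indicat_real {s'<..u'} \<tau>) = indicat_real {max s s'<..min u u'}"
    by (auto simp: fun_eq_iff indicator_def)
  moreover have "emeasure lborel {max s s'<..min u u'} = ennreal (overlap s u s' u')"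
  proof (cases "max s s' \<le> min u u'")
    case True
    thus ?thesis by (simp only: emeasure_lborel_Ioc overlap_def) simp
  next
    case False
    hence "{max s s'<..min u u'} = {}" "overlap s u s' u' = 0" by (auto simp: overlap_def)
    thus ?thesis by (simp only: emeasure_empty ennreal_0)
  qed
  moreover have "0 \<le> overlap s u s' u'" by (simp add: overlap_def)
  ultimately show ?thesis
    using has_bochner_integral_real_indicator[of "{max s s'<..min u u'}" lborel]
    by (simp add: measure_def)
qed

text \<open>For disjoint intervals the later increment has mean 0 against everything before it.
  Overlapping intervals are cut at \<open>s'\<close> and at the earlier right end \<open>m\<close>;
  by the martingale property only the product over the common piece can contribute, and the bracket
  evaluates it.\<close>

lemma incr_covariance_ordered:
  assumes kl: "k \<in> K" "l \<in> K" and su: "0 \<le> s" "s \<le> u" "s \<le> s'" "s' \<le> u'"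
    and G: "G \<in> borel_measurable (F s')" "\<And>\<omega>. \<omega> \<in> space M \<Longrightarrow> \<bar>G \<omega>\<bar> \<le> B"
  shows "integrable M (\<lambda>\<omega>. G \<omega> * (incr k s u \<omega> * incr l s' u' \<omega>)) \<and>
    expectation (\<lambda>\<omega>. G \<omega> * (incr k s u \<omega> * incr l s' u' \<omega>)) =
      (if k = l then lam k * overlap s u s' u' * expectation G else 0)"
proof -
  have s': "0 \<le> s'" using su by simp
  have int: "integrable M (\<lambda>\<omega>. G \<omega> * X \<omega>)" if "integrable M X" for X
  proof (rule Bochner_Integration.integrable_bound[OF integrable_mult_right[OF that, of B]])
    have [measurable]: "G \<in> borel_measurable M" using measurable_F_M[OF s' G(1)] .
    show "(\<lambda>\<omega>. G \<omega> * X \<omega>) \<in> borel_measurable M" using that by measurable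
    show "AE \<omega> in M. norm (G \<omega> * X \<omega>) \<le> norm (B * X \<omega>)"
    proof (rule AE_I2)
      fix \<omega> assume "\<omega> \<in> space M"
      hence "\<bar>G \<omega>\<bar> \<le> \<bar>B\<bar>" using G(2) by (meson abs_ge_self order_trans)
      thus "norm (G \<omega> * X \<omega>) \<le> norm (B * X \<omega>)" by (simp add: abs_mult mult_right_mono)
    qed
  qed
  have intG: "integrable M G" using int[of "\<lambda>_. 1"] by simp
  show ?thesis
  proof (cases "u \<le> s'")
    case True
    have m: "(\<lambda>\<omega>. G \<omega> * incr k s u \<omega>) \<in> borel_measurable (F s')"
      using measurable_F_mono[OF _ True incr_measurable_F[OF kl(1) su(1,2)]] su G(1) by simp
    have "overlap s u s' u' = 0" using True su by (simp add: overlap_def)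
    with incr_martingale[OF kl(2) s' su(4) m int[OF incr_moments(1)[OF kl(1) su(1,2)]]]
    show ?thesis by (simp add: mult.assoc)
  next
    case False
    define m where "m = min u u'"
    have m: "s' \<le> m" "m \<le> u" "m \<le> u'" "m = u \<or> m = u'" "0 \<le> m" using False su by (auto simp: m_def)
    let ?a = "\<lambda>\<omega>. (G \<omega> * incr k s s' \<omega>) * incr l s' u' \<omega>"
    let ?b = "\<lambda>\<omega>. G \<omega> * (incr k s' m \<omega> * incr l s' m \<omega>)"
    let ?c = "\<lambda>\<omega>. (G \<omega> * incr k s' m \<omega>) * incr l m u' \<omega>"
    let ?d = "\<lambda>\<omega>. (G \<omega> * incr l s' m \<omega>) * incr k m u \<omega>"
    have Gm: "G \<in> borel_measurable (F m)" by (rule measurable_F_mono[OF s' m(1) G(1)])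
    have a: "integrable M ?a" "expectation ?a = 0"
      by (rule incr_martingale[OF kl(2) s' su(4)];
        use G(1) incr_measurable_F[OF kl(1) su(1,3)] int[OF incr_moments(1)[OF kl(1) su(1,3)]] in simp)+
    have b: "integrable M ?b" "expectation ?b = (if k = l then lam k * (m - s') * expectation G else 0)"
      by (rule incr_bracket[OF kl s' m(1) G(1) intG])+
    have c: "integrable M ?c" "expectation ?c = 0"
      by (rule incr_martingale[OF kl(2) m(5,3)];
        use Gm incr_measurable_F[OF kl(1) s' m(1)] int[OF incr_moments(1)[OF kl(1) s' m(1)]] in simp)+
    have d: "integrable M ?d" "expectation ?d = 0"
      by (rule incr_martingale[OF kl(1) m(5,2)];
        use Gm incr_measurable_F[OF kl(2) s' m(1)] int[OF incr_moments(1)[OF kl(2) s' m(1)]] in simp)+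
    \<comment> \<open>There is no term with both right remainders: \<open>m\<close> equals
      \<open>u\<close> or \<open>u'\<close>, so \<open>incr k m u\<close> or
      \<open>incr l m u'\<close> vanishes.\<close>
    have "G \<omega> * (incr k s u \<omega> * incr l s' u' \<omega>) = ?a \<omega> + ?b \<omega> + ?c \<omega> + ?d \<omega>" for \<omega>
      using m(4) by (auto simp: incr_def algebra_simps)
    moreover have "overlap s u s' u' = m - s'" using m(1) su(3) by (simp add: overlap_def m_def)
    ultimately show ?thesis
      using a b c d by (simp add: Bochner_Integration.integrable_add Bochner_Integration.integral_add)
  qed
qed

text \<open>The weight may depend on the past up to the later of the two left endpoints, as the
  inner product of two simple integrands does. The two orders of the endpoints are
  symmetric.\<close>

lemma incr_covariance:
  assumes kl: "k \<in> K" "l \<in> K" and su: "0 \<le> s" "s \<le> u" "0 \<le> s'" "s' \<le> u'"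
    and G: "G \<in> borel_measurable (F (max s s'))" "\<And>\<omega>. \<omega> \<in> space M \<Longrightarrow> \<bar>G \<omega>\<bar> \<le> B"
  shows "integrable M (\<lambda>\<omega>. G \<omega> * (incr k s u \<omega> * incr l s' u' \<omega>))" (is ?i)
    and "expectation (\<lambda>\<omega>. G \<omega> * (incr k s u \<omega> * incr l s' u' \<omega>)) =
      (if k = l then lam k * overlap s u s' u' * expectation G else 0)" (is ?e)
proof -
  have "?i \<and> ?e"
  proof (cases "s \<le> s'")
    case True
    show ?thesis by (rule incr_covariance_ordered[OF kl su(1,2) True su(4)])
      (use G True in \<open>auto simp: max_def\<close>)
  next
    case False
    have "integrable M (\<lambda>\<omega>. G \<omega> * (incr l s' u' \<omega> * incr k s u \<omega>)) \<and>
      expectation (\<lambda>\<omega>. G \<omega> * (incr l s' u' \<omega> * incr k s u \<omega>)) =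
        (if l = k then lam l * overlap s' u' s u * expectation G else 0)"
      by (rule incr_covariance_ordered[OF kl(2,1) su(3,4) _ su(2)])
        (use G False in \<open>auto simp: max_def\<close>)
    thus ?thesis by (auto simp: overlap_commute mult.commute)
  qed
  thus ?i ?e by auto
qed

end

section \<open>The isometry for elementary integrals\<close>

context wiener_setting
begin

text \<open>The integral evaluates operators at \<open>e k\<close>, the Hilbert-Schmidt norm at
  \<open>f k\<close>; the factor squares to the variance rate of \<open>\<beta> k\<close>. For
  \<open>lam k = 0\<close> both sides are 0, otherwise \<open>e k\<close> is a multiple of
  \<open>f k\<close> and so lies in \<open>U0 Q\<close>.\<close>

lemma L20_apply_e:
  fixes \<Phi> :: "'u \<Rightarrow> 'b::real_inner"
  assumes \<Phi>: "\<Phi> \<in> L20 Q" and k: "k \<in> K"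
  shows "\<Phi> (f k) = sqrt (lam k) *\<^sub>R \<Phi> (e k)"
proof (cases "lam k = 0")
  case True
  thus ?thesis using \<Phi> bounded_U0_zero[of \<Phi>] by (simp add: f_def L20_iff)
next
  case False
  hence l: "sqrt (lam k) \<noteq> 0" by simp
  have "(1 / sqrt (lam k)) *\<^sub>R f k \<in> U0 Q" by (rule subspace_scale[OF subspace_U0 f_U0])
  hence "e k \<in> U0 Q" using k l by (simp add: f_def)
  thus ?thesis using \<Phi> k by (simp add: L20_def linear_on_set_def f_def)
qed

text \<open>Elementary data freed from the partition: the intervals may overlap and end anywhere.
  The difference of two elementary processes on unrelated partitions, even with different horizons,
  is again of this form.\<close>

definition atoms :: "'j set \<Rightarrow> ('j \<Rightarrow> real) \<Rightarrow> ('j \<Rightarrow> real) \<Rightarrow> ('j \<Rightarrow> 'w \<Rightarrow> 'u \<Rightarrow> 'h::{real_inner,banach,second_countable_topology}) \<Rightarrow> bool" where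
  "atoms J s u \<xi> \<longleftrightarrow> finite J \<and> (\<forall>j\<in>J. 0 \<le> s j \<and> s j \<le> u j \<and> simple_function (F (s j)) (\<xi> j) \<and> \<xi> j ` space M \<subseteq> L20 Q)"

definition atom_sum :: "'j set \<Rightarrow> ('j \<Rightarrow> real) \<Rightarrow> ('j \<Rightarrow> real) \<Rightarrow> ('j \<Rightarrow> 'w \<Rightarrow> 'u \<Rightarrow> 'h::real_vector) \<Rightarrow> nat set \<Rightarrow> 'w \<Rightarrow> 'h" where
  "atom_sum J s u \<xi> A \<omega> = (\<Sum>j\<in>J. \<Sum>k\<in>A. incr k (s j) (u j) \<omega> *\<^sub>R \<xi> j \<omega> (e k))"

definition atom_process :: "'j set \<Rightarrow> ('j \<Rightarrow> real) \<Rightarrow> ('j \<Rightarrow> real) \<Rightarrow> ('j \<Rightarrow> 'w \<Rightarrow> 'u \<Rightarrow> 'h::real_vector) \<Rightarrow> real \<Rightarrow> 'w \<Rightarrow> 'u \<Rightarrow> 'h" where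
  "atom_process J s u \<xi> \<tau> \<omega> x = (\<Sum>j\<in>J. indicat_real {s j<..u j} \<tau> *\<^sub>R \<xi> j \<omega> x)"

text \<open>Finitely many values give bounded coordinates, and \<open>incr_covariance\<close> asks
  for a bounded weight.\<close>

lemma simple_coord_measurable:
  fixes \<xi> :: "'w \<Rightarrow> 'u \<Rightarrow> 'h::{real_inner,banach,second_countable_topology}"
  assumes "0 \<le> s" "simple_function (F s) \<xi>"
  shows "(\<lambda>\<omega>. \<xi> \<omega> x) \<in> borel_measurable (F s)"
    and "\<exists>B. \<forall>\<omega>\<in>space M. norm (\<xi> \<omega> x) \<le> B"
proof -
  have *: "simple_function (F s) (\<lambda>\<omega>. \<xi> \<omega> x)"
    by (rule simple_function_compose1[OF assms(2), of "\<lambda>p. p x"])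
  thus "(\<lambda>\<omega>. \<xi> \<omega> x) \<in> borel_measurable (F s)" by (rule borel_measurable_simple_function)
  have "finite ((\<lambda>\<omega>. \<xi> \<omega> x) ` space M)" using * space_F[OF assms(1)] by (simp add: simple_function_def)
  hence "bounded ((\<lambda>\<omega>. \<xi> \<omega> x) ` space M)" by (rule finite_imp_bounded)
  thus "\<exists>B. \<forall>\<omega>\<in>space M. norm (\<xi> \<omega> x) \<le> B" by (auto simp: bounded_iff)
qed

lemma atom_sum_measurable:
  assumes "atoms J s u \<xi>" "A \<subseteq> K" "\<forall>j\<in>J. u j \<le> t"
  shows "atom_sum J s u \<xi> A \<in> borel_measurable (F t)"
proof -
  have "(\<lambda>\<omega>. incr k (s j) (u j) \<omega> *\<^sub>R \<xi> j \<omega> (e k)) \<in> borel_measurable (F t)" if j: "j \<in> J" and k: "k \<in> A" for j k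
  proof -
    have a: "0 \<le> s j" "s j \<le> u j" "u j \<le> t" "simple_function (F (s j)) (\<xi> j)"
      using assms j by (auto simp: atoms_def)
    have "incr k (s j) (u j) \<in> borel_measurable (F t)"
      by (rule measurable_F_mono[OF _ a(3) incr_measurable_F]) (use a k assms in auto)
    moreover have "(\<lambda>\<omega>. \<xi> j \<omega> (e k)) \<in> borel_measurable (F t)"
      by (rule measurable_F_mono[OF a(1) _ simple_coord_measurable(1)[OF a(1,4)]]) (use a in auto)
    ultimately show ?thesis by (rule borel_measurable_scaleR)
  qed
  thus ?thesis unfolding atom_sum_def[abs_def] by (intro borel_measurable_sum)
qed

lemma atom_sum_measurable_M:
  assumes at: "atoms J s u \<xi>" and A: "A \<subseteq> K"
  shows "atom_sum J s u \<xi> A \<in> borel_measurable M"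
\<comment> \<open>The largest right endpoint serves as horizon; it exists only for nonempty
  \<open>J\<close>.\<close>
proof (cases "J = {}")
  case True thus ?thesis by (simp add: atom_sum_def[abs_def])
next
  case False
  have fin: "finite J" using at by (simp add: atoms_def)
  have "\<forall>j\<in>J. u j \<le> Max (u ` J)" using fin by simp
  moreover have "0 \<le> Max (u ` J)"
  proof -
    obtain j where "j \<in> J" using False by blast
    hence "0 \<le> u j" "u j \<le> Max (u ` J)" using at fin by (auto simp: atoms_def)
    thus ?thesis by linarith
  qed
  ultimately show ?thesis using measurable_F_M[OF _ atom_sum_measurable[OF at A]] by blast
qed

text \<open>Both sides expand into sums over pairs of atoms. On the left the covariance removes
  \<open>k \<noteq> l\<close> and leaves \<open>lam k\<close> times the overlap; on the right the
  product of two interval indicators integrates to the same overlap, and \<open>L20_apply_e\<close>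
  supplies the same \<open>lam k\<close>.\<close>

lemma atom_isometry:
  fixes \<xi> :: "'j \<Rightarrow> 'w \<Rightarrow> 'u \<Rightarrow> 'h::{real_inner,banach,second_countable_topology}"
  assumes at: "atoms J s u \<xi>" and A: "finite A" "A \<subseteq> K"
  shows "L2sq M (atom_sum J s u \<xi> A) =
    (\<Sum>k\<in>A. \<integral>\<^sup>+\<omega>. \<integral>\<^sup>+\<tau>. ennreal ((norm (atom_process J s u \<xi> \<tau> \<omega> (f k)))\<^sup>2) \<partial>lborel \<partial>M)"
proof -
  define G where "G i k j l \<omega> = inner (\<xi> i \<omega> (e k)) (\<xi> j \<omega> (e l))" for i k j l \<omega>
  define ov where "ov i j = overlap (s i) (u i) (s j) (u j)" for i j
  have J: "finite J" and su: "\<And>j. j \<in> J \<Longrightarrow> 0 \<le> s j" "\<And>j. j \<in> J \<Longrightarrow> s j \<le> u j"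
    and \<xi>: "\<And>j. j \<in> J \<Longrightarrow> simple_function (F (s j)) (\<xi> j)"
    and L: "\<And>j \<omega>. j \<in> J \<Longrightarrow> \<omega> \<in> space M \<Longrightarrow> \<xi> j \<omega> \<in> L20 Q"
    using at by (auto simp: atoms_def)
  have Gm: "G i k j l \<in> borel_measurable (F (max (s i) (s j)))" if "i \<in> J" "j \<in> J" for i j k l
    unfolding G_def[abs_def]
    by (intro borel_measurable_inner measurable_F_mono[OF _ _ simple_coord_measurable(1)[OF su(1) \<xi>]])
      (use that su in auto)
  have Gb: "\<exists>B. \<forall>\<omega>\<in>space M. \<bar>G i k j l \<omega>\<bar> \<le> B" if ij: "i \<in> J" "j \<in> J" for i j k l
  proof -
    obtain B1 B2 where B: "\<forall>\<omega>\<in>space M. norm (\<xi> i \<omega> (e k)) \<le> B1" "\<forall>\<omega>\<in>space M. norm (\<xi> j \<omega> (e l)) \<le> B2"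
      using simple_coord_measurable(2)[OF su(1) \<xi>] ij by metis
    have "\<bar>G i k j l \<omega>\<bar> \<le> \<bar>B1\<bar> * \<bar>B2\<bar>" if "\<omega> \<in> space M" for \<omega>
    proof -
      have "\<bar>G i k j l \<omega>\<bar> \<le> norm (\<xi> i \<omega> (e k)) * norm (\<xi> j \<omega> (e l))"
        unfolding G_def by (rule Cauchy_Schwarz_ineq2)
      also have "\<dots> \<le> \<bar>B1\<bar> * \<bar>B2\<bar>" using B that by (intro mult_mono) force+
      finally show ?thesis .
    qed
    thus ?thesis by blast
  qed
  have cov: "has_bochner_integral M (\<lambda>\<omega>. G i k j l \<omega> * (incr k (s i) (u i) \<omega> * incr l (s j) (u j) \<omega>))
      (if k = l then lam k * ov i j * expectation (G i k j k) else 0)"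
    if ij: "i \<in> J" "j \<in> J" and kl: "k \<in> A" "l \<in> A" for i j k l
  proof -
    obtain B where B: "\<And>\<omega>. \<omega> \<in> space M \<Longrightarrow> \<bar>G i k j l \<omega>\<bar> \<le> B" using Gb[OF ij] by metis
    have "k \<in> K" "l \<in> K" using kl A by auto
    from incr_covariance[OF this su(1)[OF ij(1)] su(2)[OF ij(1)] su(1)[OF ij(2)] su(2)[OF ij(2)] Gm[OF ij] B]
    show ?thesis unfolding has_bochner_integral_iff ov_def by simp
  qed
  have Gi: "integrable M (G i k j l)" if ij: "i \<in> J" "j \<in> J" for i j k l
  proof -
    obtain B where B: "\<And>\<omega>. \<omega> \<in> space M \<Longrightarrow> \<bar>G i k j l \<omega>\<bar> \<le> B" using Gb[OF ij] by metis
    show ?thesis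
      by (rule integrable_const_bound[of _ B])
        (use B su ij measurable_F_M[OF _ Gm[OF ij]] in \<open>auto simp: le_max_iff_disj\<close>)
  qed
  have sq: "(norm (atom_sum J s u \<xi> A \<omega>))\<^sup>2 =
    (\<Sum>i\<in>J. \<Sum>k\<in>A. \<Sum>j\<in>J. \<Sum>l\<in>A. G i k j l \<omega> * (incr k (s i) (u i) \<omega> * incr l (s j) (u j) \<omega>))" for \<omega>
    unfolding atom_sum_def power2_norm_eq_inner inner_sum_left inner_sum_right G_def
    by (simp add: mult_ac inner_commute)
  \<comment> \<open>The time integral of the squared norm of coordinate \<open>k\<close>; its
    expectation is where the two computations meet.\<close>
  define q where "q k \<omega> = (\<Sum>i\<in>J. \<Sum>j\<in>J. ov i j * (lam k * G i k j k \<omega>))" for k \<omega>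
  have hq: "has_bochner_integral lborel (\<lambda>\<tau>. (norm (atom_process J s u \<xi> \<tau> \<omega> (f k)))\<^sup>2) (q k \<omega>)"
    if \<omega>: "\<omega> \<in> space M" and k: "k \<in> A" for \<omega> k
  proof -
    have kK: "k \<in> K" using k A by auto
    have "inner (\<xi> i \<omega> (f k)) (\<xi> j \<omega> (f k)) = lam k * G i k j k \<omega>" if "i \<in> J" "j \<in> J" for i j
      using lam_nonneg[OF kK] L20_apply_e[OF L[OF that(1) \<omega>] kK] L20_apply_e[OF L[OF that(2) \<omega>] kK]
      by (simp add: G_def flip: mult.assoc)
    hence eq: "(norm (atom_process J s u \<xi> \<tau> \<omega> (f k)))\<^sup>2 =
      (\<Sum>i\<in>J. \<Sum>j\<in>J. indicat_real {s i<..u i} \<tau> * indicat_real {s j<..u j} \<tau> * (lam k * G i k j k \<omega>))" for \<tau>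
      unfolding atom_process_def power2_norm_eq_inner inner_sum_left inner_sum_right
      by (intro sum.cong refl) (simp add: inner_commute)
    show ?thesis unfolding eq q_def ov_def
      by (intro has_bochner_integral_sum has_bochner_integral_mult_left overlap_integral su)
  qed
  have q0: "0 \<le> q k \<omega>" if "\<omega> \<in> space M" "k \<in> A" for \<omega> k
  proof -
    have "q k \<omega> = (\<integral>\<tau>. (norm (atom_process J s u \<xi> \<tau> \<omega> (f k)))\<^sup>2 \<partial>lborel)"
      using hq[OF that] by (simp add: has_bochner_integral_iff)
    thus ?thesis by (simp add: Bochner_Integration.integral_nonneg)
  qed
  have hE: "has_bochner_integral M (q k) (\<Sum>i\<in>J. \<Sum>j\<in>J. ov i j * (lam k * expectation (G i k j k)))" for k
    unfolding q_def[abs_def]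
    by (intro has_bochner_integral_sum has_bochner_integral_mult_right has_bochner_integral_integrable Gi)
  have R: "(\<integral>\<^sup>+\<omega>. \<integral>\<^sup>+\<tau>. ennreal ((norm (atom_process J s u \<xi> \<tau> \<omega> (f k)))\<^sup>2) \<partial>lborel \<partial>M) = ennreal (expectation (q k))"
    if k: "k \<in> A" for k
  proof -
    have "(\<integral>\<^sup>+\<omega>. \<integral>\<^sup>+\<tau>. ennreal ((norm (atom_process J s u \<xi> \<tau> \<omega> (f k)))\<^sup>2) \<partial>lborel \<partial>M) = (\<integral>\<^sup>+\<omega>. ennreal (q k \<omega>) \<partial>M)"
    proof (rule nn_integral_cong)
      fix \<omega> assume \<omega>: "\<omega> \<in> space M"
      from hq[OF \<omega> k] show "(\<integral>\<^sup>+\<tau>. ennreal ((norm (atom_process J s u \<xi> \<tau> \<omega> (f k)))\<^sup>2) \<partial>lborel) = ennreal (q k \<omega>)"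
        by (subst nn_integral_eq_integral) (auto simp: has_bochner_integral_iff)
    qed
    also have "\<dots> = ennreal (expectation (q k))"
      using hE[of k] q0[OF _ k] by (intro nn_integral_eq_integral) (auto simp: has_bochner_integral_iff)
    finally show ?thesis .
  qed
  have "has_bochner_integral M (\<lambda>\<omega>. (norm (atom_sum J s u \<xi> A \<omega>))\<^sup>2)
    (\<Sum>i\<in>J. \<Sum>k\<in>A. \<Sum>j\<in>J. \<Sum>l\<in>A. if k = l then lam k * ov i j * expectation (G i k j k) else 0)"
    unfolding sq by (intro has_bochner_integral_sum cov)
  also have "(\<Sum>i\<in>J. \<Sum>k\<in>A. \<Sum>j\<in>J. \<Sum>l\<in>A. if k = l then lam k * ov i j * expectation (G i k j k) else 0) =
      (\<Sum>k\<in>A. \<Sum>i\<in>J. \<Sum>j\<in>J. ov i j * (lam k * expectation (G i k j k)))"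
    using A by (subst sum.swap) (simp add: mult_ac)
  also have "\<dots> = (\<Sum>k\<in>A. expectation (q k))"
    using hE by (intro sum.cong refl) (simp add: has_bochner_integral_iff)
  finally have X: "has_bochner_integral M (\<lambda>\<omega>. (norm (atom_sum J s u \<xi> A \<omega>))\<^sup>2) (\<Sum>k\<in>A. expectation (q k))" .
  have "L2sq M (atom_sum J s u \<xi> A) = ennreal (\<Sum>k\<in>A. expectation (q k))"
    unfolding L2sq_def using X by (subst nn_integral_eq_integral) (auto simp: has_bochner_integral_iff)
  also have "\<dots> = (\<Sum>k\<in>A. ennreal (expectation (q k)))"
  proof (rule sum_ennreal[symmetric])
    fix k assume "k \<in> A"
    thus "0 \<le> expectation (q k)" by (intro Bochner_Integration.integral_nonneg_AE AE_I2 q0)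
  qed
  finally show ?thesis using R by simp
qed

section \<open>Coordinates and the L2 space of integrands\<close>

abbreviation TM :: "(real \<times> 'w) measure" where
  "TM \<equiv> lborel \<Otimes>\<^sub>M M"

text \<open>Coordinates turn an operator-valued process into an element of \<open>L\<^sup>2\<close> of the product measure
  \<open>counting \<otimes> dt \<otimes> P\<close> with values in \<open>H\<close>.\<close>

definition pm :: "(nat \<times> real \<times> 'w) measure" where
  "pm = count_space UNIV \<Otimes>\<^sub>M TM"

lemma pm_measurableI:
  assumes "\<And>k. (\<lambda>(\<tau>, \<omega>). g k \<tau> \<omega>) \<in> TM \<rightarrow>\<^sub>M N"
  shows "(\<lambda>(k, \<tau>, \<omega>). g k \<tau> \<omega>) \<in> pm \<rightarrow>\<^sub>M N"
  unfolding pm_def using assms by (intro measurable_pair_measure_countable1) auto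

lemma space_pm: "space pm = UNIV \<times> UNIV \<times> space M"
  by (simp add: pm_def space_pair_measure)

text \<open>Tonelli, in the order of \<open>N2_norm_sq\<close>: time inside, probability
  outside.\<close>

lemma nn_integral_pm:
  assumes "(\<lambda>(k, \<tau>, \<omega>). g k \<tau> \<omega>) \<in> borel_measurable pm"
  shows "(\<integral>\<^sup>+(k, \<tau>, \<omega>). g k \<tau> \<omega> \<partial>pm) = (\<Sum>k. \<integral>\<^sup>+\<omega>. \<integral>\<^sup>+\<tau>. g k \<tau> \<omega> \<partial>lborel \<partial>M)"
proof -
  interpret P: pair_sigma_finite lborel M ..
  have s: "sigma_finite_measure TM" by (rule P.sigma_finite_measure_axioms)
  have "(\<integral>\<^sup>+(k, \<tau>, \<omega>). g k \<tau> \<omega> \<partial>pm) = (\<integral>\<^sup>+k. \<integral>\<^sup>+(\<tau>, \<omega>). g k \<tau> \<omega> \<partial>TM \<partial>count_space UNIV)"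
    using sigma_finite_measure.nn_integral_fst[OF s assms[unfolded pm_def]] by (simp add: pm_def)
  also have "\<dots> = (\<Sum>k. \<integral>\<^sup>+(\<tau>, \<omega>). g k \<tau> \<omega> \<partial>TM)" by (rule nn_integral_count_space_nat)
  also have "\<dots> = (\<Sum>k. \<integral>\<^sup>+\<omega>. \<integral>\<^sup>+\<tau>. g k \<tau> \<omega> \<partial>lborel \<partial>M)"
  proof (rule arg_cong[where f=suminf], rule ext)
    fix k
    have m: "(\<lambda>(\<tau>, \<omega>). g k \<tau> \<omega>) \<in> borel_measurable TM"
      using measurable_compose_Pair1[of k "count_space UNIV" "\<lambda>(k, \<tau>, \<omega>). g k \<tau> \<omega>" "TM" borel] assms
      by (simp add: pm_def)
    show "(\<integral>\<^sup>+(\<tau>, \<omega>). g k \<tau> \<omega> \<partial>TM) = (\<integral>\<^sup>+\<omega>. \<integral>\<^sup>+\<tau>. g k \<tau> \<omega> \<partial>lborel \<partial>M)"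
      using P.nn_integral_snd[OF m] by simp
  qed
  finally show ?thesis .
qed

text \<open>The cut-off at \<open>t\<close> places integrands with different horizons in the same L2
  space over \<open>pm\<close>, where they can be subtracted.\<close>

definition coords :: "real \<Rightarrow> (real \<Rightarrow> 'w \<Rightarrow> 'u \<Rightarrow> 'h::real_normed_vector) \<Rightarrow> nat \<times> real \<times> 'w \<Rightarrow> 'h" where
  "coords t \<Phi> = (\<lambda>(k, \<tau>, \<omega>). indicat_real {0..t} \<tau> *\<^sub>R \<Phi> \<tau> \<omega> (f k))"

lemma L2sq_coords:
  assumes "coords t \<Phi> \<in> borel_measurable pm"
  shows "L2sq pm (coords t \<Phi>) =
    (\<Sum>k. \<integral>\<^sup>+\<omega>. \<integral>\<^sup>+\<tau>. ennreal ((norm (indicat_real {0..t} \<tau> *\<^sub>R \<Phi> \<tau> \<omega> (f k)))\<^sup>2) \<partial>lborel \<partial>M)"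
proof -
  have "L2sq pm (coords t \<Phi>) = (\<integral>\<^sup>+(k, \<tau>, \<omega>). ennreal ((norm (indicat_real {0..t} \<tau> *\<^sub>R \<Phi> \<tau> \<omega> (f k)))\<^sup>2) \<partial>pm)"
    unfolding L2sq_def coords_def by (rule arg_cong[where f="nn_integral pm"]) auto
  also have "\<dots> = (\<Sum>k. \<integral>\<^sup>+\<omega>. \<integral>\<^sup>+\<tau>. ennreal ((norm (indicat_real {0..t} \<tau> *\<^sub>R \<Phi> \<tau> \<omega> (f k)))\<^sup>2) \<partial>lborel \<partial>M)"
  proof (rule nn_integral_pm)
    have "(\<lambda>p. ennreal ((norm (coords t \<Phi> p))\<^sup>2)) \<in> borel_measurable pm" using assms by measurable
    moreover have "(\<lambda>p. ennreal ((norm (coords t \<Phi> p))\<^sup>2)) =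
        (\<lambda>(k, \<tau>, \<omega>). ennreal ((norm (indicat_real {0..t} \<tau> *\<^sub>R \<Phi> \<tau> \<omega> (f k)))\<^sup>2))"
      by (auto simp: coords_def)
    ultimately show "(\<lambda>(k, \<tau>, \<omega>). ennreal ((norm (indicat_real {0..t} \<tau> *\<^sub>R \<Phi> \<tau> \<omega> (f k)))\<^sup>2)) \<in> borel_measurable pm"
      by simp
  qed
  finally show ?thesis .
qed

text \<open>The squared Hilbert-Schmidt norm is a series along \<open>f\<close>, and nonnegative
  series commute with both integrals.\<close>

lemma N2_norm_sq_eq_L2sq:
  fixes \<Phi> :: "real \<Rightarrow> 'w \<Rightarrow> 'u \<Rightarrow> 'h::{real_inner,banach,second_countable_topology}"
  assumes L: "\<And>\<tau> \<omega>. \<tau> \<in> {0..t} \<Longrightarrow> \<omega> \<in> space M \<Longrightarrow> \<Phi> \<tau> \<omega> \<in> L20 Q"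
    and m: "coords t \<Phi> \<in> borel_measurable pm"
  shows "N2_norm_sq M Q t \<Phi> = L2sq pm (coords t \<Phi>)"
proof -
  let ?g = "\<lambda>k \<tau> \<omega>. ennreal ((norm (indicat_real {0..t} \<tau> *\<^sub>R \<Phi> \<tau> \<omega> (f k)))\<^sup>2)"
  have mk: "(\<lambda>(\<tau>, \<omega>). ?g k \<tau> \<omega>) \<in> borel_measurable TM" for k
  proof -
    have "(\<lambda>p. coords t \<Phi> (k, p)) \<in> borel_measurable TM"
      using measurable_compose_Pair1[of k "count_space UNIV" "coords t \<Phi>" "TM" borel] m
      by (simp add: pm_def)
    hence "(\<lambda>p. ennreal ((norm (coords t \<Phi> (k, p)))\<^sup>2)) \<in> borel_measurable TM" by measurable
    thus ?thesis by (simp add: coords_def case_prod_beta)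
  qed
  have m1: "(\<lambda>\<tau>. ?g k \<tau> \<omega>) \<in> borel_measurable lborel" if "\<omega> \<in> space M" for k \<omega>
    using measurable_compose[OF measurable_Pair2'[OF that, of lborel] mk[of k]] by simp
  have m2: "(\<lambda>\<omega>. \<integral>\<^sup>+\<tau>. ?g k \<tau> \<omega> \<partial>lborel) \<in> borel_measurable M" for k
  proof -
    have "(\<lambda>(\<omega>, \<tau>). ?g k \<tau> \<omega>) \<in> borel_measurable (M \<Otimes>\<^sub>M lborel)"
      using measurable_pair_swap[OF mk[of k]] by (simp add: case_prod_beta)
    thus ?thesis by (rule lborel.borel_measurable_nn_integral)
  qed
  have pw: "ennreal ((L20_norm Q (\<Phi> \<tau> \<omega>))\<^sup>2) * indicator {0..t} \<tau> = (\<Sum>k. ?g k \<tau> \<omega>)"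
    if \<omega>: "\<omega> \<in> space M" for \<tau> \<omega>
  proof (cases "\<tau> \<in> {0..t}")
    case True
    from L[OF this \<omega>] have "summable (\<lambda>k. (norm (\<Phi> \<tau> \<omega> (f k)))\<^sup>2)" by (simp add: L20_iff)
    with True show ?thesis by (simp add: L20_norm_sq[OF L[OF True \<omega>]] suminf_ennreal2)
  qed simp
  have "N2_norm_sq M Q t \<Phi> = (\<integral>\<^sup>+\<omega>. \<integral>\<^sup>+\<tau>. (\<Sum>k. ?g k \<tau> \<omega>) \<partial>lborel \<partial>M)"
    unfolding N2_norm_sq_def by (intro nn_integral_cong) (simp only: pw)
  also have "\<dots> = (\<integral>\<^sup>+\<omega>. (\<Sum>k. \<integral>\<^sup>+\<tau>. ?g k \<tau> \<omega> \<partial>lborel) \<partial>M)"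
    by (intro nn_integral_cong nn_integral_suminf m1)
  also have "\<dots> = (\<Sum>k. \<integral>\<^sup>+\<omega>. \<integral>\<^sup>+\<tau>. ?g k \<tau> \<omega> \<partial>lborel \<partial>M)"
    by (rule nn_integral_suminf[OF m2])
  also have "\<dots> = L2sq pm (coords t \<Phi>)" by (rule L2sq_coords[OF m, symmetric])
  finally show ?thesis .
qed

lemma coords_atom_process:
  fixes \<xi> :: "'j \<Rightarrow> 'w \<Rightarrow> 'u \<Rightarrow> 'h::{real_inner,banach,second_countable_topology}"
  assumes at: "atoms J s u \<xi>" and t: "\<forall>j\<in>J. u j \<le> t"
  shows "coords t (atom_process J s u \<xi>) = (\<lambda>(k, \<tau>, \<omega>). atom_process J s u \<xi> \<tau> \<omega> (f k))"
proof -
  have "indicat_real {0..t} \<tau> *\<^sub>R (indicat_real {s j<..u j} \<tau> *\<^sub>R x) = indicat_real {s j<..u j} \<tau> *\<^sub>R x"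
    if "j \<in> J" for j \<tau> and x :: 'h
    using at t that by (auto simp: atoms_def indicator_def)
  thus ?thesis by (auto simp: coords_def atom_process_def scaleR_sum_right fun_eq_iff intro!: sum.cong)
qed

lemma coords_atom_process_measurable:
  assumes at: "atoms J s u \<xi>" and t: "\<forall>j\<in>J. u j \<le> t"
  shows "coords t (atom_process J s u \<xi>) \<in> borel_measurable pm"
  unfolding coords_atom_process[OF at t]
proof (rule pm_measurableI)
  fix k
  have "(\<lambda>(\<tau>, \<omega>). indicat_real {s j<..u j} \<tau> *\<^sub>R \<xi> j \<omega> (f k)) \<in> borel_measurable TM"
    if "j \<in> J" for j
  proof -
    have [measurable]: "(\<lambda>\<omega>. \<xi> j \<omega> (f k)) \<in> borel_measurable M"
      using measurable_F_M[OF _ simple_coord_measurable(1)[of "s j" "\<xi> j" "f k"]] at that by (auto simp: atoms_def)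
    show ?thesis by measurable
  qed
  thus "(\<lambda>(\<tau>, \<omega>). atom_process J s u \<xi> \<tau> \<omega> (f k)) \<in> borel_measurable TM"
    unfolding atom_process_def case_prod_beta by (intro borel_measurable_sum)
qed

lemma atom_process_L20:
  assumes "atoms J s u \<xi>" "\<omega> \<in> space M"
  shows "atom_process J s u \<xi> \<tau> \<omega> \<in> L20 Q"
  unfolding atom_process_def[abs_def] using assms
  by (intro L20_sum L20_scaleR) (auto simp: atoms_def)

lemma L2sq_coords_atom_process:
  assumes at: "atoms J s u \<xi>" and t: "\<forall>j\<in>J. u j \<le> t"
  shows "L2sq pm (coords t (atom_process J s u \<xi>)) =
    (\<Sum>k. \<integral>\<^sup>+\<omega>. \<integral>\<^sup>+\<tau>. ennreal ((norm (atom_process J s u \<xi> \<tau> \<omega> (f k)))\<^sup>2) \<partial>lborel \<partial>M)"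
proof -
  have "indicat_real {0..t} \<tau> *\<^sub>R atom_process J s u \<xi> \<tau> \<omega> (f k) = atom_process J s u \<xi> \<tau> \<omega> (f k)" for k \<tau> \<omega>
    using fun_cong[OF coords_atom_process[OF at t], of "(k, \<tau>, \<omega>)"] by (simp add: coords_def)
  thus ?thesis using L2sq_coords[OF coords_atom_process_measurable[OF at t]] by simp
qed

lemma atom_sum_le:
  assumes at: "atoms J s u \<xi>" and t: "\<forall>j\<in>J. u j \<le> t"
    and A: "finite A" "A \<subseteq> K"
  shows "L2sq M (atom_sum J s u \<xi> A) \<le> L2sq pm (coords t (atom_process J s u \<xi>))"
  unfolding L2sq_coords_atom_process[OF at t] atom_isometry[OF at A]
  by (rule sum_le_suminf) (use A in auto)

lemma atom_limit_le:
  assumes at: "atoms J s u \<xi>" and t: "\<forall>j\<in>J. u j \<le> t"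
    and Z: "L2_limit M (\<lambda>n. atom_sum J s u \<xi> (K \<inter> {..<n})) Z"
  shows "L2sq M Z \<le> 2 * L2sq pm (coords t (atom_process J s u \<xi>))"
  by (rule L2_limit_bound[OF Z]) (use at t in \<open>auto intro!: atom_sum_measurable_M atom_sum_le\<close>)

text \<open>Truncations in \<open>k\<close> differ by the sum over \<open>{m..<n}\<close>, whose
  mean square is, by the isometry, at most a block of a convergent series. All increments end by
  time \<open>t\<close>, so the limit is obtained inside \<open>F t\<close>.\<close>

lemma atom_limit_exists:
  fixes \<xi> :: "'j \<Rightarrow> 'w \<Rightarrow> 'u \<Rightarrow> 'h::{real_inner,banach,second_countable_topology}"
  assumes at: "atoms J s u \<xi>" and t: "0 \<le> t" "\<forall>j\<in>J. u j \<le> t"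
    and fin: "L2sq pm (coords t (atom_process J s u \<xi>)) < \<infinity>"
  obtains Z where "Z \<in> borel_measurable (F t)" "L2_limit M (\<lambda>n. atom_sum J s u \<xi> (K \<inter> {..<n})) Z"
proof (rule L2_complete[OF subalg[OF t(1)], of "\<lambda>n. atom_sum J s u \<xi> (K \<inter> {..<n})"])
  let ?X = "\<lambda>n. atom_sum J s u \<xi> (K \<inter> {..<n})"
  let ?a = "\<lambda>k. \<integral>\<^sup>+\<omega>. \<integral>\<^sup>+\<tau>. ennreal ((norm (atom_process J s u \<xi> \<tau> \<omega> (f k)))\<^sup>2) \<partial>lborel \<partial>M"
  show "?X n \<in> borel_measurable (F t)" for n
    using at t by (intro atom_sum_measurable) auto
  show "L2sq M (?X n) < \<infinity>" for n
    by (rule le_less_trans[OF atom_sum_le fin]) (use at t in auto)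
  have a: "(\<Sum>k. ?a k) < \<infinity>" using fin L2sq_coords_atom_process[OF at t(2)] by simp
  hence sum_fin: "?a k < top" for k
    using ennreal_suminf_lessD[of ?a top k] by simp
  define b where "b k = enn2real (?a k)" for k
  have ab: "?a k = ennreal (b k)" for k unfolding b_def using sum_fin[of k] by simp
  have "summable b"
    using a unfolding ab by (intro summable_suminf_not_top) (auto simp: b_def)
  fix \<epsilon> :: real assume \<epsilon>: "0 < \<epsilon>"
  then obtain N where N: "\<And>m n. m \<ge> N \<Longrightarrow> norm (sum b {m..<n}) < \<epsilon>"
    using \<open>summable b\<close> unfolding summable_Cauchy by blast
  have *: "L2sq M (\<lambda>\<omega>. ?X n \<omega> - ?X m \<omega>) \<le> ennreal \<epsilon>" if mn: "N \<le> m" "m \<le> n" for m n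
  proof -
    have "?X n \<omega> - ?X m \<omega> = atom_sum J s u \<xi> (K \<inter> {m..<n}) \<omega>" for \<omega>
    proof -
      have Kn: "K \<inter> {..<n} = (K \<inter> {..<m}) \<union> (K \<inter> {m..<n})" using mn by auto
      have "(\<Sum>k\<in>K \<inter> {..<n}. g k) = (\<Sum>k\<in>K \<inter> {..<m}. g k) + (\<Sum>k\<in>K \<inter> {m..<n}. g k)" for g :: "nat \<Rightarrow> 'h"
        unfolding Kn by (rule sum.union_disjoint) auto
      thus ?thesis by (simp add: atom_sum_def sum.distrib)
    qed
    hence "L2sq M (\<lambda>\<omega>. ?X n \<omega> - ?X m \<omega>) = L2sq M (atom_sum J s u \<xi> (K \<inter> {m..<n}))" by simp
    also have "\<dots> = (\<Sum>k\<in>K \<inter> {m..<n}. ?a k)" by (rule atom_isometry[OF at]) auto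
    also have "\<dots> \<le> (\<Sum>k\<in>{m..<n}. ?a k)" by (rule sum_mono2) auto
    also have "\<dots> = ennreal (sum b {m..<n})" unfolding ab by (rule sum_ennreal) (simp add: b_def)
    also have "\<dots> \<le> ennreal \<epsilon>" using N[OF mn(1), of n] by (intro ennreal_leI) simp
    finally show ?thesis .
  qed
  have "L2sq M (\<lambda>\<omega>. ?X m \<omega> - ?X n \<omega>) \<le> ennreal \<epsilon>" if "N \<le> m" "N \<le> n" for m n
    using *[of m n] *[of n m] that L2sq_minus_commute[of M "?X m" "?X n"] by (cases "m \<le> n") auto
  thus "\<exists>N. \<forall>m\<ge>N. \<forall>n\<ge>N. L2sq M (\<lambda>\<omega>. ?X m \<omega> - ?X n \<omega>) \<le> ennreal \<epsilon>" by blast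
qed (use that in blast)

end

section \<open>Predictable processes and the stochastic integral\<close>

context wiener_setting
begin

section \<open>The predictable sigma-algebra and the product space\<close>

lemma predictable_generators:
  "{{s<..u} \<times> A | s u A. 0 \<le> s \<and> s < u \<and> u \<le> t \<and> A \<in> sets (F s)} \<union> {{0} \<times> A | A. A \<in> sets (F 0)}
    \<subseteq> Pow ({0..t} \<times> space M)" (is "?G \<subseteq> _") if "0 \<le> t"
  using that sets_F_M[THEN subsetD, THEN sets.sets_into_space]
  by (auto simp: subset_eq)

lemma space_predictable: "space (predictable_algebra M F t) = {0..t} \<times> space M"
  by (simp add: predictable_algebra_def space_measure_of_conv)

lemma sets_predictable: "0 \<le> t \<Longrightarrow> sets (predictable_algebra M F t) = sigma_sets ({0..t} \<times> space M)
    ({{s<..u} \<times> A | s u A. 0 \<le> s \<and> s < u \<and> u \<le> t \<and> A \<in> sets (F s)} \<union> {{0} \<times> A | A. A \<in> sets (F 0)})"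
  unfolding predictable_algebra_def by (rule sets_measure_of[OF predictable_generators])

lemma rectangle_predictable:
  "0 \<le> s \<Longrightarrow> s < u \<Longrightarrow> u \<le> t \<Longrightarrow> A \<in> sets (F s) \<Longrightarrow> {s<..u} \<times> A \<in> sets (predictable_algebra M F t)"
  by (subst sets_predictable) (auto intro!: sigma_sets.Basic)

lemma rectangle_predictable_0:
  "0 \<le> t \<Longrightarrow> A \<in> sets (F 0) \<Longrightarrow> {0} \<times> A \<in> sets (predictable_algebra M F t)"
  by (subst sets_predictable) (auto intro!: sigma_sets.Basic)

lemma predictable_subset_product:
  assumes t: "0 \<le> t"
  shows "sets (predictable_algebra M F t) \<subseteq> sets TM"
proof -
  have "sigma_sets ({0..t} \<times> space M)
    ({{s<..u} \<times> A | s u A. 0 \<le> s \<and> s < u \<and> u \<le> t \<and> A \<in> sets (F s)} \<union> {{0} \<times> A | A. A \<in> sets (F 0)})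
    \<subseteq> sets (restrict_space TM ({0..t} \<times> space M))"
  proof (rule sets.sigma_sets_subset')
    have \<Omega>: "({0..t} \<times> space M) \<inter> space TM \<in> sets TM"
      by (auto simp: space_pair_measure)
    show "{0..t} \<times> space M \<in> sets (restrict_space TM ({0..t} \<times> space M))"
      using sets.top[of "restrict_space TM ({0..t} \<times> space M)"]
      by (simp add: space_restrict_space space_pair_measure Times_Int_Times)
    show "{{s<..u} \<times> A | s u A. 0 \<le> s \<and> s < u \<and> u \<le> t \<and> A \<in> sets (F s)} \<union> {{0} \<times> A | A. A \<in> sets (F 0)}
      \<subseteq> sets (restrict_space TM ({0..t} \<times> space M))"
    proof
      fix B assume B: "B \<in> {{s<..u} \<times> A | s u A. 0 \<le> s \<and> s < u \<and> u \<le> t \<and> A \<in> sets (F s)} \<union> {{0} \<times> A | A. A \<in> sets (F 0)}"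
      have "B \<in> sets TM"
        using B
      proof (elim UnE CollectE exE conjE)
        fix s u A assume "B = {s<..u} \<times> A" "0 \<le> s" "A \<in> sets (F s)"
        thus ?thesis using sets_F_M[of s] by auto
      next
        fix A assume "B = {0} \<times> A" "A \<in> sets (F 0)"
        thus ?thesis using sets_F_M[of 0] by auto
      qed
      moreover have "B \<subseteq> {0..t} \<times> space M" using subsetD[OF predictable_generators[OF t] B] by (rule PowD)
      ultimately show "B \<in> sets (restrict_space TM ({0..t} \<times> space M))"
        using \<Omega> by (simp add: sets_restrict_space_iff)
    qed
  qed
  also have "\<dots> \<subseteq> sets TM"
    by (auto simp: sets_restrict_space space_pair_measure)
  finally show ?thesis by (simp add: sets_predictable[OF t])
qed

text \<open>Predictable sets live over \<open>{0..t}\<close> only, and they belong to the trace of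
  the product sigma-algebra there. Extension by 0 carries functions to the whole product
  space.\<close>

lemma predictable_extend_measurable:
  fixes g :: "real \<times> 'w \<Rightarrow> 'h::{real_normed_vector,second_countable_topology}"
  assumes t: "0 \<le> t" and g: "g \<in> borel_measurable (predictable_algebra M F t)"
  shows "(\<lambda>(\<tau>, \<omega>). indicat_real {0..t} \<tau> *\<^sub>R g (\<tau>, \<omega>)) \<in> borel_measurable TM"
proof -
  let ?\<Omega> = "{0..t} \<times> space M"
  have \<Omega>: "?\<Omega> \<inter> space TM \<in> sets TM"
    by (auto simp: space_pair_measure)
  have "g \<in> borel_measurable (restrict_space TM ?\<Omega>)"
  proof (rule measurable_from_subalg[OF _ g])
    have "sets (predictable_algebra M F t) \<subseteq> sets (restrict_space TM ?\<Omega>)"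
    proof
      fix B assume B: "B \<in> sets (predictable_algebra M F t)"
      moreover from sets.sets_into_space[OF B] have "B \<subseteq> ?\<Omega>" by (simp add: space_predictable)
      ultimately show "B \<in> sets (restrict_space TM ?\<Omega>)"
        using predictable_subset_product[OF t] \<Omega> by (auto simp: sets_restrict_space_iff)
    qed
    thus "subalgebra (restrict_space TM ?\<Omega>) (predictable_algebra M F t)"
      by (auto simp: subalgebra_def space_predictable space_restrict_space space_pair_measure)
  qed
  hence "(\<lambda>x. indicator ?\<Omega> x *\<^sub>R g x) \<in> borel_measurable TM"
    by (subst (asm) borel_measurable_restrict_space_iff[OF \<Omega>])
  thus ?thesis
    by (rule measurable_cong[THEN iffD1, rotated])
      (auto simp: space_pair_measure indicator_def)
qed

lemma predictable_coords_measurable: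
  fixes \<Phi> :: "real \<Rightarrow> 'w \<Rightarrow> 'u \<Rightarrow> 'h::{real_inner,banach,second_countable_topology}"
  assumes t: "0 \<le> t"
    and \<Phi>: "\<And>k. (\<lambda>(\<tau>, \<omega>). \<Phi> \<tau> \<omega> (f k)) \<in> borel_measurable (predictable_algebra M F t)"
  shows "coords t \<Phi> \<in> borel_measurable pm"
  unfolding coords_def
proof (rule pm_measurableI)
  fix k
  show "(\<lambda>(\<tau>, \<omega>). indicat_real {0..t} \<tau> *\<^sub>R \<Phi> \<tau> \<omega> (f k)) \<in> borel_measurable TM"
    using predictable_extend_measurable[OF t \<Phi>[of k]] by simp
qed

lemma predictable_process_iff:
  fixes \<Phi> :: "real \<Rightarrow> 'w \<Rightarrow> 'u \<Rightarrow> 'h::{real_inner,banach,second_countable_topology}"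
  shows "predictable_process M F t (L20_borel Q) \<Phi> \<longleftrightarrow>
    (\<forall>\<tau>\<in>{0..t}. \<forall>\<omega>\<in>space M. \<Phi> \<tau> \<omega> \<in> L20 Q) \<and>
    (\<forall>k. (\<lambda>(\<tau>, \<omega>). \<Phi> \<tau> \<omega> (f k)) \<in> borel_measurable (predictable_algebra M F t))"
proof -
  have "(\<lambda>x. (case x of (\<tau>, \<omega>) \<Rightarrow> \<Phi> \<tau> \<omega>) (f k)) = (\<lambda>(\<tau>, \<omega>). \<Phi> \<tau> \<omega> (f k))" for k by auto
  thus ?thesis
    unfolding predictable_process_def measurable_L20_iff space_predictable by (auto simp: Pi_iff)
qed

lemma N2_iff:
  fixes \<Phi> :: "real \<Rightarrow> 'w \<Rightarrow> 'u \<Rightarrow> 'h::{real_inner,banach,second_countable_topology}"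
  assumes t: "0 \<le> t"
  shows "\<Phi> \<in> N2 M F Q t \<longleftrightarrow> predictable_process M F t (L20_borel Q) \<Phi> \<and> L2sq pm (coords t \<Phi>) < \<infinity>"
  unfolding N2_def
  using predictable_coords_measurable[OF t, of \<Phi>] N2_norm_sq_eq_L2sq[of t \<Phi>]
  by (auto simp: predictable_process_iff)

lemma N2_coords_measurable:
  fixes \<Phi> :: "real \<Rightarrow> 'w \<Rightarrow> 'u \<Rightarrow> 'h::{real_inner,banach,second_countable_topology}"
  assumes "0 \<le> t" "\<Phi> \<in> N2 M F Q t"
  shows "coords t \<Phi> \<in> borel_measurable pm"
  using assms by (intro predictable_coords_measurable) (auto simp: N2_iff predictable_process_iff)

section \<open>From elementary integrals to the stochastic integral\<close>

lemma elementary_data_atoms: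
  fixes \<xi> :: "nat \<Rightarrow> 'w \<Rightarrow> 'u \<Rightarrow> 'h::{real_inner,banach,second_countable_topology}"
  assumes "elementary_data M F Q t N r \<xi>"
  shows "atoms {..<N} r (\<lambda>m. r (Suc m)) \<xi>" "\<forall>m\<in>{..<N}. r (Suc m) \<le> t"
proof -
  have r: "r 0 = 0" "r N = t" "\<And>m. m < N \<Longrightarrow> r m < r (Suc m)"
    using assms by (auto simp: elementary_data_def)
  have mono: "r m \<le> r n" if "m \<le> n" "n \<le> N" for m n
    using that
  proof (induction n rule: dec_induct)
    case (step n)
    thus ?case using r(3)[of n] by simp
  qed simp
  show "atoms {..<N} r (\<lambda>m. r (Suc m)) \<xi>"
    using assms mono[of 0] r by (force simp: atoms_def elementary_data_def)
  show "\<forall>m\<in>{..<N}. r (Suc m) \<le> t" using mono[of _ N] r by auto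
qed

lemma elementary_process_eq:
  "elementary_process N r \<xi> = atom_process {..<N} r (\<lambda>m. r (Suc m)) \<xi>"
  by (simp add: elementary_process_def atom_process_def fun_eq_iff)

lemma has_elementary_integral_eq:
  "has_elementary_integral M K e \<beta> N r \<xi> Z \<longleftrightarrow>
    L2_limit M (\<lambda>n. atom_sum {..<N} r (\<lambda>m. r (Suc m)) \<xi> (K \<inter> {..<n})) Z"
  by (simp add: has_elementary_integral_def atom_sum_def[abs_def] incr_def)

lemma elementary_error_eq:
  fixes \<Phi> :: "real \<Rightarrow> 'w \<Rightarrow> 'u \<Rightarrow> 'h::{real_inner,banach,second_countable_topology}"
  assumes t: "0 \<le> t" and \<Phi>: "predictable_process M F t (L20_borel Q) \<Phi>"
    and el: "elementary_data M F Q t N r \<xi>"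
  shows "N2_norm_sq M Q t (\<lambda>\<tau> \<omega> u. elementary_process N r \<xi> \<tau> \<omega> u - \<Phi> \<tau> \<omega> u) =
    L2sq pm (\<lambda>p. coords t (elementary_process N r \<xi>) p - coords t \<Phi> p)"
proof -
  note at = elementary_data_atoms[OF el]
  have eq: "coords t (\<lambda>\<tau> \<omega> u. elementary_process N r \<xi> \<tau> \<omega> u - \<Phi> \<tau> \<omega> u) =
      (\<lambda>p. coords t (elementary_process N r \<xi>) p - coords t \<Phi> p)"
    by (auto simp: coords_def scaleR_diff_right)
  have [measurable]: "coords t (elementary_process N r \<xi>) \<in> borel_measurable pm"
    unfolding elementary_process_eq by (rule coords_atom_process_measurable[OF at])
  have [measurable]: "coords t \<Phi> \<in> borel_measurable pm"
    using \<Phi> by (intro predictable_coords_measurable[OF t]) (auto simp: predictable_process_iff)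
  show ?thesis
    unfolding eq[symmetric]
  proof (rule N2_norm_sq_eq_L2sq)
    show "(\<lambda>u. elementary_process N r \<xi> \<tau> \<omega> u - \<Phi> \<tau> \<omega> u) \<in> L20 Q" if "\<tau> \<in> {0..t}" "\<omega> \<in> space M" for \<tau> \<omega>
      using \<Phi> that atom_process_L20[OF at(1), of \<omega> \<tau>] unfolding elementary_process_eq
      by (intro L20_diff) (auto simp: predictable_process_iff)
    show "coords t (\<lambda>\<tau> \<omega> u. elementary_process N r \<xi> \<tau> \<omega> u - \<Phi> \<tau> \<omega> u) \<in> borel_measurable pm"
      unfolding eq by measurable
  qed
qed

text \<open>The two families are put side by side on the disjoint union of their index sets, the
  second with reversed sign. They form one family of atoms with horizon \<open>max t t'\<close>, to
  which the bound for a single limit applies; this takes the place of a common refinement.\<close>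

lemma atom_limit_diff_le:
  fixes \<xi> :: "'i \<Rightarrow> 'w \<Rightarrow> 'u \<Rightarrow> 'h::{real_inner,banach,second_countable_topology}" and \<xi>' :: "'j \<Rightarrow> 'w \<Rightarrow> 'u \<Rightarrow> 'h"
  assumes at: "atoms J s u \<xi>" "\<forall>j\<in>J. u j \<le> t" and at': "atoms J' s' u' \<xi>'" "\<forall>j\<in>J'. u' j \<le> t'"
    and Z: "L2_limit M (\<lambda>n. atom_sum J s u \<xi> (K \<inter> {..<n})) Z"
    and Z': "L2_limit M (\<lambda>n. atom_sum J' s' u' \<xi>' (K \<inter> {..<n})) Z'"
  shows "L2sq M (\<lambda>\<omega>. Z \<omega> - Z' \<omega>) \<le>
    2 * L2sq pm (\<lambda>p. coords t (atom_process J s u \<xi>) p - coords t' (atom_process J' s' u' \<xi>') p)"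
proof -
  define \<eta> where "\<eta> = case_sum \<xi> (\<lambda>j \<omega> x. - \<xi>' j \<omega> x)"
  let ?J = "J <+> J'" and ?s = "case_sum s s'" and ?u = "case_sum u u'"
  have fin: "finite J" "finite J'" using at at' by (auto simp: atoms_def)
  have neg: "simple_function (F (s' j)) (\<lambda>\<omega> x. - \<xi>' j \<omega> x)" "(\<lambda>\<omega> x. - \<xi>' j \<omega> x) ` space M \<subseteq> L20 Q"
    if "j \<in> J'" for j
    using at'(1) that simple_function_compose1[of "F (s' j)" "\<xi>' j" "\<lambda>\<Phi> x. - \<Phi> x"]
      L20_scaleR[of _ "-1"] by (auto simp: atoms_def)
  have a: "atoms ?J ?s ?u \<eta>"
    unfolding atoms_def
  proof (intro conjI ballI)
    fix j assume "j \<in> ?J"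
    hence "0 \<le> ?s j \<and> ?s j \<le> ?u j \<and> simple_function (F (?s j)) (\<eta> j) \<and> \<eta> j ` space M \<subseteq> L20 Q"
    proof
      fix i assume i: "j = Inl i" "i \<in> J"
      show ?thesis unfolding \<eta>_def i(1) sum.case using at(1) i(2) unfolding atoms_def by blast
    next
      fix i assume i: "j = Inr i" "i \<in> J'"
      show ?thesis unfolding \<eta>_def i(1) sum.case using at'(1) neg[OF i(2)] i(2) unfolding atoms_def by blast
    qed
    thus "0 \<le> ?s j" "?s j \<le> ?u j" "simple_function (F (?s j)) (\<eta> j)" "\<eta> j ` space M \<subseteq> L20 Q" by blast+
  qed (use fin in simp)
  have u: "\<forall>j\<in>?J. ?u j \<le> max t t'" using at(2) at'(2) by auto
  have sum: "atom_sum ?J ?s ?u \<eta> A = (\<lambda>\<omega>. atom_sum J s u \<xi> A \<omega> - atom_sum J' s' u' \<xi>' A \<omega>)" for A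
    by (simp add: atom_sum_def[abs_def] sum.Plus[OF fin] \<eta>_def sum_negf)
  have proc: "atom_process ?J ?s ?u \<eta> \<tau> \<omega> x = atom_process J s u \<xi> \<tau> \<omega> x - atom_process J' s' u' \<xi>' \<tau> \<omega> x" for \<tau> \<omega> x
    by (simp add: atom_process_def sum.Plus[OF fin] \<eta>_def sum_negf)
  have lim: "L2_limit M (\<lambda>n. atom_sum ?J ?s ?u \<eta> (K \<inter> {..<n})) (\<lambda>\<omega>. Z \<omega> - Z' \<omega>)"
    unfolding sum by (rule L2_limit_diff[OF Z Z']) (auto intro!: atom_sum_measurable_M at(1) at'(1))
  have eq: "coords (max t t') (atom_process ?J ?s ?u \<eta>) =
      (\<lambda>p. coords t (atom_process J s u \<xi>) p - coords t' (atom_process J' s' u' \<xi>') p)"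
    unfolding coords_atom_process[OF a u] coords_atom_process[OF at] coords_atom_process[OF at']
    by (auto simp: proc)
  show ?thesis using atom_limit_le[OF a u lim] unfolding eq .
qed

lemma has_stochastic_integralE:
  fixes \<Phi> :: "real \<Rightarrow> 'w \<Rightarrow> 'u \<Rightarrow> 'h::{real_inner,banach,second_countable_topology}"
  assumes t: "0 \<le> t" and Y: "has_stochastic_integral M F Q K e \<beta> \<Phi> t Y"
  obtains N r \<xi> Z where "\<And>n. atoms {..<N n} (r n) (\<lambda>m. r n (Suc m)) (\<xi> n)"
    "\<And>n. \<forall>m\<in>{..<N n}. r n (Suc m) \<le> t"
    "\<And>n. L2_limit M (\<lambda>i. atom_sum {..<N n} (r n) (\<lambda>m. r n (Suc m)) (\<xi> n) (K \<inter> {..<i})) (Z n)"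
    "(\<lambda>n. L2sq pm (\<lambda>p. coords t (atom_process {..<N n} (r n) (\<lambda>m. r n (Suc m)) (\<xi> n)) p - coords t \<Phi> p)) \<longlonglongrightarrow> 0"
    "L2_limit M Z Y"
proof -
  obtain N r \<xi> Z where *: "\<And>n. elementary_data M F Q t (N n) (r n) (\<xi> n)"
      "\<And>n. has_elementary_integral M K e \<beta> (N n) (r n) (\<xi> n) (Z n)"
      "(\<lambda>n. N2_norm_sq M Q t (\<lambda>\<tau> \<omega> u. elementary_process (N n) (r n) (\<xi> n) \<tau> \<omega> u - \<Phi> \<tau> \<omega> u)) \<longlonglongrightarrow> 0"
      "L2_limit M Z Y" and \<Phi>: "\<Phi> \<in> N2 M F Q t"
    using Y unfolding has_stochastic_integral_def by blast
  have pr: "predictable_process M F t (L20_borel Q) \<Phi>" using \<Phi> by (simp add: N2_iff t)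
  show thesis
    by (rule that[OF elementary_data_atoms[OF *(1)] *(2)[unfolded has_elementary_integral_eq] _ *(4)])
      (rule *(3)[unfolded elementary_error_eq[OF t pr *(1)], unfolded elementary_process_eq])
qed

text \<open>One estimate gives both the uniqueness of the integral and the mean square continuity of the
  convolution; the constant is not sharp.\<close>

lemma stochastic_integral_diff_le:
  fixes \<Phi> \<Phi>' :: "real \<Rightarrow> 'w \<Rightarrow> 'u \<Rightarrow> 'h::{real_inner,banach,second_countable_topology}"
  assumes t: "0 \<le> t" "has_stochastic_integral M F Q K e \<beta> \<Phi> t Y"
    and t': "0 \<le> t'" "has_stochastic_integral M F Q K e \<beta> \<Phi>' t' Y'"
  shows "L2sq M (\<lambda>\<omega>. Y \<omega> - Y' \<omega>) \<le> 16 * L2sq pm (\<lambda>p. coords t \<Phi> p - coords t' \<Phi>' p)"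
proof -
  obtain N r \<xi> Z where a: "\<And>n. atoms {..<N n} (r n) (\<lambda>m. r n (Suc m)) (\<xi> n)"
    "\<And>n. \<forall>m\<in>{..<N n}. r n (Suc m) \<le> t"
    "\<And>n. L2_limit M (\<lambda>i. atom_sum {..<N n} (r n) (\<lambda>m. r n (Suc m)) (\<xi> n) (K \<inter> {..<i})) (Z n)"
    "(\<lambda>n. L2sq pm (\<lambda>p. coords t (atom_process {..<N n} (r n) (\<lambda>m. r n (Suc m)) (\<xi> n)) p - coords t \<Phi> p)) \<longlonglongrightarrow> 0"
    "L2_limit M Z Y"
    by (rule has_stochastic_integralE[OF t]) (rule that)
  obtain N' r' \<xi>' Z' where b: "\<And>n. atoms {..<N' n} (r' n) (\<lambda>m. r' n (Suc m)) (\<xi>' n)"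
    "\<And>n. \<forall>m\<in>{..<N' n}. r' n (Suc m) \<le> t'"
    "\<And>n. L2_limit M (\<lambda>i. atom_sum {..<N' n} (r' n) (\<lambda>m. r' n (Suc m)) (\<xi>' n) (K \<inter> {..<i})) (Z' n)"
    "(\<lambda>n. L2sq pm (\<lambda>p. coords t' (atom_process {..<N' n} (r' n) (\<lambda>m. r' n (Suc m)) (\<xi>' n)) p - coords t' \<Phi>' p)) \<longlonglongrightarrow> 0"
    "L2_limit M Z' Y'"
    by (rule has_stochastic_integralE[OF t']) (rule that)
  define c where "c n = coords t (atom_process {..<N n} (r n) (\<lambda>m. r n (Suc m)) (\<xi> n))" for n
  define c' where "c' n = coords t' (atom_process {..<N' n} (r' n) (\<lambda>m. r' n (Suc m)) (\<xi>' n))" for n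
  have [measurable]: "c n \<in> borel_measurable pm" "c' n \<in> borel_measurable pm" for n
    unfolding c_def c'_def using a b by (auto intro!: coords_atom_process_measurable)
  have "\<Phi> \<in> N2 M F Q t" "\<Phi>' \<in> N2 M F Q t'" using t t' by (auto simp: has_stochastic_integral_def)
  hence [measurable]: "coords t \<Phi> \<in> borel_measurable pm" "coords t' \<Phi>' \<in> borel_measurable pm"
    using t t' by (auto intro: N2_coords_measurable)
  have Zm[measurable]: "Z n \<in> borel_measurable M" "Z' n \<in> borel_measurable M" for n
    using a(3) b(3) by (auto simp: L2_limit_def')
  have [measurable]: "Y \<in> borel_measurable M" "Y' \<in> borel_measurable M"
    using a(5) b(5) by (auto simp: L2_limit_def')
  let ?D = "L2sq pm (\<lambda>p. coords t \<Phi> p - coords t' \<Phi>' p)"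
  let ?a = "\<lambda>n. L2sq pm (\<lambda>p. c n p - coords t \<Phi> p)" and ?b = "\<lambda>n. L2sq pm (\<lambda>p. c' n p - coords t' \<Phi>' p)"
  let ?z = "\<lambda>n. L2sq M (\<lambda>\<omega>. (Z n \<omega> - Z' n \<omega>) - (Y \<omega> - Y' \<omega>))"
  \<comment> \<open>The path from \<open>c n\<close> to \<open>c' n\<close> runs through
    \<open>coords t \<Phi>\<close> and \<open>coords t' \<Phi>'\<close>; each triangle inequality
    doubles what remains, which gives \<open>8 * ?D\<close> here and \<open>16 * ?D\<close> after
    one more in \<open>le\<close>.\<close>
  have zz: "L2sq M (\<lambda>\<omega>. Z n \<omega> - Z' n \<omega>) \<le> 4 * ?a n + (8 * ?D + 8 * ?b n)" for n
  proof -
    have "L2sq M (\<lambda>\<omega>. Z n \<omega> - Z' n \<omega>) \<le> 2 * L2sq pm (\<lambda>p. c n p - c' n p)"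
      unfolding c_def c'_def by (rule atom_limit_diff_le[OF a(1,2) b(1,2) a(3) b(3)])
    also have "\<dots> \<le> 2 * (2 * ?a n + 2 * (2 * ?D + 2 * L2sq pm (\<lambda>p. coords t' \<Phi>' p - c' n p)))"
      by (intro mult_left_mono order_trans[OF L2sq_triangle[of "c n" _ "coords t \<Phi>" "c' n"]] add_mono
        L2sq_triangle order_refl) auto
    also have "\<dots> = 4 * ?a n + (8 * ?D + 8 * ?b n)"
      unfolding L2sq_minus_commute[of pm "coords t' \<Phi>'" "c' n"]
      by (simp add: distrib_left mult.assoc[symmetric])
    finally show ?thesis .
  qed
  have le: "L2sq M (\<lambda>\<omega>. Y \<omega> - Y' \<omega>) \<le> 2 * ?z n + (8 * ?a n + (16 * ?D + 16 * ?b n))" for n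
  proof -
    have "L2sq M (\<lambda>\<omega>. (Y \<omega> - Y' \<omega>) - (Z n \<omega> - Z' n \<omega>) + (Z n \<omega> - Z' n \<omega>)) \<le>
        2 * L2sq M (\<lambda>\<omega>. (Y \<omega> - Y' \<omega>) - (Z n \<omega> - Z' n \<omega>)) + 2 * L2sq M (\<lambda>\<omega>. Z n \<omega> - Z' n \<omega>)"
      by (rule L2sq_add) measurable
    also have "\<dots> \<le> 2 * L2sq M (\<lambda>\<omega>. (Y \<omega> - Y' \<omega>) - (Z n \<omega> - Z' n \<omega>)) + 2 * (4 * ?a n + (8 * ?D + 8 * ?b n))"
      by (intro add_mono mult_left_mono zz order_refl) auto
    also have "\<dots> = 2 * ?z n + (8 * ?a n + (16 * ?D + 16 * ?b n))"
      unfolding L2sq_minus_commute[of M "\<lambda>\<omega>. Y \<omega> - Y' \<omega>"]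
      by (simp add: distrib_left mult.assoc[symmetric])
    finally show ?thesis by simp
  qed
  have "(\<lambda>n. 2 * ?z n + (8 * ?a n + (16 * ?D + 16 * ?b n))) \<longlonglongrightarrow> 2 * 0 + (8 * 0 + (16 * ?D + 16 * 0))"
    using L2_limit_diff[OF a(5) b(5)] a(4) b(4) unfolding c_def c'_def
    by (intro tendsto_add tendsto_const ennreal_tendsto_cmult) (auto simp: L2_limit_def')
  hence "(\<lambda>n. 2 * ?z n + (8 * ?a n + (16 * ?D + 16 * ?b n))) \<longlonglongrightarrow> 16 * ?D" by simp
  thus ?thesis by (rule LIMSEQ_le_const) (use le in blast)
qed

lemma stochastic_integral_unique:
  fixes \<Phi> :: "real \<Rightarrow> 'w \<Rightarrow> 'u \<Rightarrow> 'h::{real_inner,banach,second_countable_topology}"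
  assumes "0 \<le> t" "has_stochastic_integral M F Q K e \<beta> \<Phi> t Y" "has_stochastic_integral M F Q K e \<beta> \<Phi> t Y'"
  shows "AE \<omega> in M. Y \<omega> = Y' \<omega>"
proof -
  have m[measurable]: "Y \<in> borel_measurable M" "Y' \<in> borel_measurable M"
    using assms by (auto simp: has_stochastic_integral_def L2_limit_def')
  have "L2sq M (\<lambda>\<omega>. Y \<omega> - Y' \<omega>) \<le> 16 * L2sq pm (\<lambda>p. coords t \<Phi> p - coords t \<Phi> p)"
    by (rule stochastic_integral_diff_le) (use assms in auto)
  hence "(\<integral>\<^sup>+\<omega>. ennreal ((norm (Y \<omega> - Y' \<omega>))\<^sup>2) \<partial>M) = 0" by (simp add: L2sq_def)
  hence "AE \<omega> in M. ennreal ((norm (Y \<omega> - Y' \<omega>))\<^sup>2) = 0" by (subst (asm) nn_integral_0_iff_AE) auto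
  thus ?thesis by eventually_elim simp
qed

text \<open>Extension of the isometry: the approximating processes are Cauchy, hence so are their
  integrals, each taken measurable for \<open>F t\<close>. \<open>L2_complete\<close> hands this
  measurability to the limit.\<close>

lemma stochastic_integral_from_approximation:
  fixes \<Phi> :: "real \<Rightarrow> 'w \<Rightarrow> 'u \<Rightarrow> 'h::{real_inner,banach,second_countable_topology}"
  assumes t: "0 \<le> t" and \<Phi>: "\<Phi> \<in> N2 M F Q t"
    and app: "\<And>\<epsilon>::real. 0 < \<epsilon> \<Longrightarrow> \<exists>N r \<xi>. elementary_data M F Q t N r \<xi> \<and>
      N2_norm_sq M Q t (\<lambda>\<tau> \<omega> u. elementary_process N r \<xi> \<tau> \<omega> u - \<Phi> \<tau> \<omega> u) \<le> ennreal \<epsilon>"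
  obtains Y where "Y \<in> borel_measurable (F t)" "has_stochastic_integral M F Q K e \<beta> \<Phi> t Y"
proof -
  have "\<forall>n. \<exists>N r \<xi>. elementary_data M F Q t N r \<xi> \<and>
      N2_norm_sq M Q t (\<lambda>\<tau> \<omega> u. elementary_process N r \<xi> \<tau> \<omega> u - \<Phi> \<tau> \<omega> u) \<le> ennreal (1 / real (Suc n))"
    using app by simp
  then obtain N r \<xi> where el: "\<And>n. elementary_data M F Q t (N n) (r n) (\<xi> n)"
    and err: "\<And>n. N2_norm_sq M Q t (\<lambda>\<tau> \<omega> u. elementary_process (N n) (r n) (\<xi> n) \<tau> \<omega> u - \<Phi> \<tau> \<omega> u) \<le> ennreal (1 / real (Suc n))"
    unfolding choice_iff by blast
  have pr: "predictable_process M F t (L20_borel Q) \<Phi>" and fin: "L2sq pm (coords t \<Phi>) < \<infinity>"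
    using \<Phi> by (auto simp: N2_iff t)
  note at = elementary_data_atoms[OF el]
  define c where "c n = coords t (atom_process {..<N n} (r n) (\<lambda>m. r n (Suc m)) (\<xi> n))" for n
  have [measurable]: "c n \<in> borel_measurable pm" for n
    unfolding c_def by (rule coords_atom_process_measurable[OF at])
  have [measurable]: "coords t \<Phi> \<in> borel_measurable pm" by (rule N2_coords_measurable[OF t \<Phi>])
  have err': "L2sq pm (\<lambda>p. c n p - coords t \<Phi> p) \<le> ennreal (1 / real (Suc n))" for n
    unfolding c_def by (rule err[of n, unfolded elementary_error_eq[OF t pr el], unfolded elementary_process_eq])
  have cfin: "L2sq pm (c n) < \<infinity>" for n
  proof -
    have "L2sq pm (\<lambda>p. (c n p - coords t \<Phi> p) + coords t \<Phi> p) \<le> 2 * L2sq pm (\<lambda>p. c n p - coords t \<Phi> p) + 2 * L2sq pm (coords t \<Phi>)"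
      by (rule L2sq_add) measurable
    also have "L2sq pm (\<lambda>p. c n p - coords t \<Phi> p) < \<infinity>" by (rule le_less_trans[OF err']) simp
    hence "2 * L2sq pm (\<lambda>p. c n p - coords t \<Phi> p) + 2 * L2sq pm (coords t \<Phi>) < \<infinity>"
      using fin by (simp add: ennreal_mult_less_top)
    finally show ?thesis by simp
  qed
  have "\<exists>Z. Z \<in> borel_measurable (F t) \<and> L2_limit M (\<lambda>i. atom_sum {..<N n} (r n) (\<lambda>m. r n (Suc m)) (\<xi> n) (K \<inter> {..<i})) Z" for n
    using atom_limit_exists[OF at(1) t at(2) cfin[unfolded c_def]] by metis
  then obtain Z where Z: "\<And>n. Z n \<in> borel_measurable (F t)"
    "\<And>n. L2_limit M (\<lambda>i. atom_sum {..<N n} (r n) (\<lambda>m. r n (Suc m)) (\<xi> n) (K \<inter> {..<i})) (Z n)"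
    by metis
  have cauchy: "\<exists>i0. \<forall>m\<ge>i0. \<forall>n\<ge>i0. L2sq M (\<lambda>\<omega>. Z m \<omega> - Z n \<omega>) \<le> ennreal \<epsilon>" if \<epsilon>: "0 < \<epsilon>" for \<epsilon> :: real
  proof -
    \<comment> \<open>From \<open>i0\<close> on, each of the two errors
      \<open>4 * (1 / real (Suc n))\<close> is at most \<open>\<epsilon> / 2\<close>.\<close>
    obtain i0 where "8 / \<epsilon> < real i0" using reals_Archimedean2 by blast
    hence i0: "8 < real i0 * \<epsilon>" using \<epsilon> by (simp add: field_simps)
    have "L2sq M (\<lambda>\<omega>. Z m \<omega> - Z n \<omega>) \<le> ennreal \<epsilon>" if mn: "i0 \<le> m" "i0 \<le> n" for m n
    proof -
      have "L2sq M (\<lambda>\<omega>. Z m \<omega> - Z n \<omega>) \<le> 2 * L2sq pm (\<lambda>p. c m p - c n p)"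
        unfolding c_def by (rule atom_limit_diff_le[OF at at Z(2) Z(2)])
      also have "\<dots> \<le> 2 * (2 * L2sq pm (\<lambda>p. c m p - coords t \<Phi> p) + 2 * L2sq pm (\<lambda>p. coords t \<Phi> p - c n p))"
        by (intro mult_left_mono L2sq_triangle) auto
      also have "\<dots> \<le> 2 * (2 * ennreal (1 / real (Suc m)) + 2 * ennreal (1 / real (Suc n)))"
        using err' unfolding L2sq_minus_commute[of pm "coords t \<Phi>" "c n"]
        by (intro mult_left_mono add_mono) auto
      also have "\<dots> = ennreal (4 * (1 / real (Suc m)) + 4 * (1 / real (Suc n)))"
      proof -
        have "2 * (2 * ennreal x + 2 * ennreal y) = ennreal (4 * x + 4 * y)" if "0 \<le> x" "0 \<le> y" for x y
          using that by (simp add: distrib_left mult.assoc[symmetric] ennreal_plus ennreal_mult)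
        thus ?thesis by simp
      qed
      also have "\<dots> \<le> ennreal \<epsilon>"
      proof (rule ennreal_leI)
        have "4 * (1 / real (Suc n)) \<le> \<epsilon> / 2" if "i0 \<le> n" for n
        proof -
          have "8 < real (Suc n) * \<epsilon>" using i0 that \<epsilon>
            by (meson less_le_trans mult_right_mono of_nat_le_iff le_SucI less_imp_le)
          thus ?thesis by (simp add: field_simps)
        qed
        from this[OF mn(1)] this[OF mn(2)]
        show "4 * (1 / real (Suc m)) + 4 * (1 / real (Suc n)) \<le> \<epsilon>" by linarith
      qed
      finally show ?thesis .
    qed
    thus ?thesis by blast
  qed
  have Z_fin: "L2sq M (Z n) < \<infinity>" for n using Z(2)[of n] by (simp add: L2_limit_def')
  obtain Y where Y: "Y \<in> borel_measurable (F t)" "L2_limit M Z Y"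
    by (rule L2_complete[OF subalg[OF t], of Z], rule Z(1), rule Z_fin, rule cauchy, assumption, rule that)
  have lim: "(\<lambda>n. N2_norm_sq M Q t (\<lambda>\<tau> \<omega> u. elementary_process (N n) (r n) (\<xi> n) \<tau> \<omega> u - \<Phi> \<tau> \<omega> u)) \<longlonglongrightarrow> 0"
  proof (rule tendsto_sandwich[OF _ _ tendsto_const])
    show "(\<lambda>n. ennreal (1 / real (Suc n))) \<longlonglongrightarrow> 0"
      using tendsto_ennrealI[OF LIMSEQ_Suc[OF lim_1_over_n]] by simp
  qed (use err in \<open>auto intro: always_eventually\<close>)
  have "has_stochastic_integral M F Q K e \<beta> \<Phi> t Y"
    unfolding has_stochastic_integral_def
    using \<Phi> el Z(2)[folded has_elementary_integral_eq] lim Y(2) by blast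
  with Y(1) show thesis by (rule that)
qed

end

section \<open>Density of elementary processes\<close>

lemma L2sq_dominated_convergence:
  fixes c :: "nat \<Rightarrow> 'x \<Rightarrow> 'b::{real_normed_vector,second_countable_topology}" and w :: "'x \<Rightarrow> real"
  assumes [measurable]: "\<And>n. c n \<in> borel_measurable M" "w \<in> borel_measurable M"
    and w: "L2sq M w < \<infinity>" and le: "\<And>n x. x \<in> space M \<Longrightarrow> norm (c n x) \<le> w x"
    and lim: "AE x in M. (\<lambda>n. c n x) \<longlonglongrightarrow> 0"
  shows "(\<lambda>n. L2sq M (c n)) \<longlonglongrightarrow> 0"
proof -
  have "(\<lambda>n. \<integral>\<^sup>+x. ennreal ((norm (c n x))\<^sup>2) \<partial>M) \<longlonglongrightarrow> (\<integral>\<^sup>+x. 0 \<partial>M)"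
  proof (rule nn_integral_dominated_convergence[where w="\<lambda>x. ennreal ((w x)\<^sup>2)"])
    show "(\<integral>\<^sup>+x. ennreal ((w x)\<^sup>2) \<partial>M) < \<infinity>" using w by (simp add: L2sq_def)
    show "AE x in M. ennreal ((norm (c n x))\<^sup>2) \<le> ennreal ((w x)\<^sup>2)" for n
      using le by (intro AE_I2 ennreal_leI power_mono) auto
    show "AE x in M. (\<lambda>n. ennreal ((norm (c n x))\<^sup>2)) \<longlonglongrightarrow> 0"
      using lim
    proof eventually_elim
      case (elim x)
      hence "(\<lambda>n. ennreal ((norm (c n x))\<^sup>2)) \<longlonglongrightarrow> ennreal ((norm (0::'b))\<^sup>2)"
        by (intro tendsto_ennrealI tendsto_intros)
      thus ?case by simp
    qed
  qed simp_all
  thus ?thesis by (simp add: L2sq_def)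
qed

section \<open>Uniform grids and approximation of predictable sets\<close>

definition grid :: "real \<Rightarrow> nat \<Rightarrow> nat \<Rightarrow> real" where
  "grid t N m = t * real m / real N"

lemma grid_Suc: "grid t N (Suc m) = grid t N m + t / real N"
  by (simp add: grid_def algebra_simps add_divide_distrib)

lemma grid_mono: "0 \<le> t \<Longrightarrow> m \<le> n \<Longrightarrow> grid t N m \<le> grid t N n"
  unfolding grid_def by (intro divide_right_mono mult_left_mono) auto

lemma grid_nonneg: "0 \<le> t \<Longrightarrow> 0 \<le> grid t N m"
  by (simp add: grid_def)

text \<open>The right end of the cell is the first grid point not below \<open>\<tau>\<close>; it
  has a predecessor because \<open>\<tau>\<close> is positive.\<close>

lemma grid_cell_exists:
  assumes "0 < t" "0 < N" "0 < \<tau>" "\<tau> \<le> t"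
  obtains m where "m < N" "\<tau> \<in> {grid t N m<..grid t N (Suc m)}"
proof -
  let ?P = "\<lambda>n. \<tau> \<le> grid t N n"
  have N: "?P N" using assms by (simp add: grid_def)
  define n where "n = (LEAST n. ?P n)"
  have n: "?P n" "n \<le> N" unfolding n_def using LeastI[of ?P, OF N] Least_le[of ?P, OF N] by auto
  have "n \<noteq> 0" using n(1) assms by (intro notI) (simp add: grid_def)
  then obtain m where m: "n = Suc m" using not0_implies_Suc by blast
  have "\<not> ?P m" using not_less_Least[of m ?P] m by (simp add: n_def)
  with m n show thesis by (intro that[of m]) auto
qed

lemma grid_cell_unique:
  assumes "0 \<le> t" "\<tau> \<in> {grid t N m<..grid t N (Suc m)}" "\<tau> \<in> {grid t N n<..grid t N (Suc n)}"
  shows "m = n"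
proof (rule ccontr)
  assume "m \<noteq> n"
  hence "Suc m \<le> n \<or> Suc n \<le> m" by auto
  thus False using grid_mono[OF assms(1), of "Suc m" n N] grid_mono[OF assms(1), of "Suc n" m N] assms(2,3) by auto
qed

definition sym_difference :: "'a set \<Rightarrow> 'a set \<Rightarrow> 'a set" where
  "sym_difference A B = (A - B) \<union> (B - A)"

context wiener_setting
begin

definition grid_set :: "real \<Rightarrow> nat \<Rightarrow> (nat \<Rightarrow> 'w set) \<Rightarrow> (real \<times> 'w) set" where
  "grid_set t N A = (\<Union>m<N. {grid t N m<..grid t N (Suc m)} \<times> A m)"

definition grid_adapted :: "real \<Rightarrow> nat \<Rightarrow> (nat \<Rightarrow> 'w set) \<Rightarrow> bool" where
  "grid_adapted t N A \<longleftrightarrow> (\<forall>m<N. A m \<in> sets (F (grid t N m)))"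

lemma grid_set_measurable:
  assumes "0 \<le> t" "grid_adapted t N A"
  shows "grid_set t N A \<in> sets TM"
  unfolding grid_set_def
proof (intro sets.finite_UN finite_lessThan)
  fix m assume "m \<in> {..<N}"
  hence "A m \<in> sets M"
    using assms sets_F_M[OF grid_nonneg[OF assms(1), of N m]] by (auto simp: grid_adapted_def)
  thus "{grid t N m<..grid t N (Suc m)} \<times> A m \<in> sets TM" by simp
qed

text \<open>Asking for an approximation along all large \<open>N\<close> lets finitely many sets (and, below, processes)
  be approximated on one common partition, so that no common refinements are needed.\<close>

definition grid_approximable :: "real \<Rightarrow> (real \<times> 'w) set \<Rightarrow> bool" where
  "grid_approximable t B \<longleftrightarrow> (\<forall>\<epsilon>>0. \<forall>\<^sub>F N in sequentially. \<exists>A. grid_adapted t N A \<and>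
     emeasure TM (sym_difference B (grid_set t N A)) \<le> ennreal \<epsilon>)"

lemma emeasure_Times: "I \<in> sets lborel \<Longrightarrow> A \<in> sets M \<Longrightarrow>
    emeasure TM (I \<times> A) = emeasure lborel I * emeasure M A"
  by (rule emeasure_pair_measure_Times)

text \<open>A cell is used when its left endpoint lies between \<open>s\<close> (included) and
  \<open>u\<close> (excluded). Then \<open>A0\<close> already belongs to the filtration at that
  endpoint, and errors are confined to one mesh width after \<open>s\<close> and one after
  \<open>u\<close>.\<close>

lemma grid_approximable_rectangle:
  assumes t: "0 < t" and su: "0 \<le> s" "s < u" "u \<le> t" and A0: "A0 \<in> sets (F s)"
  shows "grid_approximable t ({s<..u} \<times> A0)"
  unfolding grid_approximable_def
proof (intro allI impI)
  fix \<epsilon> :: real assume \<epsilon>: "0 < \<epsilon>"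
  \<comment> \<open>Makes twice the mesh at most \<open>\<epsilon>\<close>, to pay for the strips
    after \<open>s\<close> and after \<open>u\<close>.\<close>
  obtain N0 :: nat where N0: "2 * t / \<epsilon> < real N0" using reals_Archimedean2 by blast
  show "\<forall>\<^sub>F N in sequentially. \<exists>A. grid_adapted t N A \<and>
      emeasure TM (sym_difference ({s<..u} \<times> A0) (grid_set t N A)) \<le> ennreal \<epsilon>"
    using eventually_ge_at_top[of "Suc N0"]
  proof eventually_elim
    case (elim N)
    hence N: "0 < N" "2 * t / \<epsilon> < real N" using N0 by auto
    define \<delta> where "\<delta> = t / real N"
    have \<delta>: "0 < \<delta>" "2 * \<delta> \<le> \<epsilon>" using N t \<epsilon> by (auto simp: \<delta>_def field_simps)
    define A where "A m = (if s \<le> grid t N m \<and> grid t N m < u then A0 else {})" for m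
    have ad: "grid_adapted t N A"
      unfolding grid_adapted_def A_def using A0 sets_F_mono[OF su(1)] by auto
    have "sym_difference ({s<..u} \<times> A0) (grid_set t N A) \<subseteq> ({s..s+\<delta>} \<union> {u..u+\<delta>}) \<times> space M"
    proof
      fix p assume p: "p \<in> sym_difference ({s<..u} \<times> A0) (grid_set t N A)"
      obtain \<tau> \<omega> where [simp]: "p = (\<tau>, \<omega>)" by force
      have A0': "A0 \<subseteq> space M" using sets.sets_into_space[OF A0] space_F[OF su(1)] by simp
      from p consider "p \<in> {s<..u} \<times> A0" "p \<notin> grid_set t N A" | "p \<notin> {s<..u} \<times> A0" "p \<in> grid_set t N A"
        by (auto simp: sym_difference_def)
      thus "p \<in> ({s..s+\<delta>} \<union> {u..u+\<delta>}) \<times> space M"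
      proof cases
        case 1
        hence \<tau>: "s < \<tau>" "\<tau> \<le> u" "\<omega> \<in> A0" by auto
        obtain m where m: "m < N" "\<tau> \<in> {grid t N m<..grid t N (Suc m)}"
          using grid_cell_exists[OF t N(1), of \<tau>] \<tau> su by auto
        have "\<not> (s \<le> grid t N m)"
        proof
          assume "s \<le> grid t N m"
          hence "\<omega> \<in> A m" using \<tau> m by (simp add: A_def)
          hence "p \<in> grid_set t N A" using m by (auto simp: grid_set_def)
          with 1 show False by simp
        qed
        thus ?thesis using m(2) \<tau> A0' by (auto simp: grid_Suc \<delta>_def[symmetric])
      next
        case 2
        then obtain m where m: "m < N" "\<tau> \<in> {grid t N m<..grid t N (Suc m)}" "\<omega> \<in> A m"
          by (auto simp: grid_set_def)
        hence "s \<le> grid t N m" "grid t N m < u" "\<omega> \<in> A0" by (auto simp: A_def split: if_splits)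
        thus ?thesis using 2(1) m(2) A0' by (auto simp: grid_Suc \<delta>_def[symmetric])
      qed
    qed
    hence "emeasure TM (sym_difference ({s<..u} \<times> A0) (grid_set t N A)) \<le>
        emeasure TM (({s..s+\<delta>} \<union> {u..u+\<delta>}) \<times> space M)"
      by (rule emeasure_mono) simp
    also have "\<dots> = emeasure lborel ({s..s+\<delta>} \<union> {u..u+\<delta>})"
      by (subst emeasure_Times) (auto simp: emeasure_space_1)
    also have "\<dots> \<le> emeasure lborel {s..s+\<delta>} + emeasure lborel {u..u+\<delta>}"
      by (rule emeasure_subadditive) auto
    also have "\<dots> = ennreal (2 * \<delta>)" using \<delta> by (simp flip: ennreal_plus)
    also have "\<dots> \<le> ennreal \<epsilon>" using \<delta> by (intro ennreal_leI)
    finally show ?case using ad by blast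
  qed
qed

lemma grid_approximable_null:
  assumes "B \<in> null_sets TM" "0 \<le> t"
  shows "grid_approximable t B"
  unfolding grid_approximable_def
proof (intro allI impI always_eventually exI conjI)
  fix \<epsilon> :: real and N :: nat
  show "grid_adapted t N (\<lambda>_. {})" by (simp add: grid_adapted_def)
  show "emeasure TM (sym_difference B (grid_set t N (\<lambda>_. {}))) \<le> ennreal \<epsilon>"
    using assms by (simp add: sym_difference_def grid_set_def null_sets_def)
qed

lemma null_set_0: "A \<in> sets M \<Longrightarrow> {0} \<times> A \<in> null_sets TM"
  by (auto simp: null_sets_def emeasure_Times)

text \<open>Complementing cell by cell preserves adaptedness. The cells do not cover time 0, so the
  new error exceeds the old one by a null set.\<close>

lemma grid_approximable_compl:
  assumes t: "0 < t" and B: "B \<in> sets (predictable_algebra M F t)" and app: "grid_approximable t B"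
  shows "grid_approximable t ({0..t} \<times> space M - B)"
  unfolding grid_approximable_def
proof (intro allI impI)
  fix \<epsilon> :: real assume \<epsilon>: "0 < \<epsilon>"
  have Bm: "B \<in> sets TM" using B predictable_subset_product[of t] t by auto
  show "\<forall>\<^sub>F N in sequentially. \<exists>A. grid_adapted t N A \<and>
      emeasure TM (sym_difference ({0..t} \<times> space M - B) (grid_set t N A)) \<le> ennreal \<epsilon>"
    using app[unfolded grid_approximable_def, rule_format, OF \<epsilon>] eventually_ge_at_top[of 1]
  proof eventually_elim
    case (elim N)
    then obtain A where A: "grid_adapted t N A"
      "emeasure TM (sym_difference B (grid_set t N A)) \<le> ennreal \<epsilon>" by blast
    let ?A = "\<lambda>m. space M - A m"
    have "?A m \<in> sets (F (grid t N m))" if "m < N" for m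
      using A(1) that t sets.compl_sets[of "A m" "F (grid t N m)"] grid_nonneg[of t N m]
      by (auto simp: grid_adapted_def space_F)
    hence ad: "grid_adapted t N ?A" by (simp add: grid_adapted_def)
    have "sym_difference ({0..t} \<times> space M - B) (grid_set t N ?A) \<subseteq>
        sym_difference B (grid_set t N A) \<union> {0} \<times> space M"
    proof
      fix p assume p: "p \<in> sym_difference ({0..t} \<times> space M - B) (grid_set t N ?A)"
      obtain \<tau> \<omega> where [simp]: "p = (\<tau>, \<omega>)" by force
      from p consider "p \<in> {0..t} \<times> space M" "p \<notin> B" "p \<notin> grid_set t N ?A" | "p \<notin> {0..t} \<times> space M - B" "p \<in> grid_set t N ?A"
        by (auto simp: sym_difference_def)
      thus "p \<in> sym_difference B (grid_set t N A) \<union> {0} \<times> space M"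
      proof cases
        case 1
        show ?thesis
        proof (cases "\<tau> = 0")
          case False
          hence "0 < \<tau>" "\<tau> \<le> t" using 1 by auto
          then obtain m where m: "m < N" "\<tau> \<in> {grid t N m<..grid t N (Suc m)}"
            using grid_cell_exists[OF t, of N \<tau>] elim by auto
          have "\<omega> \<in> A m" using 1 m by (auto simp: grid_set_def)
          hence "p \<in> grid_set t N A" using m by (auto simp: grid_set_def)
          thus ?thesis using 1 by (auto simp: sym_difference_def)
        qed (use 1 in auto)
      next
        case 2
        then obtain m where m: "m < N" "\<tau> \<in> {grid t N m<..grid t N (Suc m)}" "\<omega> \<in> space M - A m"
          by (auto simp: grid_set_def)
        have "grid t N (Suc m) \<le> grid t N N" by (rule grid_mono) (use t m in auto)
        also have "\<dots> = t" using elim by (simp add: grid_def)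
        finally have "\<tau> \<in> {0..t}" using m(2) grid_nonneg[of t N m] t by auto
        hence "p \<in> B" using 2(1) m(3) by auto
        moreover have "p \<notin> grid_set t N A"
        proof
          assume "p \<in> grid_set t N A"
          then obtain n where n: "n < N" "\<tau> \<in> {grid t N n<..grid t N (Suc n)}" "\<omega> \<in> A n" by (auto simp: grid_set_def)
          have "m = n" by (rule grid_cell_unique[OF _ m(2) n(2)]) (use t in simp)
          with m n show False by simp
        qed
        ultimately show ?thesis by (auto simp: sym_difference_def)
      qed
    qed
    hence "emeasure TM (sym_difference ({0..t} \<times> space M - B) (grid_set t N ?A)) \<le>
        emeasure TM (sym_difference B (grid_set t N A) \<union> {0} \<times> space M)"
      using Bm grid_set_measurable[OF _ A(1)] t by (intro emeasure_mono) (auto simp: sym_difference_def)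
    also have "\<dots> = emeasure TM (sym_difference B (grid_set t N A))"
      using Bm grid_set_measurable[OF _ A(1)] t
      by (intro emeasure_Un_null_set null_set_0) (auto simp: sym_difference_def)
    finally show ?case using ad A(2) by (meson order_trans)
  qed
qed

text \<open>Up to \<open>\<epsilon> / 2\<close> finitely many of the sets suffice, by continuity
  from above, the strip over \<open>{0..t}\<close> having finite measure. These are approximated on
  one common grid and united cell by cell.\<close>

lemma grid_approximable_UN:
  fixes B :: "nat \<Rightarrow> (real \<times> 'w) set"
  assumes t: "0 < t" and B: "\<And>i. B i \<in> sets (predictable_algebra M F t)" and app: "\<And>i. grid_approximable t (B i)"
  shows "grid_approximable t (\<Union>i. B i)"
  unfolding grid_approximable_def
proof (intro allI impI)
  fix \<epsilon> :: real assume \<epsilon>: "0 < \<epsilon>"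
  have Bm[measurable]: "B i \<in> sets TM" for i using B predictable_subset_product[of t] t by auto
  define R where "R n = (\<Union>i. B i) - (\<Union>i<n. B i)" for n
  have Rm: "R n \<in> sets TM" for n unfolding R_def by measurable
  have "emeasure TM (R 0) \<le> emeasure TM ({0..t} \<times> space M)"
    using sets.sets_into_space[OF B] by (intro emeasure_mono) (auto simp: R_def space_predictable)
  also have "\<dots> < \<infinity>" using t by (simp add: emeasure_Times emeasure_space_1)
  finally have "(\<lambda>n. emeasure TM (R n)) \<longlonglongrightarrow> emeasure TM (\<Inter>n. R n)"
  proof (intro Lim_emeasure_decseq)
    assume R0: "emeasure TM (R 0) < \<infinity>"
    show "emeasure TM (R n) \<noteq> \<infinity>" for n
    proof -
      have "emeasure TM (R n) \<le> emeasure TM (R 0)"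
        by (rule emeasure_mono[OF _ Rm]) (auto simp: R_def)
      with R0 show ?thesis by auto
    qed
    show "decseq R" unfolding R_def decseq_def by fastforce
  qed (use Rm in auto)
  moreover have "(\<Inter>n. R n) = {}" by (auto simp: R_def)
  ultimately have "(\<lambda>n. emeasure TM (R n)) \<longlonglongrightarrow> 0" by simp
  hence "\<forall>\<^sub>F n in sequentially. emeasure TM (R n) < ennreal (\<epsilon> / 2)"
    using \<epsilon> by (intro order_tendstoD) auto
  then obtain n where n: "emeasure TM (R n) < ennreal (\<epsilon> / 2)" by (auto simp: eventually_sequentially)
  \<comment> \<open>The \<open>n\<close> remaining errors add up to at most
    \<open>\<epsilon> / 2\<close>; \<open>Suc n\<close> keeps the quotient positive for
    \<open>n = 0\<close> too.\<close>
  let ?\<eta> = "\<epsilon> / (2 * real (Suc n))"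
  have "\<forall>\<^sub>F N in sequentially. \<forall>i\<in>{..<n}. \<exists>A. grid_adapted t N A \<and>
      emeasure TM (sym_difference (B i) (grid_set t N A)) \<le> ennreal ?\<eta>"
    using app \<epsilon> unfolding grid_approximable_def by (intro eventually_ball_finite ballI) auto
  thus "\<forall>\<^sub>F N in sequentially. \<exists>A. grid_adapted t N A \<and>
      emeasure TM (sym_difference (\<Union>i. B i) (grid_set t N A)) \<le> ennreal \<epsilon>"
  proof eventually_elim
    case (elim N)
    then obtain A where A: "\<And>i. i < n \<Longrightarrow> grid_adapted t N (A i)"
      "\<And>i. i < n \<Longrightarrow> emeasure TM (sym_difference (B i) (grid_set t N (A i))) \<le> ennreal ?\<eta>"
      by (metis lessThan_iff)
    let ?A = "\<lambda>m. \<Union>i<n. A i m"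
    have ad: "grid_adapted t N ?A" using A(1) by (auto simp: grid_adapted_def intro!: sets.finite_UN)
    have gm: "i < n \<Longrightarrow> sym_difference (B i) (grid_set t N (A i)) \<in> sets TM" for i
      using grid_set_measurable[OF _ A(1)] t Bm by (auto simp: sym_difference_def)
    have "sym_difference (\<Union>i. B i) (grid_set t N ?A) \<subseteq> R n \<union> (\<Union>i<n. sym_difference (B i) (grid_set t N (A i)))"
      by (auto simp: sym_difference_def grid_set_def R_def)
    hence "emeasure TM (sym_difference (\<Union>i. B i) (grid_set t N ?A)) \<le>
        emeasure TM (R n \<union> (\<Union>i<n. sym_difference (B i) (grid_set t N (A i))))"
      using Rm gm by (intro emeasure_mono) auto
    also have "\<dots> \<le> emeasure TM (R n) + emeasure TM (\<Union>i<n. sym_difference (B i) (grid_set t N (A i)))"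
      using Rm gm by (intro emeasure_subadditive) auto
    also have "\<dots> \<le> ennreal (\<epsilon> / 2) + (\<Sum>i<n. emeasure TM (sym_difference (B i) (grid_set t N (A i))))"
      using n gm by (intro add_mono emeasure_subadditive_finite) auto
    also have "\<dots> \<le> ennreal (\<epsilon> / 2) + (\<Sum>i<n. ennreal ?\<eta>)"
      using A(2) by (intro add_mono sum_mono) auto
    also have "(\<Sum>i<n. ennreal ?\<eta>) = ennreal (\<Sum>i<n. ?\<eta>)"
      using \<epsilon> by (intro sum_ennreal) auto
    also have "\<dots> \<le> ennreal (\<epsilon> / 2)"
    proof (rule ennreal_leI)
      have "real n * \<epsilon> \<le> real (Suc n) * \<epsilon>" using \<epsilon> by (intro mult_right_mono) auto
      thus "(\<Sum>i<n. ?\<eta>) \<le> \<epsilon> / 2" by (simp add: field_simps)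
    qed
    also have "ennreal (\<epsilon> / 2) + ennreal (\<epsilon> / 2) = ennreal \<epsilon>" using \<epsilon> by (simp flip: ennreal_plus)
    finally show ?case using ad by (auto simp: add_left_mono)
  qed
qed

text \<open>Approximability holds for the generators and passes to complements and arbitrary
  countable unions of predictable sets, so induction over the generated sigma-algebra reaches every
  predictable set.\<close>

lemma predictable_grid_approximable:
  assumes t: "0 < t" and B: "B \<in> sets (predictable_algebra M F t)"
  shows "grid_approximable t B"
proof -
  note sp = sets_predictable[of t]
  have "B \<in> sigma_sets ({0..t} \<times> space M)
    ({{s<..u} \<times> A | s u A. 0 \<le> s \<and> s < u \<and> u \<le> t \<and> A \<in> sets (F s)} \<union> {{0} \<times> A | A. A \<in> sets (F 0)})"
    using B t sp by simp
  thus ?thesis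
  proof induction
    case (Basic a)
    thus ?case
    proof (elim UnE CollectE exE conjE)
      fix A assume "a = {0} \<times> A" "A \<in> sets (F 0)"
      thus ?thesis using sets_F_M[of 0] t by (intro grid_approximable_null) (auto intro!: null_set_0)
    qed (use grid_approximable_rectangle[OF t] in blast)
  next
    case Empty
    show ?case using t by (intro grid_approximable_null) auto
  next
    case (Compl a)
    thus ?case using grid_approximable_compl[OF t] sp t by simp
  next
    case (Union a)
    thus ?case using grid_approximable_UN[OF t] sp t by simp
  qed
qed

section \<open>Approximation of predictable processes\<close>

lemma space_pm_cases:
  assumes "p \<in> space pm"
  obtains k \<tau> \<omega> where "p = (k, \<tau>, \<omega>)" "\<omega> \<in> space M"
  using assms by (cases p) (auto simp: space_pm)

text \<open>Stated for functions on \<open>pm\<close> rather than for processes, so that a single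
  coordinate can be approximated on its own and the results added.\<close>

definition approximable :: "real \<Rightarrow> (nat \<times> real \<times> 'w \<Rightarrow> 'h::{real_inner,banach,second_countable_topology}) \<Rightarrow> bool" where
  "approximable t c \<longleftrightarrow> c \<in> borel_measurable pm \<and>
    (\<forall>\<epsilon>>0. \<forall>\<^sub>F N in sequentially. \<exists>\<xi>. elementary_data M F Q t N (grid t N) \<xi> \<and>
      L2sq pm (\<lambda>p. coords t (elementary_process N (grid t N) \<xi>) p - c p) \<le> ennreal \<epsilon>)"

lemma coords_elementary_measurable:
  fixes \<xi> :: "nat \<Rightarrow> 'w \<Rightarrow> 'u \<Rightarrow> 'h::{real_inner,banach,second_countable_topology}"
  assumes "elementary_data M F Q t N r \<xi>"
  shows "coords t (elementary_process N r \<xi>) \<in> borel_measurable pm"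
  unfolding elementary_process_eq by (rule coords_atom_process_measurable[OF elementary_data_atoms[OF assms]])

lemma elementary_data_grid_iff:
  fixes \<xi> :: "nat \<Rightarrow> 'w \<Rightarrow> 'u \<Rightarrow> 'h::{real_inner,banach,second_countable_topology}"
  assumes "0 < t" "0 < N"
  shows "elementary_data M F Q t N (grid t N) \<xi> \<longleftrightarrow>
    (\<forall>m<N. simple_function (F (grid t N m)) (\<xi> m) \<and> \<xi> m ` space M \<subseteq> L20 Q)"
  using assms by (auto simp: elementary_data_def grid_Suc) (auto simp: grid_def)

text \<open>For large \<open>N\<close> both approximations use the same grid, so their data are
  added cell by cell; \<open>\<epsilon> / 4\<close> pays for the factor 2 of
  \<open>L2sq_add\<close>.\<close>

lemma approximable_add:
  fixes c d :: "nat \<times> real \<times> 'w \<Rightarrow> 'h::{real_inner,banach,second_countable_topology}"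
  assumes t: "0 < t" and c: "approximable t c" and d: "approximable t d"
  shows "approximable t (\<lambda>p. c p + d p)"
  unfolding approximable_def
proof (intro conjI allI impI)
  have [measurable]: "c \<in> borel_measurable pm" "d \<in> borel_measurable pm"
    using c d by (auto simp: approximable_def)
  show "(\<lambda>p. c p + d p) \<in> borel_measurable pm" by measurable
  fix \<epsilon> :: real assume \<epsilon>: "0 < \<epsilon>"
  have cN: "\<forall>\<^sub>F N in sequentially. \<exists>\<xi>. elementary_data M F Q t N (grid t N) \<xi> \<and>
      L2sq pm (\<lambda>p. coords t (elementary_process N (grid t N) \<xi>) p - c p) \<le> ennreal (\<epsilon> / 4)"
    using c \<epsilon> by (simp add: approximable_def)
  have dN: "\<forall>\<^sub>F N in sequentially. \<exists>\<xi>. elementary_data M F Q t N (grid t N) \<xi> \<and>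
      L2sq pm (\<lambda>p. coords t (elementary_process N (grid t N) \<xi>) p - d p) \<le> ennreal (\<epsilon> / 4)"
    using d \<epsilon> by (simp add: approximable_def)
  show "\<forall>\<^sub>F N in sequentially. \<exists>\<xi>. elementary_data M F Q t N (grid t N) \<xi> \<and>
      L2sq pm (\<lambda>p. coords t (elementary_process N (grid t N) \<xi>) p - (c p + d p)) \<le> ennreal \<epsilon>"
    using cN dN eventually_gt_at_top[of 0]
  proof eventually_elim
    case (elim N)
    then obtain \<xi> \<eta> where \<xi>: "elementary_data M F Q t N (grid t N) \<xi>"
      "L2sq pm (\<lambda>p. coords t (elementary_process N (grid t N) \<xi>) p - c p) \<le> ennreal (\<epsilon> / 4)"
      and \<eta>: "elementary_data M F Q t N (grid t N) \<eta>"
      "L2sq pm (\<lambda>p. coords t (elementary_process N (grid t N) \<eta>) p - d p) \<le> ennreal (\<epsilon> / 4)" by blast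
    define \<zeta> where "\<zeta> m \<omega> x = \<xi> m \<omega> x + \<eta> m \<omega> x" for m \<omega> x
    note iff = elementary_data_grid_iff[OF t elim(3)]
    have "simple_function (F (grid t N m)) (\<zeta> m) \<and> \<zeta> m ` space M \<subseteq> L20 Q" if m: "m < N" for m
    proof
      have *: "simple_function (F (grid t N m)) (\<xi> m)" "simple_function (F (grid t N m)) (\<eta> m)"
        "\<xi> m ` space M \<subseteq> L20 Q" "\<eta> m ` space M \<subseteq> L20 Q"
        using \<xi>(1) \<eta>(1) m unfolding iff by auto
      show "simple_function (F (grid t N m)) (\<zeta> m)"
        using simple_function_compose2[OF *(1,2), of "\<lambda>a b x. a x + b x"] by (simp add: \<zeta>_def[abs_def])
      show "\<zeta> m ` space M \<subseteq> L20 Q"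
        using * by (auto simp: \<zeta>_def[abs_def] intro!: L20_add)
    qed
    hence \<zeta>: "elementary_data M F Q t N (grid t N) \<zeta>" unfolding iff by blast
    have eq: "coords t (elementary_process N (grid t N) \<zeta>) p - (c p + d p) =
      (coords t (elementary_process N (grid t N) \<xi>) p - c p) + (coords t (elementary_process N (grid t N) \<eta>) p - d p)" for p
      by (cases p) (simp add: coords_def elementary_process_def \<zeta>_def scaleR_add_right sum.distrib algebra_simps)
    have [measurable]: "coords t (elementary_process N (grid t N) \<xi>) \<in> borel_measurable pm"
      "coords t (elementary_process N (grid t N) \<eta>) \<in> borel_measurable pm"
      using coords_elementary_measurable \<xi> \<eta> by auto
    have "L2sq pm (\<lambda>p. coords t (elementary_process N (grid t N) \<zeta>) p - (c p + d p)) \<le>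
      2 * L2sq pm (\<lambda>p. coords t (elementary_process N (grid t N) \<xi>) p - c p) +
      2 * L2sq pm (\<lambda>p. coords t (elementary_process N (grid t N) \<eta>) p - d p)"
      unfolding eq by (rule L2sq_add) measurable
    also have "\<dots> \<le> 2 * ennreal (\<epsilon> / 4) + 2 * ennreal (\<epsilon> / 4)"
      using \<xi> \<eta> by (intro add_mono mult_left_mono) auto
    also have "\<dots> = ennreal (2 * (\<epsilon> / 4) + 2 * (\<epsilon> / 4))"
      using \<epsilon> by (simp only: ennreal_plus ennreal_mult') (simp add: ennreal_mult' ennreal_plus)
    also have "2 * (\<epsilon> / 4) + 2 * (\<epsilon> / 4) = \<epsilon>" by simp
    finally show ?case using \<zeta> by blast
  qed
qed

lemma approximable_cong:
  assumes "approximable t c" "\<And>p. p \<in> space pm \<Longrightarrow> c p = d p"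
  shows "approximable t d"
proof -
  have "d \<in> borel_measurable pm" using assms by (subst measurable_cong[of _ d c]) (auto simp: approximable_def)
  moreover have "L2sq pm (\<lambda>p. g p - d p) = L2sq pm (\<lambda>p. g p - c p)" for g
    by (rule L2sq_cong) (simp add: assms(2))
  ultimately show ?thesis using assms(1) by (simp add: approximable_def)
qed

text \<open>Grid sets for \<open>B\<close> multiplied by \<open>rank_one k h\<close> give an
  elementary process living in coordinate \<open>k\<close> alone, whose error is
  \<open>(norm h)\<^sup>2\<close> times the measure of a symmetric difference.\<close>

lemma approximable_indicator:
  fixes h :: "'h::{real_inner,banach,second_countable_topology}"
  assumes t: "0 < t" and k: "k \<in> Kp" and B: "B \<in> sets (predictable_algebra M F t)"
  shows "approximable t (\<lambda>(j, q). indicat_real ({k} \<times> B) (j, q) *\<^sub>R h)"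
  unfolding approximable_def
proof (intro conjI allI impI)
  have Bm: "B \<in> sets TM" using B predictable_subset_product[of t] t by auto
  hence kB[measurable]: "{k} \<times> B \<in> sets pm" by (simp add: pm_def)
  show "(\<lambda>(j, q). indicat_real ({k} \<times> B) (j, q) *\<^sub>R h) \<in> borel_measurable pm"
    unfolding case_prod_beta prod.collapse by measurable
  fix \<epsilon> :: real assume \<epsilon>: "0 < \<epsilon>"
  \<comment> \<open>The added 1 covers \<open>h = 0\<close>.\<close>
  let ?\<eta> = "\<epsilon> / ((norm h)\<^sup>2 + 1)"
  have pos: "0 < (norm h)\<^sup>2 + 1" by (simp add: add_nonneg_pos)
  hence \<eta>: "0 < ?\<eta>" using \<epsilon> by simp
  show "\<forall>\<^sub>F N in sequentially. \<exists>\<xi>. elementary_data M F Q t N (grid t N) \<xi> \<and>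
      L2sq pm (\<lambda>p. coords t (elementary_process N (grid t N) \<xi>) p - (case p of (j, q) \<Rightarrow> indicat_real ({k} \<times> B) (j, q) *\<^sub>R h)) \<le> ennreal \<epsilon>"
    using predictable_grid_approximable[OF t B, unfolded grid_approximable_def, rule_format, OF \<eta>]
      eventually_gt_at_top[of 0]
  proof eventually_elim
    case (elim N)
    then obtain A where A: "grid_adapted t N A"
      "emeasure TM (sym_difference B (grid_set t N A)) \<le> ennreal ?\<eta>" by blast
    define \<xi> where "\<xi> m \<omega> x = indicat_real (A m) \<omega> *\<^sub>R rank_one k h x" for m \<omega> x
    have el: "elementary_data M F Q t N (grid t N) \<xi>"
      unfolding elementary_data_grid_iff[OF t elim(2)]
    proof (intro allI impI conjI)
      fix m assume m: "m < N"
      have "simple_function (F (grid t N m)) (indicat_real (A m))"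
        using A(1) m by (intro simple_function_indicator) (auto simp: grid_adapted_def)
      from simple_function_compose1[OF this, of "\<lambda>r x. r *\<^sub>R rank_one k h x"]
      show "simple_function (F (grid t N m)) (\<xi> m)" by (simp add: \<xi>_def[abs_def])
      show "\<xi> m ` space M \<subseteq> L20 Q"
        unfolding \<xi>_def[abs_def] by (auto intro!: L20_scaleR rank_one_L20[OF k])
    qed
    have proc: "coords t (elementary_process N (grid t N) \<xi>) (j, \<tau>, \<omega>) =
        indicat_real ({k} \<times> grid_set t N A) (j, \<tau>, \<omega>) *\<^sub>R h" for j \<tau> \<omega>
    proof -
      have "coords t (elementary_process N (grid t N) \<xi>) (j, \<tau>, \<omega>) =
          (\<Sum>m<N. indicat_real {grid t N m<..grid t N (Suc m)} \<tau> *\<^sub>R \<xi> m \<omega> (f j))"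
        using fun_cong[OF coords_atom_process[OF elementary_data_atoms[OF el]], of "(j, \<tau>, \<omega>)"]
        unfolding elementary_process_eq by (simp add: atom_process_def)
      also have "\<dots> = (\<Sum>m<N. indicat_real {grid t N m<..grid t N (Suc m)} \<tau> * indicat_real (A m) \<omega>) *\<^sub>R (if j = k then h else 0)"
        by (simp only: \<xi>_def rank_one_f[OF k] scaleR_scaleR scaleR_sum_left)
      \<comment> \<open>The cells are disjoint, so at most one term of the sum is nonzero.\<close>
      also have "(\<Sum>m<N. indicat_real {grid t N m<..grid t N (Suc m)} \<tau> * indicat_real (A m) \<omega>) = indicat_real (grid_set t N A) (\<tau>, \<omega>)"
      proof (cases "\<exists>m<N. \<tau> \<in> {grid t N m<..grid t N (Suc m)}")
        case True
        then obtain m where m: "m < N" "\<tau> \<in> {grid t N m<..grid t N (Suc m)}" by blast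
        have u: "n = m" if "\<tau> \<in> {grid t N n<..grid t N (Suc n)}" for n
          by (rule grid_cell_unique[OF _ that m(2)]) (use t in simp)
        have "(\<Sum>n<N. indicat_real {grid t N n<..grid t N (Suc n)} \<tau> * indicat_real (A n) \<omega>) =
            (\<Sum>n<N. if n = m then indicat_real (A m) \<omega> else 0)"
        proof (rule sum.cong[OF refl])
          fix n
          show "indicat_real {grid t N n<..grid t N (Suc n)} \<tau> * indicat_real (A n) \<omega> = (if n = m then indicat_real (A m) \<omega> else 0)"
          proof (cases "n = m")
            case True
            thus ?thesis by (simp add: indicator_simps(1)[OF m(2)] del: greaterThanAtMost_iff)
          next
            case False
            hence "\<tau> \<notin> {grid t N n<..grid t N (Suc n)}" using u[of n] by blast
            thus ?thesis using False by (simp add: indicator_simps(2) del: greaterThanAtMost_iff)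
          qed
        qed
        also have "\<dots> = indicat_real (A m) \<omega>" using m by simp
        also have "\<dots> = indicat_real (grid_set t N A) (\<tau>, \<omega>)"
        proof -
          have "(\<tau>, \<omega>) \<in> grid_set t N A \<longleftrightarrow> \<omega> \<in> A m" using u m unfolding grid_set_def by blast
          thus ?thesis by (simp add: indicator_def)
        qed
        finally show ?thesis .
      next
        case False
        hence "(\<tau>, \<omega>) \<notin> grid_set t N A" by (auto simp: grid_set_def)
        moreover have "(\<Sum>m<N. indicat_real {grid t N m<..grid t N (Suc m)} \<tau> * indicat_real (A m) \<omega>) = 0"
          using False by (intro sum.neutral) auto
        ultimately show ?thesis by simp
      qed
      finally show ?thesis by (auto simp: indicator_def)
    qed
    let ?D = "{k} \<times> sym_difference B (grid_set t N A)"
    have Sm: "sym_difference B (grid_set t N A) \<in> sets TM"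
      using Bm grid_set_measurable[OF _ A(1)] t by (auto simp: sym_difference_def)
    hence Dm[measurable]: "?D \<in> sets pm" by (simp add: pm_def)
    have "L2sq pm (\<lambda>p. coords t (elementary_process N (grid t N) \<xi>) p - (case p of (j, q) \<Rightarrow> indicat_real ({k} \<times> B) (j, q) *\<^sub>R h)) =
        (\<integral>\<^sup>+p. ennreal ((norm h)\<^sup>2) * indicator ?D p \<partial>pm)"
      unfolding L2sq_def
    proof (rule nn_integral_cong)
      fix p :: "nat \<times> real \<times> 'w"
      obtain j \<tau> \<omega> where p: "p = (j, \<tau>, \<omega>)" by (cases p) auto
      show "ennreal ((norm (coords t (elementary_process N (grid t N) \<xi>) p - (case p of (j, q) \<Rightarrow> indicat_real ({k} \<times> B) (j, q) *\<^sub>R h)))\<^sup>2) =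
          ennreal ((norm h)\<^sup>2) * indicator ?D p"
        unfolding p proc by (auto simp: indicator_def sym_difference_def)
    qed
    also have "\<dots> = ennreal ((norm h)\<^sup>2) * emeasure pm ?D" by (rule nn_integral_cmult_indicator) measurable
    also have "emeasure pm ?D = emeasure TM (sym_difference B (grid_set t N A))"
    proof -
      interpret P: pair_sigma_finite lborel M ..
      have "sigma_finite_measure TM" by (rule P.sigma_finite_measure_axioms)
      thus ?thesis unfolding pm_def
        by (subst sigma_finite_measure.emeasure_pair_measure_Times) (use Sm in auto)
    qed
    also have "ennreal ((norm h)\<^sup>2) * \<dots> \<le> ennreal ((norm h)\<^sup>2) * ennreal ?\<eta>"
      by (intro mult_left_mono A) auto
    also have "\<dots> = ennreal ((norm h)\<^sup>2 * ?\<eta>)" using \<eta> by (intro ennreal_mult[symmetric]) auto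
    also have "\<dots> \<le> ennreal \<epsilon>"
    proof (rule ennreal_leI)
      show "(norm h)\<^sup>2 * ?\<eta> \<le> \<epsilon>" using pos \<epsilon> by (simp add: field_simps)
    qed
    finally show ?case using el by blast
  qed
qed

lemma approximable_zero:
  assumes t: "0 < t"
  shows "approximable t (\<lambda>_. 0 :: 'h::{real_inner,banach,second_countable_topology})"
  unfolding approximable_def
proof (intro conjI allI impI)
  fix \<epsilon> :: real assume \<epsilon>: "0 < \<epsilon>"
  show "\<forall>\<^sub>F N in sequentially. \<exists>\<xi>. elementary_data M F Q t N (grid t N) \<xi> \<and>
      L2sq pm (\<lambda>p. coords t (elementary_process N (grid t N) \<xi>) p - (0::'h)) \<le> ennreal \<epsilon>"
    using eventually_gt_at_top[of 0]
  proof eventually_elim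
    case (elim N)
    have "elementary_data M F Q t N (grid t N) (\<lambda>_ _ _. 0 :: 'h)"
      unfolding elementary_data_grid_iff[OF t elim] by (auto simp: L20_zero)
    moreover have "L2sq pm (\<lambda>p. coords t (elementary_process N (grid t N) (\<lambda>_ _ _. 0 :: 'h)) p - 0) = 0"
      by (simp add: L2sq_def coords_def elementary_process_def case_prod_beta)
    ultimately show ?case by (metis zero_le)
  qed
qed simp

lemma approximable_sum:
  fixes c :: "'i \<Rightarrow> nat \<times> real \<times> 'w \<Rightarrow> 'h::{real_inner,banach,second_countable_topology}"
  assumes "0 < t" "\<And>i. i \<in> I \<Longrightarrow> approximable t (c i)"
  shows "approximable t (\<lambda>p. \<Sum>i\<in>I. c i p)"
  using assms by (induction I rule: infinite_finite_induct) (auto intro: approximable_zero approximable_add)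

text \<open>Each coordinate is a pointwise limit of predictable simple functions of at most twice
  its norm. Truncated to finitely many coordinates these are finite sums of indicators, and
  dominated convergence with three times the norm of \<open>coords t \<Phi>\<close> does the
  rest.\<close>

lemma elementary_dense_pos:
  fixes \<Phi> :: "real \<Rightarrow> 'w \<Rightarrow> 'u \<Rightarrow> 'h::{real_inner,banach,second_countable_topology}"
  assumes t: "0 < t" and \<Phi>: "\<Phi> \<in> N2 M F Q t" and \<epsilon>: "0 < (\<epsilon>::real)"
  shows "\<exists>N r \<xi>. elementary_data M F Q t N r \<xi> \<and>
      N2_norm_sq M Q t (\<lambda>\<tau> \<omega> u. elementary_process N r \<xi> \<tau> \<omega> u - \<Phi> \<tau> \<omega> u) \<le> ennreal \<epsilon>"
proof -
  let ?P = "predictable_algebra M F t"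
  have t0: "0 \<le> t" using t by simp
  have pr: "predictable_process M F t (L20_borel Q) \<Phi>" and fin: "L2sq pm (coords t \<Phi>) < \<infinity>"
    using \<Phi> by (auto simp: N2_iff t0)
  have \<Phi>L: "\<And>\<tau> \<omega>. \<tau> \<in> {0..t} \<Longrightarrow> \<omega> \<in> space M \<Longrightarrow> \<Phi> \<tau> \<omega> \<in> L20 Q"
    and \<Phi>m: "\<And>k. (\<lambda>(\<tau>, \<omega>). \<Phi> \<tau> \<omega> (f k)) \<in> borel_measurable ?P"
    using pr by (auto simp: predictable_process_iff)
  have [measurable]: "coords t \<Phi> \<in> borel_measurable pm" by (rule N2_coords_measurable[OF t0 \<Phi>])
  have "\<forall>k. \<exists>s. (\<forall>i. simple_function ?P (s i)) \<and>
      (\<forall>x\<in>space ?P. (\<lambda>i. s i x) \<longlonglongrightarrow> (case x of (\<tau>, \<omega>) \<Rightarrow> \<Phi> \<tau> \<omega> (f k))) \<and>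
      (\<forall>i. \<forall>x\<in>space ?P. dist (s i x) 0 \<le> 2 * dist (case x of (\<tau>, \<omega>) \<Rightarrow> \<Phi> \<tau> \<omega> (f k)) 0)"
    using borel_measurable_implies_sequence_metric[OF \<Phi>m] by blast
  then obtain s where "\<forall>k. (\<forall>i. simple_function ?P (s k i)) \<and>
      (\<forall>x\<in>space ?P. (\<lambda>i. s k i x) \<longlonglongrightarrow> (case x of (\<tau>, \<omega>) \<Rightarrow> \<Phi> \<tau> \<omega> (f k))) \<and>
      (\<forall>i. \<forall>x\<in>space ?P. dist (s k i x) 0 \<le> 2 * dist (case x of (\<tau>, \<omega>) \<Rightarrow> \<Phi> \<tau> \<omega> (f k)) 0)"
    unfolding choice_iff by blast
  hence s: "simple_function ?P (s k i)"
    "\<tau> \<in> {0..t} \<Longrightarrow> \<omega> \<in> space M \<Longrightarrow> (\<lambda>i. s k i (\<tau>, \<omega>)) \<longlonglongrightarrow> \<Phi> \<tau> \<omega> (f k)"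
    "\<tau> \<in> {0..t} \<Longrightarrow> \<omega> \<in> space M \<Longrightarrow> norm (s k i (\<tau>, \<omega>)) \<le> 2 * norm (\<Phi> \<tau> \<omega> (f k))" for k i \<tau> \<omega>
    unfolding space_predictable by (auto simp: dist_norm)
  \<comment> \<open>One index \<open>n\<close> both truncates the coordinates and selects the simple
    approximation. Restriction to \<open>Kp\<close> loses nothing, since \<open>\<Phi>\<close>
    vanishes at the other \<open>f k\<close>.\<close>
  define c where "c n = (\<lambda>(k, \<tau>, \<omega>). if k \<in> Kp \<and> k < n then indicat_real {0..t} \<tau> *\<^sub>R s k n (\<tau>, \<omega>) else 0)" for n
  have app: "approximable t (c n)" for n
  proof (rule approximable_cong)
    let ?S = "\<lambda>k h. s k n -` {h} \<inter> space ?P"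
    show "approximable t (\<lambda>p. \<Sum>k\<in>Kp \<inter> {..<n}. \<Sum>h\<in>s k n ` space ?P. (case p of (j, q) \<Rightarrow> indicat_real ({k} \<times> ?S k h) (j, q) *\<^sub>R h))"
    proof (intro approximable_sum[OF t] approximable_indicator[OF t])
      show "?S k h \<in> sets ?P" if "h \<in> s k n ` space ?P" for k h
        using s(1) that by (auto simp: simple_function_def)
    qed auto
    fix p assume "p \<in> space pm"
    then obtain j \<tau> \<omega> where p: "p = (j, \<tau>, \<omega>)" "\<omega> \<in> space M" by (rule space_pm_cases)
    have inner: "(\<Sum>h\<in>s k n ` space ?P. indicat_real ({k} \<times> ?S k h) (j, \<tau>, \<omega>) *\<^sub>R h) =
        (if j = k then indicat_real {0..t} \<tau> *\<^sub>R s k n (\<tau>, \<omega>) else 0)" for k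
    proof (cases "j = k \<and> \<tau> \<in> {0..t}")
      case True
      hence "(\<tau>, \<omega>) \<in> space ?P" using p by (simp add: space_predictable)
      hence "(\<Sum>h\<in>s k n ` space ?P. indicat_real ({k} \<times> ?S k h) (j, \<tau>, \<omega>) *\<^sub>R h) =
          (\<Sum>h\<in>s k n ` space ?P. if h = s k n (\<tau>, \<omega>) then s k n (\<tau>, \<omega>) else 0)"
        using True by (intro sum.cong) (auto simp: indicator_def)
      also have "\<dots> = s k n (\<tau>, \<omega>)"
        using s(1)[of k n] \<open>(\<tau>, \<omega>) \<in> space ?P\<close> by (simp add: simple_function_def)
      finally show ?thesis using True by simp
    next
      case False
      hence "(\<Sum>h\<in>s k n ` space ?P. indicat_real ({k} \<times> ?S k h) (j, \<tau>, \<omega>) *\<^sub>R h) = 0"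
        by (intro sum.neutral) (auto simp: indicator_def space_predictable)
      thus ?thesis using False by auto
    qed
    show "(\<Sum>k\<in>Kp \<inter> {..<n}. \<Sum>h\<in>s k n ` space ?P. (case p of (j, q) \<Rightarrow> indicat_real ({k} \<times> ?S k h) (j, q) *\<^sub>R h)) = c n p"
      unfolding p(1) prod.case inner by (simp add: c_def)
  qed
  have [measurable]: "c n \<in> borel_measurable pm" for n using app[of n] by (simp add: approximable_def)
  have \<Phi>0: "\<Phi> \<tau> \<omega> (f k) = 0" if "\<tau> \<in> {0..t}" "\<omega> \<in> space M" "k \<notin> Kp" for \<tau> \<omega> k
    using \<Phi>L[OF that(1,2)] bounded_U0_zero[of "\<Phi> \<tau> \<omega>"] f_eq_0[OF that(3)] by (simp add: L20_iff)
  have "(\<lambda>n. L2sq pm (\<lambda>p. c n p - coords t \<Phi> p)) \<longlonglongrightarrow> 0"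
  proof (rule L2sq_dominated_convergence)
    show "(\<lambda>p. 3 * norm (coords t \<Phi> p)) \<in> borel_measurable pm" by measurable
    have "L2sq pm (\<lambda>p. 3 * norm (coords t \<Phi> p)) = 9 * L2sq pm (coords t \<Phi>)"
      unfolding L2sq_def
      by (subst nn_integral_cmult[symmetric]) (auto simp: power_mult_distrib ennreal_mult intro!: nn_integral_cong)
    thus "L2sq pm (\<lambda>p. 3 * norm (coords t \<Phi> p)) < \<infinity>" using fin by (simp add: ennreal_mult_less_top)
    show "norm (c n p - coords t \<Phi> p) \<le> 3 * norm (coords t \<Phi> p)" if p_in: "p \<in> space pm" for n p
    proof -
      obtain k \<tau> \<omega> where p: "p = (k, \<tau>, \<omega>)" "\<omega> \<in> space M" by (rule space_pm_cases[OF p_in])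
      have "norm (c n p) \<le> 2 * norm (coords t \<Phi> p)"
        using s(3)[OF _ p(2), of \<tau> k n] by (auto simp: p(1) c_def coords_def indicator_def)
      thus ?thesis using norm_triangle_ineq4[of "c n p" "coords t \<Phi> p"] by linarith
    qed
    show "AE p in pm. (\<lambda>n. c n p - coords t \<Phi> p) \<longlonglongrightarrow> 0"
    proof (rule AE_I2)
      fix p assume "p \<in> space pm"
      then obtain k \<tau> \<omega> where p: "p = (k, \<tau>, \<omega>)" "\<omega> \<in> space M" by (rule space_pm_cases)
      show "(\<lambda>n. c n p - coords t \<Phi> p) \<longlonglongrightarrow> 0"
      proof (cases "\<tau> \<in> {0..t} \<and> k \<in> Kp")
        case True
        hence "\<forall>\<^sub>F n in sequentially. s k n (\<tau>, \<omega>) - \<Phi> \<tau> \<omega> (f k) = c n p - coords t \<Phi> p"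
          by (intro eventually_mono[OF eventually_gt_at_top[of k]]) (simp add: p(1) c_def coords_def)
        moreover have "(\<lambda>n. s k n (\<tau>, \<omega>) - \<Phi> \<tau> \<omega> (f k)) \<longlonglongrightarrow> 0"
          using s(2)[of \<tau> \<omega> k] True p by (simp add: LIM_zero)
        ultimately show ?thesis by (rule Lim_transform_eventually[rotated])
      next
        case False
        hence "c n p = 0" "coords t \<Phi> p = 0" for n
          using \<Phi>0[of \<tau> \<omega> k] p by (auto simp: c_def coords_def indicator_def)
        thus ?thesis by simp
      qed
    qed
  qed measurable
  hence "\<forall>\<^sub>F n in sequentially. L2sq pm (\<lambda>p. c n p - coords t \<Phi> p) < ennreal (\<epsilon> / 4)"
    using \<epsilon> by (intro order_tendstoD) auto
  then obtain n where n: "L2sq pm (\<lambda>p. c n p - coords t \<Phi> p) < ennreal (\<epsilon> / 4)" by (auto simp: eventually_sequentially)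
  have "\<forall>\<^sub>F N in sequentially. \<exists>\<xi>. elementary_data M F Q t N (grid t N) \<xi> \<and>
      L2sq pm (\<lambda>p. coords t (elementary_process N (grid t N) \<xi>) p - c n p) \<le> ennreal (\<epsilon> / 4)"
    using app[of n] \<epsilon> by (simp add: approximable_def)
  then obtain N \<xi> where el: "elementary_data M F Q t N (grid t N) \<xi>"
    and le: "L2sq pm (\<lambda>p. coords t (elementary_process N (grid t N) \<xi>) p - c n p) \<le> ennreal (\<epsilon> / 4)"
    by (auto simp: eventually_sequentially)
  have [measurable]: "coords t (elementary_process N (grid t N) \<xi>) \<in> borel_measurable pm"
    by (rule coords_elementary_measurable[OF el])
  have "N2_norm_sq M Q t (\<lambda>\<tau> \<omega> u. elementary_process N (grid t N) \<xi> \<tau> \<omega> u - \<Phi> \<tau> \<omega> u) =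
      L2sq pm (\<lambda>p. coords t (elementary_process N (grid t N) \<xi>) p - coords t \<Phi> p)"
    by (rule elementary_error_eq[OF t0 pr el])
  also have "\<dots> \<le> 2 * L2sq pm (\<lambda>p. coords t (elementary_process N (grid t N) \<xi>) p - c n p) +
      2 * L2sq pm (\<lambda>p. c n p - coords t \<Phi> p)"
    by (rule L2sq_triangle) measurable
  also have "\<dots> \<le> 2 * ennreal (\<epsilon> / 4) + 2 * ennreal (\<epsilon> / 4)"
    using le n by (intro add_mono mult_left_mono) auto
  also have "\<dots> = ennreal (2 * (\<epsilon> / 4) + 2 * (\<epsilon> / 4))"
    using \<epsilon> by (simp only: ennreal_plus ennreal_mult') (simp add: ennreal_mult' ennreal_plus)
  also have "2 * (\<epsilon> / 4) + 2 * (\<epsilon> / 4) = \<epsilon>" by simp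
  finally show ?thesis using el by blast
qed

lemma elementary_dense:
  fixes \<Phi> :: "real \<Rightarrow> 'w \<Rightarrow> 'u \<Rightarrow> 'h::{real_inner,banach,second_countable_topology}"
  assumes t: "0 \<le> t" and \<Phi>: "\<Phi> \<in> N2 M F Q t" and \<epsilon>: "0 < (\<epsilon>::real)"
  shows "\<exists>N r \<xi>. elementary_data M F Q t N r \<xi> \<and>
      N2_norm_sq M Q t (\<lambda>\<tau> \<omega> u. elementary_process N r \<xi> \<tau> \<omega> u - \<Phi> \<tau> \<omega> u) \<le> ennreal \<epsilon>"
proof (cases "t = 0")
  case False
  thus ?thesis using elementary_dense_pos[OF _ \<Phi> \<epsilon>] t by simp
next
  case True
  \<comment> \<open>For horizon 0 the partition without cells is admissible, and every norm over the
    single time 0 vanishes.\<close>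
  have "elementary_data M F Q t 0 (\<lambda>_. 0) (\<lambda>_ _ _. 0 :: 'h)" using True by (simp add: elementary_data_def)
  moreover have "N2_norm_sq M Q t \<Xi> = 0" for \<Xi> :: "real \<Rightarrow> 'w \<Rightarrow> 'u \<Rightarrow> 'h"
  proof -
    have "(\<integral>\<^sup>+\<tau>\<in>{0..t}. ennreal ((L20_norm Q (\<Xi> \<tau> \<omega>))\<^sup>2) \<partial>lborel) = 0" for \<omega>
      by (rule nn_integral_null_set) (simp add: True null_sets_def)
    thus ?thesis by (simp add: N2_norm_sq_def)
  qed
  ultimately show ?thesis by (metis zero_le)
qed

end

section \<open>The stochastic convolution\<close>

context wiener_setting
begin

section \<open>Predictability of the integrand and of step processes\<close>

lemma fst_predictable:
  assumes t: "0 \<le> t"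
  shows "fst \<in> borel_measurable (predictable_algebra M F t)"
proof (rule borel_measurableI_le)
  fix c
  let ?P = "predictable_algebra M F t"
  have "{p \<in> space ?P. fst p \<le> c} =
      (if c < 0 then {} else {0} \<times> space M \<union> (if 0 < min c t then {0<..min c t} \<times> space M else {}))"
    using t by (auto simp: space_predictable)
  also have "\<dots> \<in> sets ?P"
    using t sets.top[of "F 0"] space_F[of 0]
    by (auto intro!: sets.Un rectangle_predictable rectangle_predictable_0)
  finally show "{p \<in> space ?P. fst p \<le> c} \<in> sets ?P" .
qed

text \<open>The trace of a generator on the shorter time strip is a generator or empty, so the
  inclusion of the strips is measurable.\<close>

lemma predictable_restrict:
  assumes t: "0 \<le> t" "t \<le> T" and g: "g \<in> predictable_algebra M F T \<rightarrow>\<^sub>M N"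
  shows "g \<in> predictable_algebra M F t \<rightarrow>\<^sub>M N"
proof -
  have T: "0 \<le> T" using t by simp
  have "(\<lambda>p. p) \<in> predictable_algebra M F t \<rightarrow>\<^sub>M predictable_algebra M F T"
    unfolding predictable_algebra_def[of M F T]
  proof (rule measurable_measure_of[OF predictable_generators[OF T]])
    show "(\<lambda>p. p) \<in> space (predictable_algebra M F t) \<rightarrow> {0..T} \<times> space M"
      using t by (auto simp: space_predictable)
    fix B assume B: "B \<in> {{s<..u} \<times> A | s u A. 0 \<le> s \<and> s < u \<and> u \<le> T \<and> A \<in> sets (F s)} \<union> {{0} \<times> A | A. A \<in> sets (F 0)}"
    hence "B \<inter> ({0..t} \<times> space M) \<in> sets (predictable_algebra M F t)"
    proof (elim UnE CollectE exE conjE)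
      fix A assume A: "B = {0} \<times> A" "A \<in> sets (F 0)"
      hence "B \<inter> ({0..t} \<times> space M) = {0} \<times> A"
        using sets.sets_into_space[OF A(2)] space_F[of 0] t by auto
      thus ?thesis using rectangle_predictable_0[OF t(1) A(2)] by simp
    next
      fix s u A assume A: "B = {s<..u} \<times> A" "0 \<le> s" "s < u" "u \<le> T" "A \<in> sets (F s)"
      have AM: "A \<subseteq> space M" using sets.sets_into_space[OF A(5)] space_F[OF A(2)] by simp
      show ?thesis
      proof (cases "s < t")
        case True
        have "B \<inter> ({0..t} \<times> space M) = {s<..min u t} \<times> A" using A AM by auto
        thus ?thesis using rectangle_predictable[of s "min u t" t A] A True by simp
      next
        case False
        hence "B \<inter> ({0..t} \<times> space M) = {}" using A by auto
        thus ?thesis by simp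
      qed
    qed
    thus "(\<lambda>p. p) -` B \<inter> space (predictable_algebra M F t) \<in> sets (predictable_algebra M F t)"
      by (simp add: space_predictable)
  qed
  from measurable_compose[OF this g] show ?thesis .
qed

text \<open>The time set \<open>I\<close> is left open so that both the cells \<open>{s<..u}\<close>
  and the initial point \<open>{0}\<close> of the step processes are covered.\<close>

lemma predictable_product:
  fixes g :: "'w \<Rightarrow> 'h::{banach,second_countable_topology}"
  assumes T: "0 \<le> T" and s: "0 \<le> s" and I: "\<And>A. A \<in> sets (F s) \<Longrightarrow> I \<times> A \<in> sets (predictable_algebra M F T)"
    and g: "g \<in> borel_measurable (F s)"
  shows "(\<lambda>(\<tau>, \<omega>). indicat_real I \<tau> *\<^sub>R g \<omega>) \<in> borel_measurable (predictable_algebra M F T)"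
proof -
  let ?P = "predictable_algebra M F T" and ?\<Omega> = "I \<times> space M"
  have \<Omega>: "?\<Omega> \<in> sets ?P" using I[OF sets.top] space_F[OF s] by simp
  hence \<Omega>': "?\<Omega> \<inter> space ?P \<in> sets ?P" by simp
  have sub: "?\<Omega> \<subseteq> space ?P" by (rule sets.sets_into_space[OF \<Omega>])
  have "(\<lambda>p. g (snd p)) \<in> borel_measurable (restrict_space ?P ?\<Omega>)"
  proof (rule measurableI)
    fix B :: "'h set" assume B: "B \<in> sets borel"
    have A: "g -` B \<inter> space M \<in> sets (F s)"
      using measurable_sets[OF g B] space_F[OF s] by simp
    have "(\<lambda>p. g (snd p)) -` B \<inter> space (restrict_space ?P ?\<Omega>) = I \<times> (g -` B \<inter> space M)"
      using sub by (auto simp: space_restrict_space)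
    also have "\<dots> \<in> sets (restrict_space ?P ?\<Omega>)"
      using I[OF A] by (subst sets_restrict_space_iff[OF \<Omega>']) auto
    finally show "(\<lambda>p. g (snd p)) -` B \<inter> space (restrict_space ?P ?\<Omega>) \<in> sets (restrict_space ?P ?\<Omega>)" .
  qed simp
  hence "(\<lambda>p. indicator ?\<Omega> p *\<^sub>R g (snd p)) \<in> borel_measurable ?P"
    by (subst (asm) borel_measurable_restrict_space_iff[OF \<Omega>'])
  thus ?thesis
    by (rule measurable_cong[THEN iffD1, rotated]) (auto simp: space_predictable indicator_def)
qed

text \<open>Strong continuity and the uniform bound \<open>C\<close> make the operator application
  jointly continuous in time and vector: moving the vector costs at most \<open>C\<close> times its
  displacement, and moving the time is strong continuity at the fixed vector \<open>snd p0\<close>.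
  This is then composed with the predictable pair of time and \<open>g\<close>.\<close>

lemma joint_measurable:
  fixes S :: "real \<Rightarrow> 'h::{real_inner,banach,second_countable_topology} \<Rightarrow> 'h"
  assumes t: "0 \<le> t" "t \<le> T" and bl: "\<And>r. 0 \<le> r \<Longrightarrow> bounded_linear (S r)"
    and cont: "\<And>x. continuous_on {0..} (\<lambda>r. S r x)"
    and C: "0 \<le> C" "\<And>r x. r \<in> {0..T} \<Longrightarrow> norm (S r x) \<le> C * norm x"
    and g: "g \<in> borel_measurable (predictable_algebra M F t)"
  shows "(\<lambda>p. S (t - fst p) (g p)) \<in> borel_measurable (predictable_algebra M F t)"
proof -
  let ?P = "predictable_algebra M F t" and ?D = "{0..t} \<times> (UNIV :: 'h set)"
  have "continuous_on ?D (\<lambda>p. S (t - fst p) (snd p))"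
    unfolding continuous_on_def
  proof
    fix p0 assume p0: "p0 \<in> ?D"
    have "continuous_on ?D (\<lambda>p. S (t - fst p) (snd p0))"
      by (rule continuous_on_compose2[OF cont]) (auto intro!: continuous_intros)
    from bspec[OF this[unfolded continuous_on_def] p0]
    have "((\<lambda>p. S (t - fst p) (snd p0)) \<longlongrightarrow> S (t - fst p0) (snd p0)) (at p0 within ?D)" .
    moreover have "((\<lambda>p. S (t - fst p) (snd p) - S (t - fst p) (snd p0)) \<longlongrightarrow> 0) (at p0 within ?D)"
    proof (rule Lim_null_comparison)
      show "\<forall>\<^sub>F p in at p0 within ?D. norm (S (t - fst p) (snd p) - S (t - fst p) (snd p0)) \<le> C * norm (snd p - snd p0)"
        unfolding eventually_at_filter
      proof (intro always_eventually allI impI)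
        fix p assume "p \<in> ?D"
        hence r: "0 \<le> t - fst p" "t - fst p \<in> {0..T}" using t by auto
        interpret bounded_linear "S (t - fst p)" by (rule bl[OF r(1)])
        show "norm (S (t - fst p) (snd p) - S (t - fst p) (snd p0)) \<le> C * norm (snd p - snd p0)"
          using C(2)[OF r(2), of "snd p - snd p0"] by (simp add: diff)
      qed
      have "((\<lambda>p. C * norm (snd p - snd p0)) \<longlongrightarrow> C * norm (snd p0 - snd p0)) (at p0 within ?D)"
        by (intro tendsto_intros)
      thus "((\<lambda>p. C * norm (snd p - snd p0)) \<longlongrightarrow> 0) (at p0 within ?D)" by simp
    qed
    ultimately show "((\<lambda>p. S (t - fst p) (snd p)) \<longlongrightarrow> S (t - fst p0) (snd p0)) (at p0 within ?D)"
      using tendsto_add by fastforce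
  qed
  hence S: "(\<lambda>p. S (t - fst p) (snd p)) \<in> borel_measurable (restrict_space borel ?D)"
    by (rule borel_measurable_continuous_on_restrict)
  have "(\<lambda>p. (fst p, g p)) \<in> ?P \<rightarrow>\<^sub>M restrict_space borel ?D"
  proof (rule measurable_restrict_space2)
    show "(\<lambda>p. (fst p, g p)) \<in> space ?P \<rightarrow> ?D" by (auto simp: space_predictable)
    show "(\<lambda>p. (fst p, g p)) \<in> borel_measurable ?P"
      unfolding borel_prod[symmetric] by (rule measurable_Pair[OF fst_predictable[OF t(1)] g])
  qed
  from measurable_compose[OF this S] show ?thesis by simp
qed

end

section \<open>Existence, mean square continuity and predictable version of the convolution\<close>

locale convolution_setting = wiener_setting M Q K e lam F \<beta>
  for M :: "'w measure" and Q :: "'u::{real_inner,banach,second_countable_topology} \<Rightarrow> 'u" and K e lam F \<beta> +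
  fixes S :: "real \<Rightarrow> 'h::{real_inner,banach,second_countable_topology} \<Rightarrow> 'h" and T :: real
    and \<Psi> :: "real \<Rightarrow> 'w \<Rightarrow> 'u \<Rightarrow> 'h"
  assumes S_bounded_linear: "0 \<le> r \<Longrightarrow> bounded_linear (S r)"
    and S_continuous: "continuous_on {0..} (\<lambda>r. S r x)"
    and T: "0 < T" and \<Psi>: "\<Psi> \<in> N2 M F Q T"
begin

lemma S_bound:
  obtains C where "0 \<le> C" "\<And>r x. r \<in> {0..T} \<Longrightarrow> norm (S r x) \<le> C * norm x"
proof (rule uniform_boundedness[of "{0..T}" S])
  show "bounded_linear (S r)" if "r \<in> {0..T}" for r using that S_bounded_linear by simp
  show "\<exists>B. \<forall>r\<in>{0..T}. norm (S r x) \<le> B" for x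
  proof -
    have "compact ((\<lambda>r. S r x) ` {0..T})"
      by (rule compact_continuous_image[OF continuous_on_subset[OF S_continuous]]) auto
    thus ?thesis using compact_imp_bounded bounded_iff by (metis image_eqI)
  qed
qed (rule that)

abbreviation conv :: "real \<Rightarrow> real \<Rightarrow> 'w \<Rightarrow> 'u \<Rightarrow> 'h" where
  "conv t \<equiv> convolution_integrand S \<Psi> t"

lemma \<Psi>_L20: "\<tau> \<in> {0..T} \<Longrightarrow> \<omega> \<in> space M \<Longrightarrow> \<Psi> \<tau> \<omega> \<in> L20 Q"
  and \<Psi>_predictable: "(\<lambda>(\<tau>, \<omega>). \<Psi> \<tau> \<omega> (f k)) \<in> borel_measurable (predictable_algebra M F T)"
  and \<Psi>_finite: "L2sq pm (coords T \<Psi>) < \<infinity>"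
  and \<Psi>_coords: "coords T \<Psi> \<in> borel_measurable pm"
  using \<Psi> N2_iff[of T \<Psi>] N2_coords_measurable[of T \<Psi>] T by (auto simp: predictable_process_iff)

lemma conv_coords:
  "coords t (conv t) (k, \<tau>, \<omega>) = (if \<tau> \<in> {0..t} then S (t - \<tau>) (\<Psi> \<tau> \<omega> (f k)) else 0)"
  by (simp add: coords_def convolution_integrand_def)

lemma conv_coords_le:
  assumes C: "\<And>r x. r \<in> {0..T} \<Longrightarrow> norm (S r x) \<le> C * norm x" "0 \<le> C" and t: "t \<in> {0..T}"
  shows "norm (coords t (conv t) p) \<le> C * norm (coords T \<Psi> p)"
proof -
  obtain k \<tau> \<omega> where p: "p = (k, \<tau>, \<omega>)" by (cases p) auto
  show ?thesis
  proof (cases "\<tau> \<in> {0..t}")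
    case True
    hence "t - \<tau> \<in> {0..T}" "\<tau> \<in> {0..T}" using t by auto
    thus ?thesis using True C(1)[of "t - \<tau>" "\<Psi> \<tau> \<omega> (f k)"] by (simp add: p conv_coords) (simp add: coords_def)
  next
    case False
    hence "coords t (conv t) p = 0" by (auto simp: p conv_coords)
    thus ?thesis using C(2) by simp
  qed
qed

lemma conv_N2:
  assumes t: "t \<in> {0..T}"
  shows "conv t \<in> N2 M F Q t"
proof -
  obtain C where C: "0 \<le> C" "\<And>r x. r \<in> {0..T} \<Longrightarrow> norm (S r x) \<le> C * norm x" by (rule S_bound) (rule that)
  have t': "0 \<le> t" "t \<le> T" using t by auto
  have "(\<lambda>(\<tau>, \<omega>). conv t \<tau> \<omega> (f k)) \<in> borel_measurable (predictable_algebra M F t)" for k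
  proof -
    have "(\<lambda>p. S (t - fst p) ((\<lambda>(\<tau>, \<omega>). \<Psi> \<tau> \<omega> (f k)) p)) \<in> borel_measurable (predictable_algebra M F t)"
      by (rule joint_measurable[OF t' S_bounded_linear S_continuous C predictable_restrict[OF t' \<Psi>_predictable]])
    thus ?thesis by (simp add: convolution_integrand_def case_prod_beta)
  qed
  moreover have "conv t \<tau> \<omega> \<in> L20 Q" if "\<tau> \<in> {0..t}" "\<omega> \<in> space M" for \<tau> \<omega>
    using L20_bounded_linear[OF \<Psi>_L20 S_bounded_linear, of \<tau> \<omega> "t - \<tau>"] that t
    by (simp add: convolution_integrand_def comp_def)
  moreover have "L2sq pm (coords t (conv t)) < \<infinity>"
  proof -
    have "L2sq pm (coords t (conv t)) \<le> L2sq pm (\<lambda>p. C *\<^sub>R coords T \<Psi> p)"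
      using conv_coords_le[OF C(2,1) t] C(1) by (intro L2sq_mono) simp
    also have "\<dots> = ennreal (C\<^sup>2) * L2sq pm (coords T \<Psi>)"
      unfolding L2sq_def using \<Psi>_coords
      by (subst nn_integral_cmult[symmetric]) (auto simp: power_mult_distrib ennreal_mult intro!: nn_integral_cong)
    also have "\<dots> < \<infinity>" using \<Psi>_finite by (simp add: ennreal_mult_less_top)
    finally show ?thesis .
  qed
  ultimately show ?thesis unfolding N2_iff[OF t'(1)] predictable_process_iff by blast
qed

lemma conv_coords_measurable: "t \<in> {0..T} \<Longrightarrow> coords t (conv t) \<in> borel_measurable pm"
  by (rule N2_coords_measurable[OF _ conv_N2]) auto

lemma conv_integral_exists:
  assumes t: "t \<in> {0..T}"
  obtains Y where "Y \<in> borel_measurable (F t)" "has_stochastic_integral M F Q K e \<beta> (conv t) t Y"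
proof -
  have t0: "0 \<le> t" using t by simp
  show thesis
    by (rule stochastic_integral_from_approximation[OF t0 conv_N2[OF t]],
      rule elementary_dense[OF t0 conv_N2[OF t]], assumption, rule that)
qed

text \<open>Two sequences with a common limit are compared, rather than a sequence with its limit,
  because the compactness argument for uniform continuity produces such pairs. The cut-off jumps
  where \<open>\<tau>\<close> meets \<open>c\<close>, so pointwise convergence can fail only on the
  slice \<open>\<tau> = c\<close>, a null set.\<close>

lemma conv_continuous_at:
  assumes s: "\<And>n. s n \<in> {0..T}" "s \<longlonglongrightarrow> c" and t: "\<And>n. t n \<in> {0..T}" "t \<longlonglongrightarrow> c"
  shows "(\<lambda>n. L2sq pm (\<lambda>p. coords (s n) (conv (s n)) p - coords (t n) (conv (t n)) p)) \<longlonglongrightarrow> 0"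
proof -
  obtain C where C: "0 \<le> C" "\<And>r x. r \<in> {0..T} \<Longrightarrow> norm (S r x) \<le> C * norm x" by (rule S_bound) (rule that)
  have [measurable]: "coords (s n) (conv (s n)) \<in> borel_measurable pm" "coords (t n) (conv (t n)) \<in> borel_measurable pm" for n
    using s t by (auto intro: conv_coords_measurable)
  have lim: "(\<lambda>n. coords (s n) (conv (s n)) (k, \<tau>, \<omega>)) \<longlonglongrightarrow> (if 0 \<le> \<tau> \<and> \<tau> < c then S (c - \<tau>) (\<Psi> \<tau> \<omega> (f k)) else 0)"
    if s: "\<And>n. s n \<in> {0..T}" "s \<longlonglongrightarrow> c" and \<tau>: "\<tau> \<noteq> c" for s k \<tau> \<omega>
  proof (cases "0 \<le> \<tau> \<and> \<tau> < c")
    case True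
    have ev: "\<forall>\<^sub>F n in sequentially. \<tau> < s n" using order_tendstoD(1)[OF s(2)] True by blast
    have ev': "\<forall>\<^sub>F n in sequentially. s n - \<tau> \<in> {0..}" using ev by eventually_elim simp
    have "(\<lambda>n. S (s n - \<tau>) (\<Psi> \<tau> \<omega> (f k))) \<longlonglongrightarrow> S (c - \<tau>) (\<Psi> \<tau> \<omega> (f k))"
      by (rule continuous_on_tendsto_compose[OF S_continuous tendsto_diff[OF s(2) tendsto_const] _ ev'])
        (use True in simp)
    moreover have "\<forall>\<^sub>F n in sequentially. S (s n - \<tau>) (\<Psi> \<tau> \<omega> (f k)) = coords (s n) (conv (s n)) (k, \<tau>, \<omega>)"
      using ev by eventually_elim (use True in \<open>simp add: conv_coords\<close>)
    ultimately show ?thesis using True by (simp add: Lim_transform_eventually)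
  next
    case False
    have "\<forall>\<^sub>F n in sequentially. 0 = coords (s n) (conv (s n)) (k, \<tau>, \<omega>)"
    proof (cases "0 \<le> \<tau>")
      case True
      with False \<tau> have "c < \<tau>" by simp
      with order_tendstoD(2)[OF s(2)] have "\<forall>\<^sub>F n in sequentially. s n < \<tau>" by blast
      thus ?thesis by eventually_elim (simp add: conv_coords)
    qed (simp add: conv_coords)
    hence "(\<lambda>n. coords (s n) (conv (s n)) (k, \<tau>, \<omega>)) \<longlonglongrightarrow> 0" by (rule Lim_transform_eventually[OF tendsto_const])
    thus ?thesis by (simp only: False if_False)
  qed
  show ?thesis
  proof (rule L2sq_dominated_convergence)
    have [measurable]: "coords T \<Psi> \<in> borel_measurable pm" by (rule \<Psi>_coords)
    show "(\<lambda>p. 2 * C * norm (coords T \<Psi> p)) \<in> borel_measurable pm" by measurable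
    have "L2sq pm (\<lambda>p. 2 * C * norm (coords T \<Psi> p)) = ennreal ((2 * C)\<^sup>2) * L2sq pm (coords T \<Psi>)"
      unfolding L2sq_def
      by (subst nn_integral_cmult[symmetric]) (auto simp: power_mult_distrib ennreal_mult intro!: nn_integral_cong)
    thus "L2sq pm (\<lambda>p. 2 * C * norm (coords T \<Psi> p)) < \<infinity>" using \<Psi>_finite by (simp add: ennreal_mult_less_top)
    show "norm (coords (s n) (conv (s n)) p - coords (t n) (conv (t n)) p) \<le> 2 * C * norm (coords T \<Psi> p)" for n p
      using conv_coords_le[OF C(2,1) s(1)[of n], of p] conv_coords_le[OF C(2,1) t(1)[of n], of p]
        norm_triangle_ineq4[of "coords (s n) (conv (s n)) p" "coords (t n) (conv (t n)) p"] by simp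
    have "UNIV \<times> {c} \<times> space M \<in> null_sets pm"
    proof -
      interpret P: pair_sigma_finite lborel M ..
      have sf: "sigma_finite_measure TM" by (rule P.sigma_finite_measure_axioms)
      have "emeasure pm (UNIV \<times> ({c} \<times> space M)) = emeasure (count_space UNIV) (UNIV :: nat set) * emeasure TM ({c} \<times> space M)"
        unfolding pm_def by (rule sigma_finite_measure.emeasure_pair_measure_Times[OF sf]) simp_all
      also have "\<dots> = 0" by (simp add: emeasure_Times)
      finally show ?thesis by (simp add: null_sets_def pm_def)
    qed
    thus "AE p in pm. (\<lambda>n. coords (s n) (conv (s n)) p - coords (t n) (conv (t n)) p) \<longlonglongrightarrow> 0"
    proof (rule AE_I')
      show "{p \<in> space pm. \<not> (\<lambda>n. coords (s n) (conv (s n)) p - coords (t n) (conv (t n)) p) \<longlonglongrightarrow> 0} \<subseteq> UNIV \<times> {c} \<times> space M"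
      proof
        fix p assume p: "p \<in> {p \<in> space pm. \<not> (\<lambda>n. coords (s n) (conv (s n)) p - coords (t n) (conv (t n)) p) \<longlonglongrightarrow> 0}"
        hence "p \<in> space pm" by simp
        then obtain k \<tau> \<omega> where q: "p = (k, \<tau>, \<omega>)" "\<omega> \<in> space M" by (rule space_pm_cases)
        have "\<tau> = c"
        proof (rule ccontr)
          assume "\<tau> \<noteq> c"
          from tendsto_diff[OF lim[OF s this] lim[OF t this], of k \<omega> k \<omega>] p
          show False by (simp add: q)
        qed
        thus "p \<in> UNIV \<times> {c} \<times> space M" using q by simp
      qed
    qed
  qed measurable
qed

text \<open>Heine-Cantor by contradiction: bad pairs at distance at most
  \<open>1 / real (Suc n)\<close> have a subsequence along which both points converge to the same
  \<open>c\<close>, where \<open>conv_continuous_at\<close> makes the mean square difference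
  small.\<close>

lemma conv_uniformly_continuous:
  assumes \<epsilon>: "0 < (\<epsilon>::real)"
  shows "\<exists>\<delta>>0. \<forall>s\<in>{0..T}. \<forall>t\<in>{0..T}. \<bar>s - t\<bar> \<le> \<delta> \<longrightarrow>
    L2sq pm (\<lambda>p. coords s (conv s) p - coords t (conv t) p) \<le> ennreal \<epsilon>"
proof (rule ccontr)
  let ?d = "\<lambda>s t. L2sq pm (\<lambda>p. coords s (conv s) p - coords t (conv t) p)"
  assume no: "\<not> (\<exists>\<delta>>0. \<forall>s\<in>{0..T}. \<forall>t\<in>{0..T}. \<bar>s - t\<bar> \<le> \<delta> \<longrightarrow> ?d s t \<le> ennreal \<epsilon>)"
  have "\<forall>n. \<exists>s t. s \<in> {0..T} \<and> t \<in> {0..T} \<and> \<bar>s - t\<bar> \<le> 1 / real (Suc n) \<and> \<not> ?d s t \<le> ennreal \<epsilon>"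
  proof
    fix n
    have "0 < 1 / real (Suc n)" by simp
    with no show "\<exists>s t. s \<in> {0..T} \<and> t \<in> {0..T} \<and> \<bar>s - t\<bar> \<le> 1 / real (Suc n) \<and> \<not> ?d s t \<le> ennreal \<epsilon>"
      by blast
  qed
  then obtain s t where "\<forall>n. s n \<in> {0..T} \<and> t n \<in> {0..T} \<and> \<bar>s n - t n\<bar> \<le> 1 / real (Suc n) \<and> \<not> ?d (s n) (t n) \<le> ennreal \<epsilon>"
    unfolding choice_iff by blast
  hence st: "s n \<in> {0..T}" "t n \<in> {0..T}" "\<bar>s n - t n\<bar> \<le> 1 / real (Suc n)" "\<not> ?d (s n) (t n) \<le> ennreal \<epsilon>" for n
    by blast+
  obtain c r where r: "strict_mono (r :: nat \<Rightarrow> nat)" "(s \<circ> r) \<longlonglongrightarrow> c"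
    using st(1) compact_Icc[of 0 T, unfolded compact_def, rule_format, of s] by blast
  have "(\<lambda>n. s n - t n) \<longlonglongrightarrow> 0"
    by (rule Lim_null_comparison[OF _ LIMSEQ_Suc[OF lim_1_over_n]]) (use st(3) in simp)
  hence "(\<lambda>n. s (r n) - t (r n)) \<longlonglongrightarrow> 0" using LIMSEQ_subseq_LIMSEQ[OF _ r(1)] by (fastforce simp: o_def)
  from tendsto_diff[OF r(2) this] have "(\<lambda>n. t (r n)) \<longlonglongrightarrow> c" by simp
  from conv_continuous_at[of "s \<circ> r" c "\<lambda>n. t (r n)", OF _ r(2) _ this]
  have "(\<lambda>n. ?d (s (r n)) (t (r n))) \<longlonglongrightarrow> 0" using st by simp
  hence "\<forall>\<^sub>F n in sequentially. ?d (s (r n)) (t (r n)) < ennreal \<epsilon>" using \<epsilon> by (intro order_tendstoD) auto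
  then obtain n where "?d (s (r n)) (t (r n)) < ennreal \<epsilon>" by (auto simp: eventually_sequentially)
  with st(4)[of "r n"] show False by simp
qed

lemma predictable_version:
  "has_predictable_version M F T (stochastic_convolution M F Q K e \<beta> S \<Psi>)"
proof -
  have T0: "0 \<le> T" using T by simp
  have "\<forall>t\<in>{0..T}. \<exists>Y. Y \<in> borel_measurable (F t) \<and> has_stochastic_integral M F Q K e \<beta> (conv t) t Y"
    using conv_integral_exists by metis
  then obtain Y where Y: "\<And>t. t \<in> {0..T} \<Longrightarrow> Y t \<in> borel_measurable (F t)"
    "\<And>t. t \<in> {0..T} \<Longrightarrow> has_stochastic_integral M F Q K e \<beta> (conv t) t (Y t)" by metis
  have YM: "t \<in> {0..T} \<Longrightarrow> Y t \<in> borel_measurable M" for t using measurable_F_M[OF _ Y(1)] by simp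
  have "\<forall>n. \<exists>N>0. \<forall>s\<in>{0..T}. \<forall>t\<in>{0..T}. \<bar>s - t\<bar> \<le> T / real N \<longrightarrow> L2sq M (\<lambda>\<omega>. Y s \<omega> - Y t \<omega>) \<le> ennreal ((1/2)^n)"
  proof
    fix n :: nat
    \<comment> \<open>The division by 16 cancels the constant of
      \<open>stochastic_integral_diff_le\<close> and leaves the summable bound
      \<open>(1/2)^n\<close>.\<close>
    have "0 < (1/2 :: real)^n / 16" by simp
    from conv_uniformly_continuous[OF this]
    obtain \<delta> where \<delta>: "0 < \<delta>" "\<And>s t. s \<in> {0..T} \<Longrightarrow> t \<in> {0..T} \<Longrightarrow> \<bar>s - t\<bar> \<le> \<delta> \<Longrightarrow>
        L2sq pm (\<lambda>p. coords s (conv s) p - coords t (conv t) p) \<le> ennreal ((1/2)^n / 16)"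
      by blast
    obtain N :: nat where N: "T / \<delta> < real N" using reals_Archimedean2 by blast
    have N0: "0 < real N" using N T \<delta> by (meson divide_pos_pos less_trans)
    have N\<delta>: "T / real N \<le> \<delta>" using N N0 \<delta> by (simp add: field_simps)
    have "L2sq M (\<lambda>\<omega>. Y s \<omega> - Y t \<omega>) \<le> ennreal ((1/2)^n)"
      if st: "s \<in> {0..T}" "t \<in> {0..T}" "\<bar>s - t\<bar> \<le> T / real N" for s t
    proof -
      have "L2sq M (\<lambda>\<omega>. Y s \<omega> - Y t \<omega>) \<le> 16 * L2sq pm (\<lambda>p. coords s (conv s) p - coords t (conv t) p)"
        by (rule stochastic_integral_diff_le) (use st Y(2) in auto)
      also have "\<dots> \<le> 16 * ennreal ((1/2)^n / 16)"
        by (intro mult_left_mono \<delta>(2) st order_trans[OF st(3) N\<delta>]) auto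
      also have "\<dots> = ennreal (16 * ((1/2)^n / 16))" by (subst ennreal_mult) auto
      also have "16 * ((1/2)^n / 16) = (1/2 :: real)^n" by simp
      finally show ?thesis .
    qed
    thus "\<exists>N>0. \<forall>s\<in>{0..T}. \<forall>t\<in>{0..T}. \<bar>s - t\<bar> \<le> T / real N \<longrightarrow> L2sq M (\<lambda>\<omega>. Y s \<omega> - Y t \<omega>) \<le> ennreal ((1/2)^n)"
      using N0 by (intro exI[of _ N]) auto
  qed
  then obtain N where "\<forall>n. 0 < N n \<and> (\<forall>s\<in>{0..T}. \<forall>t\<in>{0..T}. \<bar>s - t\<bar> \<le> T / real (N n) \<longrightarrow> L2sq M (\<lambda>\<omega>. Y s \<omega> - Y t \<omega>) \<le> ennreal ((1/2)^n))"
    unfolding choice_iff by blast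
  hence N: "0 < N n" "s \<in> {0..T} \<Longrightarrow> t \<in> {0..T} \<Longrightarrow> \<bar>s - t\<bar> \<le> T / real (N n) \<Longrightarrow> L2sq M (\<lambda>\<omega>. Y s \<omega> - Y t \<omega>) \<le> ennreal ((1/2)^n)" for n s t
    by blast+
  \<comment> \<open>On a cell the value is taken at the left endpoint, where it is measurable for
    the filtration at the start of the cell; time 0 lies in no cell and gets its own term.\<close>
  define V where "V n \<tau> \<omega> = indicat_real {0} \<tau> *\<^sub>R Y 0 \<omega> +
    (\<Sum>m<N n. indicat_real {grid T (N n) m<..grid T (N n) (Suc m)} \<tau> *\<^sub>R Y (grid T (N n) m) \<omega>)" for n \<tau> \<omega>
  have gridT: "grid T (N n) m \<in> {0..T}" "grid T (N n) (Suc m) \<le> T" if "m < N n" for n m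
  proof -
    have "grid T (N n) (Suc m) \<le> grid T (N n) (N n)" by (rule grid_mono) (use T that in auto)
    also have "\<dots> = T" using N(1)[of n] by (simp add: grid_def)
    finally show "grid T (N n) (Suc m) \<le> T" .
    moreover have "grid T (N n) m \<le> grid T (N n) (Suc m)" by (rule grid_mono) (use T in auto)
    ultimately show "grid T (N n) m \<in> {0..T}" using grid_nonneg[of T "N n" m] T by simp
  qed
  have Vm: "(\<lambda>(\<tau>, \<omega>). V n \<tau> \<omega>) \<in> borel_measurable (predictable_algebra M F T)" for n
    unfolding V_def case_prod_beta
  proof (intro borel_measurable_add borel_measurable_sum)
    show "(\<lambda>p. indicat_real {0} (fst p) *\<^sub>R Y 0 (snd p)) \<in> borel_measurable (predictable_algebra M F T)"
      using predictable_product[OF T0 order_refl rectangle_predictable_0[OF T0] Y(1)[of 0]] T by (simp add: case_prod_beta')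
    fix m assume m: "m \<in> {..<N n}"
    let ?g = "grid T (N n)"
    have lt: "?g m < ?g (Suc m)" using T N(1)[of n] by (simp add: grid_Suc)
    have "{?g m<..?g (Suc m)} \<times> A \<in> sets (predictable_algebra M F T)" if "A \<in> sets (F (?g m))" for A
      using rectangle_predictable[OF _ lt _ that] gridT[of m n] m by simp
    from predictable_product[OF T0 _ this Y(1)] gridT[of m n] m
    show "(\<lambda>p. indicat_real {?g m<..?g (Suc m)} (fst p) *\<^sub>R Y (?g m) (snd p)) \<in> borel_measurable (predictable_algebra M F T)"
      by (simp add: case_prod_beta')
  qed
  \<comment> \<open>At each time \<open>V n t\<close> is a single variable \<open>Y s\<close> with
    \<open>s\<close> within one mesh of \<open>t\<close>; the mean square error is therefore bounded
    uniformly in \<open>t\<close>.\<close>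
  have V_le: "\<exists>s\<in>{0..T}. \<bar>s - t\<bar> \<le> T / real (N n) \<and> V n t = Y s" if t: "t \<in> {0..T}" for n t
  proof (cases "t = 0")
    case True
    have "indicat_real {grid T (N n) m<..grid T (N n) (Suc m)} 0 = 0" for m
      using grid_nonneg[of T "N n" m] T by (simp add: indicator_def)
    hence "V n t = Y 0" by (simp add: V_def True fun_eq_iff)
    thus ?thesis using True T N(1)[of n] by (intro bexI[of _ 0]) auto
  next
    case False
    let ?g = "grid T (N n)"
    obtain m where m: "m < N n" "t \<in> {?g m<..?g (Suc m)}"
      using grid_cell_exists[OF T N(1)[of n], of t] t False by auto
    have "V n t \<omega> = Y (?g m) \<omega>" for \<omega>
    proof -
      have "(\<Sum>j<N n. indicat_real {?g j<..?g (Suc j)} t *\<^sub>R Y (?g j) \<omega>) = (\<Sum>j<N n. if j = m then Y (?g m) \<omega> else 0)"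
      proof (rule sum.cong[OF refl])
        fix j
        show "indicat_real {?g j<..?g (Suc j)} t *\<^sub>R Y (?g j) \<omega> = (if j = m then Y (?g m) \<omega> else 0)"
        proof (cases "j = m")
          case True
          thus ?thesis by (simp add: indicator_simps(1)[OF m(2)] del: greaterThanAtMost_iff)
        next
          case False
          hence "t \<notin> {?g j<..?g (Suc j)}" using grid_cell_unique[OF T0 _ m(2), of j] by blast
          thus ?thesis using False by (simp add: indicator_simps(2) del: greaterThanAtMost_iff)
        qed
      qed
      thus ?thesis using m(1) False by (simp add: V_def)
    qed
    moreover have "\<bar>?g m - t\<bar> \<le> T / real (N n)" using m(2) by (auto simp: grid_Suc)
    ultimately show ?thesis using gridT(1)[OF m(1)] by (intro bexI[of _ "?g m"]) auto
  qed
  \<comment> \<open>Defined at every point, whether or not the limit exists, so predictability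
    passes from the \<open>V n\<close> to \<open>W\<close> without exceptional sets.\<close>
  define W where "W t \<omega> = lim (\<lambda>n. V n t \<omega>)" for t \<omega>
  have "predictable_process M F T borel W"
  proof -
    have "(\<lambda>p. lim (\<lambda>n. (\<lambda>(\<tau>, \<omega>). V n \<tau> \<omega>) p)) \<in> borel_measurable (predictable_algebra M F T)"
      using Vm by (rule borel_measurable_lim_metric)
    thus ?thesis by (simp add: predictable_process_def W_def case_prod_beta)
  qed
  moreover have "AE \<omega> in M. W t \<omega> = stochastic_convolution M F Q K e \<beta> S \<Psi> t \<omega>" if t: "t \<in> {0..T}" for t
  proof -
    have VM: "V n t \<in> borel_measurable M" for n using V_le[OF t, of n] YM by auto
    have "L2sq M (\<lambda>\<omega>. V n t \<omega> - Y t \<omega>) \<le> ennreal ((1/2)^n)" for n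
      using V_le[OF t, of n] N(2)[of _ t n] t by auto
    hence "(\<Sum>n. L2sq M (\<lambda>\<omega>. V n t \<omega> - Y t \<omega>)) \<le> (\<Sum>n. ennreal ((1/2)^n))"
      by (intro suminf_le summableI)
    also have "\<dots> < \<infinity>"
      unfolding infinity_ennreal_def less_top[symmetric]
      by (rule ennreal_suminf_neq_top) (simp_all add: summable_geometric)
    finally have lim: "AE \<omega> in M. (\<lambda>n. V n t \<omega>) \<longlonglongrightarrow> Y t \<omega>"
      by (rule AE_LIMSEQ_of_summable_L2sq[OF VM YM[OF t]])
    \<comment> \<open>An integral exists, so \<open>SOME\<close> returns one; by uniqueness it
      agrees with \<open>Y t\<close> almost surely.\<close>
    have "has_stochastic_integral M F Q K e \<beta> (conv t) t (stochastic_convolution M F Q K e \<beta> S \<Psi> t)"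
      unfolding stochastic_convolution_def stochastic_integral_def
      using Y(2)[OF t] by (rule someI[where P="has_stochastic_integral M F Q K e \<beta> (conv t) t"])
    hence "AE \<omega> in M. Y t \<omega> = stochastic_convolution M F Q K e \<beta> S \<Psi> t \<omega>"
      using t by (intro stochastic_integral_unique[OF _ Y(2)[OF t]]) auto
    with lim show ?thesis
      by eventually_elim (simp add: W_def limI)
  qed
  ultimately show ?thesis unfolding has_predictable_version_def by blast
qed

end

text \<open>The first conjunct certifies that the choice inside
  \<open>stochastic_convolution\<close> picks genuine integrals, so the second one really speaks
  about the stochastic convolution.\<close>

theorem proposition2:
  fixes M :: "'w measure" and F :: "real \<Rightarrow> 'w measure"
    and Q :: "'u::{real_inner,banach,second_countable_topology} \<Rightarrow> 'u"
    and K :: "nat set" and e :: "nat \<Rightarrow> 'u" and lam :: "nat \<Rightarrow> real"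
    and \<beta> :: "nat \<Rightarrow> real \<Rightarrow> 'w \<Rightarrow> real"
    and D :: "'h::{real_inner,banach,second_countable_topology} set" and A :: "'h \<Rightarrow> 'h"
    and a :: "real \<Rightarrow> real" and S :: "real \<Rightarrow> 'h \<Rightarrow> 'h"
    and T :: real and \<Psi> :: "real \<Rightarrow> 'w \<Rightarrow> 'u \<Rightarrow> 'h"
  assumes "prob_space M" and "normal_filtration M F"
    and "cylindrical_wiener_process M F Q K e lam \<beta>"
    and "closed_densely_defined D A" and "locally_integrable a"
    and "volterra_resolvent a D A S"
    and "0 < T" and "\<Psi> \<in> N2 M F Q T"
  shows "(\<forall>t\<in>{0..T}. \<exists>Y. has_stochastic_integral M F Q K e \<beta> (convolution_integrand S \<Psi> t) t Y) \<and>
         has_predictable_version M F T (stochastic_convolution M F Q K e \<beta> S \<Psi>)"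
proof -
  have "wiener_setting M Q K e lam F \<beta>"
    using assms(1,2,3)
    unfolding wiener_setting_def wiener_setting_axioms_def diagonal_operator_def
      cylindrical_wiener_process_def orthonormal_family_def by blast
  moreover have "convolution_setting_axioms M Q F S T \<Psi>"
    using assms(6,7,8) unfolding convolution_setting_axioms_def volterra_resolvent_def by blast
  ultimately interpret convolution_setting M Q K e lam F \<beta> S T \<Psi>
    by (rule convolution_setting.intro)
  show ?thesis using conv_integral_exists predictable_version by metis
qed

end
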